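(* Let $\varphi\in\mathcal S(\mathbb R^d)$ with $\|\varphi\|_2=1$, and let $\{\Omega_\gamma:\gamma\in\Gamma\}$ be an admissible cover of $\mathbb R^{2d}$. Then there exists a constant $\alpha>0$ such that for every choice of numbers $\{N_\gamma:\gamma\in\Gamma\}\subseteq\mathbb N$ satisfying $\alpha|\Omega_\gamma|\le N_\gamma$ for all $\gamma$ and $\sup_{\gamma\in\Gamma}N_\gamma<+\infty$, the family $\{\lambda^{\Omega_\gamma}_k\phi^{\Omega_\gamma}_k:\gamma\in\Gamma,\ 1\le k\le N_\gamma\}$ is a frame of $L^2(\mathbb R^d)$; that is, there are constants $0<A\le B<\infty$ with $$A\|f\|_2^2\le\sum_{\gamma\in\Gamma}\sum_{k=1}^{N_\gamma}|\langle f,\lambda^{\Omega_\gamma}_k\phi^{\Omega_\gamma}_k\rangle|^2\le B\|f\|_2^2,\qquad f\in L^2(\mathbb R^d).$$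
   Context: For $z=(x,\xi)\in\mathbb R^d\times\mathbb R^d$ and $f\in L^2(\mathbb R^d)$, the short-time Fourier transform is $V_\varphi f(x,\xi)=\int_{\mathbb R^d}f(t)\overline{\varphi(t-x)}e^{-2\pi i\xi t}\,dt$. For a bounded measurable set $\Omega\subseteq\mathbb R^{2d}$ the time-frequency localization operator is $H_\Omega f(t)=\int_\Omega V_\varphi f(x,\xi)\varphi(t-x)e^{2\pi i\xi t}\,dx\,d\xi$; it is self-adjoint, positive and trace class, with spectral decomposition $H_\Omega f=\sum_{k\ge1}\lambda^\Omega_k\langle f,\phi^\Omega_k\rangle\phi^\Omega_k$, where $\{\phi^\Omega_k\}_k$ is orthonormal and the eigenvalues $\lambda^\Omega_k\ge0$ are listed in non-increasing order. $|\Omega|$ denotes Lebesgue measure. An indexed family $\{\Omega_\gamma:\gamma\in\Gamma\}$ is an admissible cover of $\mathbb R^{2d}$ if: $\Gamma\subseteq\mathbb R^{2d}$ with $\sup_{z\in\mathbb R^{2d}}\#(\Gamma\cap B_1(z))<\infty$; each $\Omega_\gamma$ is a measurable subset of $\mathbb R^{2d}$; $\bigcup_\gamma\Omega_\gamma=\mathbb R^{2d}$; and there is $R>0$ with $\Omega_\gamma\subseteq B_R(\gamma)$ for all $\gamma\in\Gamma$. *)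

theory Defs
  imports "HOL-Analysis.Analysis"
begin

definition L2 :: "('a::euclidean_space \<Rightarrow> complex) \<Rightarrow> bool" where
  "L2 f \<longleftrightarrow> f \<in> borel_measurable lebesgue \<and> integrable lebesgue (\<lambda>x. (cmod (f x))\<^sup>2)"

definition L2_inner :: "('a::euclidean_space \<Rightarrow> complex) \<Rightarrow> ('a \<Rightarrow> complex) \<Rightarrow> complex" where
  "L2_inner f g = (\<integral>x. f x * cnj (g x) \<partial>lebesgue)"

definition L2_norm :: "('a::euclidean_space \<Rightarrow> complex) \<Rightarrow> real" where
  "L2_norm f = sqrt (\<integral>x. (cmod (f x))\<^sup>2 \<partial>lebesgue)"

fun pderivs :: "'a list \<Rightarrow> ('a::real_normed_vector \<Rightarrow> 'b::real_normed_vector) \<Rightarrow> 'a \<Rightarrow> 'b" where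
  "pderivs [] f = f"
| "pderivs (v # vs) f = (\<lambda>x. frechet_derivative (pderivs vs f) (at x) v)"

definition schwartz :: "('a::euclidean_space \<Rightarrow> complex) \<Rightarrow> bool" where
  "schwartz f \<longleftrightarrow>
     (\<forall>vs. set vs \<subseteq> Basis \<longrightarrow>
        (\<forall>x. pderivs vs f differentiable at x) \<and>
        (\<forall>k::nat. bounded (range (\<lambda>x. (norm x) ^ k *\<^sub>R pderivs vs f x))))"

definition stft :: "('a::euclidean_space \<Rightarrow> complex) \<Rightarrow> ('a \<Rightarrow> complex) \<Rightarrow> 'a \<times> 'a \<Rightarrow> complex" where
  "stft \<phi> f z = (\<integral>t. f t * cnj (\<phi> (t - fst z)) * cis (- 2 * pi * (snd z \<bullet> t)) \<partial>lebesgue)"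

definition loc_op :: "('a::euclidean_space \<Rightarrow> complex) \<Rightarrow> ('a \<times> 'a) set \<Rightarrow> ('a \<Rightarrow> complex) \<Rightarrow> 'a \<Rightarrow> complex" where
  "loc_op \<phi> \<Omega> f t =
     (LINT z:\<Omega>|lebesgue. stft \<phi> f z * \<phi> (t - fst z) * cis (2 * pi * (snd z \<bullet> t)))"

definition spectral_decomp ::
  "('a::euclidean_space \<Rightarrow> complex) \<Rightarrow> ('a \<times> 'a) set \<Rightarrow> (nat \<Rightarrow> real) \<Rightarrow> (nat \<Rightarrow> 'a \<Rightarrow> complex) \<Rightarrow> bool" where
  "spectral_decomp \<phi> \<Omega> lam e \<longleftrightarrow>
     (\<forall>k\<ge>1. L2 (e k)) \<and>
     (\<forall>j\<ge>1. \<forall>k\<ge>1. L2_inner (e j) (e k) = (if j = k then 1 else 0)) \<and>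
     (\<forall>k\<ge>1. 0 \<le> lam k \<and> lam (Suc k) \<le> lam k) \<and>
     (\<forall>f. L2 f \<longrightarrow>
        (\<lambda>n. L2_norm (\<lambda>t. loc_op \<phi> \<Omega> f t
               - (\<Sum>k=1..n. complex_of_real (lam k) * L2_inner f (e k) * e k t)))
        \<longlonglongrightarrow> 0)"

definition admissible_cover :: "('a::euclidean_space \<times> 'a) set \<Rightarrow> ('a \<times> 'a \<Rightarrow> ('a \<times> 'a) set) \<Rightarrow> bool" where
  "admissible_cover \<Gamma> \<Omega> \<longleftrightarrow>
     (\<exists>M::nat. \<forall>z. finite (\<Gamma> \<inter> ball z 1) \<and> card (\<Gamma> \<inter> ball z 1) \<le> M) \<and>
     (\<forall>\<gamma>\<in>\<Gamma>. \<Omega> \<gamma> \<in> sets lebesgue) \<and>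
     (\<Union>\<gamma>\<in>\<Gamma>. \<Omega> \<gamma>) = UNIV \<and>
     (\<exists>R>0. \<forall>\<gamma>\<in>\<Gamma>. \<Omega> \<gamma> \<subseteq> ball \<gamma> R)"

definition is_frame :: "'i set \<Rightarrow> ('i \<Rightarrow> 'a::euclidean_space \<Rightarrow> complex) \<Rightarrow> bool" where
  "is_frame I g \<longleftrightarrow>
     (\<exists>A B. 0 < A \<and> A \<le> B \<and>
        (\<forall>f. L2 f \<longrightarrow>
           (\<lambda>i. (cmod (L2_inner f (g i)))\<^sup>2) summable_on I \<and>
           A * (L2_norm f)\<^sup>2 \<le> (\<Sum>\<^sub>\<infinity>i\<in>I. (cmod (L2_inner f (g i)))\<^sup>2) \<and>
           (\<Sum>\<^sub>\<infinity>i\<in>I. (cmod (L2_inner f (g i)))\<^sup>2) \<le> B * (L2_norm f)\<^sup>2))"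

end

theory Submission
  imports Defs "HOL-Probability.Characteristic_Functions" "HOL-Probability.Sinc_Integral"
begin

text \<open>
  Write V for the short-time Fourier transform and H for the localization operator of a cell. Since V is
  an isometry, the form of H at f is the energy of V f on the cell, so these forms add up to at least the
  squared norm of f and, by bounded overlap, to at most a multiple of it.

  Lower bound for the sum of the squared norms of H f: split f as G f + (f - G f), where G localizes to
  the ball of radius R + r around the centre of the cell. The terms (H f, G f) are controlled by
  Cauchy-Schwarz and bounded overlap. By the reproducing formula the terms (H f, f - G f) only involve
  pairs of phase-space points at distance at least r; as the ambiguity function of a Schwartz window is
  integrable, a Schur estimate makes their sum at most half the squared norm of f once r is large.

  Truncation: Bessel's inequality shows that k times the k-th eigenvalue of H is at most the measure of
  the cell, so every discarded eigenvalue is at most 1 / \<alpha>, and the discarded part of the squared norms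
  is at most 1 / \<alpha> times the total energy.
\<close>

subsection \<open>Square-integrable functions\<close>

text \<open>Energies carry \<open>lam k\<close>, while the frame coefficients carry
  \<open>(lam k)\<^sup>2\<close>. Since the eigenvalues of one cell may be arbitrarily small, the
  energy on a single cell is in general not controlled by the squared norm of H f there; only the
  sum over all cells is, and only up to a share of the squared norm of f that is absorbed on the
  left. The constants are chosen in an order without circularity: the overlap \<open>M0\<close> of
  the cells, then r in terms of \<open>M0\<close> and the decay of the ambiguity function, then the
  overlap \<open>M\<close> of the enlarged balls, and at last \<alpha> = 8 M M0. Truncation then
  costs at most 1 / (8 M) times the squared norm of f, little enough to be absorbed as well. All
  estimates concern one fixed f and finitely many cells, with constants independent of both, so no
  series of operators ever has to be summed. The isometry itself rests on Plancherel's theorem,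
  obtained by Gaussian regularization, and the integrability of the ambiguity function on
  integration by parts against the derivatives of the window.\<close>

lemma borel_measurable_cnj [measurable (raw)]:
  "f \<in> borel_measurable M \<Longrightarrow> (\<lambda>x. cnj (f x)) \<in> borel_measurable M"
  using measurable_compose[OF _ borel_measurable_continuous_onI[of cnj]]
  by (auto intro: continuous_intros)

lemma L2_measurable: "L2 f \<Longrightarrow> f \<in> borel_measurable lebesgue"
  by (simp add: L2_def)

lemma L2_norm_nonneg [simp]: "0 \<le> L2_norm f"
  by (simp add: L2_norm_def)

lemma L2_norm_sq: "(L2_norm f)\<^sup>2 = (\<integral>x. (cmod (f x))\<^sup>2 \<partial>lebesgue)"
  by (simp add: L2_norm_def)

lemma L2_dominated:
  assumes "f \<in> borel_measurable lebesgue" "integrable lebesgue h" "\<And>x. (cmod (f x))\<^sup>2 \<le> h x"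
  shows "L2 f"
  unfolding L2_def
proof (intro conjI assms(1))
  note [measurable] = assms(1)
  show "integrable lebesgue (\<lambda>x. (cmod (f x))\<^sup>2)"
  proof (rule Bochner_Integration.integrable_bound[OF assms(2)])
    show "AE x in lebesgue. norm ((cmod (f x))\<^sup>2) \<le> norm (h x)"
      using assms(3) by (auto intro!: AE_I2 simp: order_trans[OF _ abs_ge_self])
  qed measurable
qed

lemma L2_zero [simp]: "L2 (\<lambda>x. 0)"
  by (simp add: L2_def)

lemma L2_cmult: "L2 f \<Longrightarrow> L2 (\<lambda>x. c * f x)"
  by (auto simp: L2_def norm_mult power_mult_distrib)

lemma cmod_add_sq_le: "(cmod (a + b))\<^sup>2 \<le> 2 * (cmod a)\<^sup>2 + 2 * (cmod b)\<^sup>2"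
proof -
  have "(cmod (a + b))\<^sup>2 \<le> (cmod a + cmod b)\<^sup>2"
    by (intro power_mono norm_triangle_ineq) auto
  also have "\<dots> \<le> 2 * (cmod a)\<^sup>2 + 2 * (cmod b)\<^sup>2"
    using sum_squares_bound[of "cmod a" "cmod b"] by (simp add: power2_sum)
  finally show ?thesis .
qed

lemma L2_add:
  assumes "L2 f" "L2 g"
  shows "L2 (\<lambda>x. f x + g x)"
proof (rule L2_dominated[where h="\<lambda>x. 2 * (cmod (f x))\<^sup>2 + 2 * (cmod (g x))\<^sup>2"])
  show "(\<lambda>x. f x + g x) \<in> borel_measurable lebesgue"
    using assms by (auto simp: L2_def)
qed (use assms in \<open>auto simp: L2_def cmod_add_sq_le\<close>)

lemma L2_diff:
  assumes "L2 f" "L2 g"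
  shows "L2 (\<lambda>x. f x - g x)"
  using L2_add[OF assms(1) L2_cmult[OF assms(2), of "-1"]] by simp

lemma L2_sum: "(\<And>i. i \<in> I \<Longrightarrow> L2 (f i)) \<Longrightarrow> L2 (\<lambda>x. \<Sum>i\<in>I. f i x)"
  by (induction I rule: infinite_finite_induct) (auto intro: L2_add)

lemma integrable_L2_mult:
  assumes "L2 f" "L2 g"
  shows "integrable lebesgue (\<lambda>x. f x * cnj (g x))"
proof -
  have [measurable]: "f \<in> borel_measurable lebesgue" "g \<in> borel_measurable lebesgue"
    using assms by (auto simp: L2_def)
  show ?thesis
  proof (rule Bochner_Integration.integrable_bound[where f="\<lambda>x. (cmod (f x))\<^sup>2 + (cmod (g x))\<^sup>2"])
    have "cmod (f x) * cmod (g x) \<le> (cmod (f x))\<^sup>2 + (cmod (g x))\<^sup>2" for x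
      using sum_squares_bound[of "cmod (f x)" "cmod (g x)"]
        mult_nonneg_nonneg[OF norm_ge_zero norm_ge_zero, of "f x" "g x"] by linarith
    then show "AE x in lebesgue. norm (f x * cnj (g x)) \<le> norm ((cmod (f x))\<^sup>2 + (cmod (g x))\<^sup>2)"
      by (auto simp: norm_mult)
    show "(\<lambda>x. f x * cnj (g x)) \<in> borel_measurable lebesgue"
      by measurable
  qed (use assms in \<open>auto simp: L2_def\<close>)
qed

lemma L2_inner_commute: "L2_inner g f = cnj (L2_inner f g)"
  unfolding L2_inner_def by (subst Bochner_Integration.integral_cnj[symmetric]) (simp add: mult.commute)

lemma L2_inner_add_left: "L2 f \<Longrightarrow> L2 g \<Longrightarrow> L2 h \<Longrightarrow>
    L2_inner (\<lambda>x. f x + g x) h = L2_inner f h + L2_inner g h"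
  by (simp add: L2_inner_def distrib_right integrable_L2_mult)

lemma L2_inner_diff_left: "L2 f \<Longrightarrow> L2 g \<Longrightarrow> L2 h \<Longrightarrow>
    L2_inner (\<lambda>x. f x - g x) h = L2_inner f h - L2_inner g h"
  by (simp add: L2_inner_def left_diff_distrib integrable_L2_mult)

lemma L2_inner_cmult_left: "L2_inner (\<lambda>x. c * f x) h = c * L2_inner f h"
  by (simp add: L2_inner_def mult.assoc)

lemma L2_inner_sum_left: "(\<And>i. i \<in> I \<Longrightarrow> L2 (f i)) \<Longrightarrow> L2 h \<Longrightarrow>
    L2_inner (\<lambda>x. \<Sum>i\<in>I. f i x) h = (\<Sum>i\<in>I. L2_inner (f i) h)"
  by (simp add: L2_inner_def sum_distrib_right integrable_L2_mult)

lemma L2_inner_diff_right: "L2 f \<Longrightarrow> L2 g \<Longrightarrow> L2 h \<Longrightarrow>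
    L2_inner h (\<lambda>x. f x - g x) = L2_inner h f - L2_inner h g"
  by (metis L2_inner_commute L2_inner_diff_left complex_cnj_diff)

lemma L2_inner_cmult_right: "L2_inner h (\<lambda>x. c * f x) = cnj c * L2_inner h f"
  by (metis L2_inner_commute L2_inner_cmult_left complex_cnj_mult complex_cnj_cnj)

lemma L2_inner_sum_right: "(\<And>i. i \<in> I \<Longrightarrow> L2 (f i)) \<Longrightarrow> L2 h \<Longrightarrow>
    L2_inner h (\<lambda>x. \<Sum>i\<in>I. f i x) = (\<Sum>i\<in>I. L2_inner h (f i))"
  by (subst L2_inner_commute, subst L2_inner_sum_left)
     (auto simp: L2_inner_commute[of h])

lemma L2_inner_self: "L2_inner f f = complex_of_real ((L2_norm f)\<^sup>2)"
proof -
  have "L2_inner f f = (\<integral>x. complex_of_real ((cmod (f x))\<^sup>2) \<partial>lebesgue)"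
    unfolding L2_inner_def by (simp only: complex_norm_square)
  then show ?thesis by (simp only: L2_norm_sq integral_complex_of_real)
qed

lemma L2_norm_add_sq:
  assumes "L2 f" "L2 g"
  shows "(L2_norm (\<lambda>x. f x + g x))\<^sup>2 = (L2_norm f)\<^sup>2 + (L2_norm g)\<^sup>2 + 2 * Re (L2_inner f g)"
proof -
  have "complex_of_real ((L2_norm (\<lambda>x. f x + g x))\<^sup>2)
      = L2_inner f (\<lambda>x. f x + g x) + L2_inner g (\<lambda>x. f x + g x)"
    by (simp only: L2_inner_self[symmetric] L2_inner_add_left assms L2_add)
  also have "L2_inner f (\<lambda>x. f x + g x) = L2_inner f f + L2_inner f g"
    by (metis L2_inner_commute L2_inner_add_left complex_cnj_add assms)
  also have "L2_inner g (\<lambda>x. f x + g x) = cnj (L2_inner f g) + L2_inner g g"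
    by (metis L2_inner_commute L2_inner_add_left complex_cnj_add assms)
  finally have "Re (complex_of_real ((L2_norm (\<lambda>x. f x + g x))\<^sup>2))
     = Re (L2_inner f f + L2_inner f g + (cnj (L2_inner f g) + L2_inner g g))" by simp
  then show ?thesis by (simp add: L2_inner_self)
qed

text \<open>The moduli stand inside the integral because the absolute integrability demanded by
  Fubini's theorem is derived from this form; the usual bound on the inner product is a
  consequence.\<close>

lemma L2_abs_Cauchy_Schwarz:
  assumes "L2 f" "L2 g"
  shows "(\<integral>x. cmod (f x) * cmod (g x) \<partial>lebesgue) \<le> L2_norm f * L2_norm g"
proof -
  have [measurable]: "f \<in> borel_measurable lebesgue" "g \<in> borel_measurable lebesgue"
    using assms by (auto simp: L2_def)
  have int: "integrable lebesgue (\<lambda>x. cmod (f x) * cmod (g x))"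
    using integrable_norm[OF integrable_L2_mult[OF assms]] by (simp add: norm_mult)
  define A where "A = (\<integral>x. cmod (f x) * cmod (g x) \<partial>lebesgue)"
  have A0: "A \<ge> 0" unfolding A_def by simp
  have "(\<integral>\<^sup>+x. ennreal (cmod (f x)) * ennreal (cmod (g x)) \<partial>lebesgue) = ennreal A"
    unfolding A_def by (subst nn_integral_eq_integral[OF int, symmetric]) (auto simp: ennreal_mult)
  moreover have "(\<integral>\<^sup>+x. (ennreal (cmod (f x)))\<^sup>2 \<partial>lebesgue) = ennreal ((L2_norm f)\<^sup>2)"
    using assms(1) unfolding L2_norm_sq L2_def
    by (subst nn_integral_eq_integral[symmetric]) (auto simp: ennreal_power)
  moreover have "(\<integral>\<^sup>+x. (ennreal (cmod (g x)))\<^sup>2 \<partial>lebesgue) = ennreal ((L2_norm g)\<^sup>2)"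
    using assms(2) unfolding L2_norm_sq L2_def
    by (subst nn_integral_eq_integral[symmetric]) (auto simp: ennreal_power)
  ultimately have "(ennreal A)\<^sup>2 \<le> ennreal ((L2_norm f)\<^sup>2) * ennreal ((L2_norm g)\<^sup>2)"
    using Cauchy_Schwarz_nn_integral[of "\<lambda>x. ennreal (cmod (f x))" lebesgue "\<lambda>x. ennreal (cmod (g x))"]
    by simp
  then have "A\<^sup>2 \<le> (L2_norm f * L2_norm g)\<^sup>2"
    using A0 by (simp add: ennreal_power ennreal_mult[symmetric] power_mult_distrib)
  then show ?thesis
    unfolding A_def[symmetric] by (rule power2_le_imp_le) simp
qed

lemma L2_Cauchy_Schwarz:
  assumes "L2 f" "L2 g"
  shows "cmod (L2_inner f g) \<le> L2_norm f * L2_norm g"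
proof -
  have "cmod (L2_inner f g) \<le> (\<integral>x. cmod (f x * cnj (g x)) \<partial>lebesgue)"
    unfolding L2_inner_def by simp
  also have "\<dots> \<le> L2_norm f * L2_norm g"
    using L2_abs_Cauchy_Schwarz[OF assms] by (simp add: norm_mult)
  finally show ?thesis .
qed

lemma L2_norm_triangle:
  assumes "L2 f" "L2 g"
  shows "L2_norm (\<lambda>x. f x + g x) \<le> L2_norm f + L2_norm g"
proof (rule power2_le_imp_le)
  have "Re (L2_inner f g) \<le> L2_norm f * L2_norm g"
    using L2_Cauchy_Schwarz[OF assms] complex_Re_le_cmod order_trans by blast
  then show "(L2_norm (\<lambda>x. f x + g x))\<^sup>2 \<le> (L2_norm f + L2_norm g)\<^sup>2"
    by (simp add: L2_norm_add_sq assms power2_sum)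
qed simp

lemma L2_norm_diff_commute: "L2_norm (\<lambda>x. f x - g x) = L2_norm (\<lambda>x. g x - f x)"
  by (simp add: L2_norm_def norm_minus_commute)

lemma L2_norm_triangle_abs:
  assumes "L2 f" "L2 g"
  shows "\<bar>L2_norm f - L2_norm g\<bar> \<le> L2_norm (\<lambda>x. f x - g x)"
  using L2_norm_triangle[OF L2_diff[OF assms] assms(2)]
    L2_norm_triangle[OF L2_diff[OF assms(2,1)] assms(1)] L2_norm_diff_commute[of f g]
  by simp

text \<open>Orthonormality is required on \<open>K\<close> only: \<open>spectral_decomp\<close>
  constrains its functions from index 1 on, so \<open>K\<close> will be
  \<open>{1..n}\<close>.\<close>

lemma L2_Parseval_finite:
  assumes "finite K" "\<And>k. k \<in> K \<Longrightarrow> L2 (e k)"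
    and orth: "\<And>j k. j \<in> K \<Longrightarrow> k \<in> K \<Longrightarrow> L2_inner (e j) (e k) = (if j = k then 1 else 0)"
  shows "(L2_norm (\<lambda>x. \<Sum>k\<in>K. c k * e k x))\<^sup>2 = (\<Sum>k\<in>K. (cmod (c k))\<^sup>2)"
proof -
  have "complex_of_real ((L2_norm (\<lambda>x. \<Sum>k\<in>K. c k * e k x))\<^sup>2)
      = (\<Sum>j\<in>K. \<Sum>k\<in>K. c j * (cnj (c k) * L2_inner (e j) (e k)))"
    using assms(2) unfolding L2_inner_self[symmetric]
    by (simp add: L2_inner_sum_left L2_inner_sum_right L2_sum L2_cmult
        L2_inner_cmult_left L2_inner_cmult_right sum_distrib_left)
  also have "\<dots> = (\<Sum>j\<in>K. \<Sum>k\<in>K. if j = k then c j * cnj (c k) else 0)"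
    by (intro sum.cong) (auto simp: orth)
  also have "\<dots> = complex_of_real (\<Sum>k\<in>K. (cmod (c k))\<^sup>2)"
    using assms(1) by (simp add: complex_norm_square del: of_real_power)
  finally show ?thesis
    using of_real_eq_iff by blast
qed

text \<open>Cauchy-Schwarz for \<open>f\<close> against its own projection \<open>s\<close>: both
  the inner product of \<open>f\<close> with \<open>s\<close> and the squared norm of
  \<open>s\<close> equal \<open>b\<close>, so b is at most the norm of \<open>f\<close> times the
  square root of b, and one square root cancels.\<close>

lemma L2_Bessel:
  assumes "finite K" "\<And>k. k \<in> K \<Longrightarrow> L2 (e k)" "L2 f"
    and orth: "\<And>j k. j \<in> K \<Longrightarrow> k \<in> K \<Longrightarrow> L2_inner (e j) (e k) = (if j = k then 1 else 0)"
  shows "(\<Sum>k\<in>K. (cmod (L2_inner f (e k)))\<^sup>2) \<le> (L2_norm f)\<^sup>2"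
proof -
  define s where "s = (\<lambda>x. \<Sum>k\<in>K. L2_inner f (e k) * e k x)"
  define b where "b = (\<Sum>k\<in>K. (cmod (L2_inner f (e k)))\<^sup>2)"
  have L: "L2 s" unfolding s_def by (intro L2_sum L2_cmult assms)
  have "L2_inner f s = (\<Sum>k\<in>K. cnj (L2_inner f (e k)) * L2_inner f (e k))"
    unfolding s_def using assms(2,3)
    by (simp add: L2_inner_sum_right L2_cmult L2_inner_cmult_right)
  also have "\<dots> = complex_of_real b"
    by (simp add: b_def complex_norm_square mult.commute del: of_real_power)
  finally have fs: "L2_inner f s = complex_of_real b" .
  have "(L2_norm s)\<^sup>2 = b"
    unfolding s_def b_def by (rule L2_Parseval_finite[OF assms(1,2) orth])
  moreover have "b \<ge> 0" by (simp add: b_def sum_nonneg)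
  ultimately have "b \<le> L2_norm f * L2_norm s" "L2_norm s = sqrt b"
    using L2_Cauchy_Schwarz[OF assms(3) L] fs by (auto simp: real_sqrt_unique[symmetric])
  then have "sqrt b * sqrt b \<le> L2_norm f * sqrt b" using \<open>b \<ge> 0\<close> by simp
  then have "sqrt b \<le> L2_norm f"
    by (cases "b = 0") (use \<open>b \<ge> 0\<close> in \<open>simp_all only: mult_le_cancel_right real_sqrt_gt_0_iff, auto\<close>)
  then have "(sqrt b)\<^sup>2 \<le> (L2_norm f)\<^sup>2" using \<open>b \<ge> 0\<close> by (intro power_mono) auto
  then show ?thesis using \<open>b \<ge> 0\<close> by (simp add: b_def)
qed

text \<open>Signals are Lebesgue measurable, but Fubini's theorem is applied to products of
  \<open>lborel\<close>, and the completed measure is not such a product. Arguments with iterated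
  integrals therefore start by passing to a Borel function that agrees almost everywhere.\<close>

lemma borel_representative:
  assumes "f \<in> borel_measurable lebesgue"
  obtains f' :: "'a::euclidean_space \<Rightarrow> complex" where "f' \<in> borel_measurable borel" "AE x in lebesgue. f x = f' x"
proof -
  have "(\<lambda>x. Re (f x)) \<in> borel_measurable lebesgue" "(\<lambda>x. Im (f x)) \<in> borel_measurable lebesgue"
    using assms by measurable
  from this[THEN completion_ex_borel_measurable_real]
  obtain u v where uv: "u \<in> borel_measurable lborel" "AE x in lborel. Re (f x) = u x"
    "v \<in> borel_measurable lborel" "AE x in lborel. Im (f x) = v x" by blast
  show thesis
  proof
    show "(\<lambda>x. Complex (u x) (v x)) \<in> borel_measurable borel"
      using uv(1,3) by (simp add: complex_eq_iff Complex_eq)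
    have "AE x in lborel. f x = Complex (u x) (v x)"
      using uv(2,4) by eventually_elim (simp add: complex_eq_iff)
    then show "AE x in lebesgue. f x = Complex (u x) (v x)" by (rule AE_completion)
  qed
qed

lemma L2_cong_AE:
  assumes "f \<in> borel_measurable lebesgue" "f' \<in> borel_measurable lebesgue" "AE x in lebesgue. f x = f' x"
  shows "L2 f \<longleftrightarrow> L2 f'" "L2_norm f = L2_norm f'"
proof -
  note [measurable] = assms(1,2)
  have ae: "AE x in lebesgue. (cmod (f x))\<^sup>2 = (cmod (f' x))\<^sup>2"
    using assms(3) by eventually_elim simp
  show "L2 f \<longleftrightarrow> L2 f'"
    unfolding L2_def using assms(1,2) integrable_cong_AE[OF _ _ ae] by simp
  show "L2_norm f = L2_norm f'"
    unfolding L2_norm_def using integral_cong_AE[OF _ _ ae] by simp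
qed

lemma L2_inner_cong_AE_left:
  assumes "f \<in> borel_measurable lebesgue" "f' \<in> borel_measurable lebesgue" "AE x in lebesgue. f x = f' x"
    "g \<in> borel_measurable lebesgue"
  shows "L2_inner f g = L2_inner f' g"
proof -
  note [measurable] = assms(1,2,4)
  have ae: "AE x in lebesgue. f x * cnj (g x) = f' x * cnj (g x)"
    using assms(3) by eventually_elim simp
  show ?thesis
    unfolding L2_inner_def using integral_cong_AE[OF _ _ ae] by simp
qed

lemma borel_imp_lebesgue: "f \<in> borel_measurable borel \<Longrightarrow> f \<in> borel_measurable lebesgue"
  by (simp add: measurable_completion)

lemma L2_borel_representative:
  assumes "L2 f"
  obtains f' where "f' \<in> borel_measurable borel" "L2 f'" "AE x in lebesgue. f x = f' x" "L2_norm f = L2_norm f'"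
  using borel_representative[OF L2_measurable[OF assms]] L2_cong_AE[OF L2_measurable[OF assms] borel_imp_lebesgue]
  by (metis assms)

lemma L2_borel_iff:
  assumes [measurable]: "f \<in> borel_measurable borel"
  shows "L2 f \<longleftrightarrow> integrable lborel (\<lambda>x. (cmod (f x))\<^sup>2)"
  unfolding L2_def by (subst integrable_completion) (auto simp: borel_imp_lebesgue)

subsection \<open>Changes of variables\<close>

lemma nn_integral_lborel_translate:
  fixes c :: "'a::euclidean_space"
  assumes [measurable]: "f \<in> borel_measurable borel"
  shows "(\<integral>\<^sup>+x. f (c + x) \<partial>lborel) = (\<integral>\<^sup>+x. f x \<partial>lborel)"
  by (subst (2) lborel_distr_plus[of c, symmetric]) (simp add: nn_integral_distr)

lemma integrable_lborel_translate:
  fixes c :: "'a::euclidean_space" and f :: "'a \<Rightarrow> 'b::{banach, second_countable_topology}"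
  assumes "integrable lborel f"
  shows "integrable lborel (\<lambda>x. f (c + x))"
proof -
  have "integrable (distr lborel borel ((+) c)) f" using assms by (simp add: lborel_distr_plus)
  then show ?thesis
    using borel_measurable_integrable[OF assms] by (subst (asm) integrable_distr_eq) auto
qed

lemma integral_lborel_translate:
  fixes c :: "'a::euclidean_space" and f :: "'a \<Rightarrow> 'b::{banach, second_countable_topology}"
  assumes "f \<in> borel_measurable borel"
  shows "(\<integral>x. f (c + x) \<partial>lborel) = (\<integral>x. f x \<partial>lborel)"
  using assms by (subst (2) lborel_distr_plus[of c, symmetric]) (simp add: integral_distr)

lemma lborel_scale:
  fixes f :: "'a::euclidean_space \<Rightarrow> 'b::{banach, second_countable_topology}"
  assumes [measurable]: "f \<in> borel_measurable borel" and c: "c > 0"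
  shows integral_lborel_scale: "(\<integral>x. f x \<partial>lborel) = c ^ DIM('a) *\<^sub>R (\<integral>x. f (c *\<^sub>R x) \<partial>lborel)"
    and integrable_lborel_scale: "integrable lborel f \<longleftrightarrow> integrable lborel (\<lambda>x. f (c *\<^sub>R x))"
proof -
  have eq: "lborel = density (distr lborel borel (\<lambda>x::'a. c *\<^sub>R x)) (\<lambda>_. ennreal (c ^ DIM('a)))"
    using lborel_affine[of c "0::'a"] c by (simp add: ennreal_power)
  show "(\<integral>x. f x \<partial>lborel) = c ^ DIM('a) *\<^sub>R (\<integral>x. f (c *\<^sub>R x) \<partial>lborel)"
    using c by (subst eq) (simp add: integral_density integral_distr)
  show "integrable lborel f \<longleftrightarrow> integrable lborel (\<lambda>x. f (c *\<^sub>R x))"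
  proof
    assume "integrable lborel f"
    then have "integrable lborel (\<lambda>x. c ^ DIM('a) *\<^sub>R f (c *\<^sub>R x))"
      using c by (subst (asm) eq) (simp add: integrable_density integrable_distr_eq)
    then have "integrable lborel (\<lambda>x. inverse (c ^ DIM('a)) *\<^sub>R c ^ DIM('a) *\<^sub>R f (c *\<^sub>R x))"
      by (rule integrable_scaleR_right)
    then show "integrable lborel (\<lambda>x. f (c *\<^sub>R x))"
      using c by simp
  next
    assume "integrable lborel (\<lambda>x. f (c *\<^sub>R x))"
    then show "integrable lborel f"
      using c by (subst eq) (simp add: integrable_density integrable_distr_eq)
  qed
qed

text \<open>Reduction to one dimension, used for Gaussians and for the weight \<open>wt\<close>.
  Complex values allow a Gaussian to be treated together with a character, which also factors over
  the coordinates.\<close>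

lemma lborel_prod_functions:
  fixes f :: "'a::euclidean_space \<Rightarrow> real \<Rightarrow> complex"
  assumes "\<And>b. b \<in> Basis \<Longrightarrow> integrable lborel (f b)"
  shows integrable_lborel_prod: "integrable lborel (\<lambda>x. \<Prod>b\<in>Basis. f b (x \<bullet> b))"
    and integral_lborel_prod: "(\<integral>x. (\<Prod>b\<in>Basis. f b (x \<bullet> b)) \<partial>lborel) = (\<Prod>b\<in>Basis. \<integral>x. f b x \<partial>lborel)"
proof -
  interpret product_sigma_finite "\<lambda>_::'a. lborel :: real measure"
    by standard
  have m [measurable]: "f b \<in> borel_measurable borel" if "b \<in> Basis" for b
    using borel_measurable_integrable[OF assms[OF that]] by simp
  have ip: "(\<Sum>b'\<in>Basis. y b' *\<^sub>R b') \<bullet> b = y b" if "b \<in> Basis" for y and b :: 'a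
    using that by (simp add: inner_sum_left_Basis)
  have m2: "(\<lambda>x. \<Prod>b\<in>Basis. f b (x \<bullet> b)) \<in> borel_measurable borel" by measurable
  show "integrable lborel (\<lambda>x. \<Prod>b\<in>Basis. f b (x \<bullet> b))"
    apply (subst lborel_eq)
    using product_integrable_prod[of Basis f] assms m2
    by (subst integrable_distr_eq) (auto simp: ip)
  show "(\<integral>x. (\<Prod>b\<in>Basis. f b (x \<bullet> b)) \<partial>lborel) = (\<Prod>b\<in>Basis. \<integral>x. f b x \<partial>lborel)"
    apply (subst lborel_eq)
    using product_integral_prod[of Basis f] assms m2
    by (subst integral_distr) (auto simp: ip)
qed

lemma integrable_lborel_tensor:
  fixes f :: "'a::euclidean_space \<Rightarrow> real" and g :: "'b::euclidean_space \<Rightarrow> real"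
  assumes "integrable lborel f" "integrable lborel g"
  shows "integrable (lborel \<Otimes>\<^sub>M lborel) (\<lambda>p. f (fst p) * g (snd p))"
proof (rule lborel_pair.Fubini_integrable)
  have [measurable]: "f \<in> borel_measurable borel" "g \<in> borel_measurable borel"
    using assms[THEN borel_measurable_integrable] by auto
  show "(\<lambda>p. f (fst p) * g (snd p)) \<in> borel_measurable (lborel \<Otimes>\<^sub>M lborel)" by measurable
  have "integrable lborel (\<lambda>x. norm (f x) * (\<integral>y. norm (g y) \<partial>lborel))"
    using assms by auto
  then show "integrable lborel (\<lambda>x. \<integral>y. norm (f (fst (x, y)) * g (snd (x, y))) \<partial>lborel)"
    by (simp only: fst_conv snd_conv norm_mult integral_mult_right_zero)
qed (use assms in auto)

subsection \<open>Continuity of translations\<close>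

lemma translation_osc_approx:
  fixes f g :: "'a::euclidean_space \<Rightarrow> 'b::{banach, second_countable_topology}"
  assumes f: "integrable lborel f" and g: "integrable lborel g"
  shows "(\<integral>t. norm (f (v + t) - f t) \<partial>lborel) \<le>
    (\<integral>t. norm (g (v + t) - g t) \<partial>lborel) + 2 * (\<integral>t. norm (f t - g t) \<partial>lborel)"
proof -
  note [simp] = f g integrable_lborel_translate[OF f] integrable_lborel_translate[OF g]
  have [measurable]: "f \<in> borel_measurable borel" "g \<in> borel_measurable borel"
    using assms[THEN borel_measurable_integrable] by auto
  have "(\<integral>t. norm (f (v + t) - f t) \<partial>lborel) \<le>
      (\<integral>t. norm (g (v + t) - g t) + norm (f (v + t) - g (v + t)) + norm (f t - g t) \<partial>lborel)"
  proof (rule integral_mono)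
    fix t
    have "f (v + t) - f t = (g (v + t) - g t) + (f (v + t) - g (v + t)) - (f t - g t)" by simp
    then show "norm (f (v + t) - f t) \<le> norm (g (v + t) - g t) + norm (f (v + t) - g (v + t)) + norm (f t - g t)"
      using norm_triangle_ineq4[of "(g (v + t) - g t) + (f (v + t) - g (v + t))" "f t - g t"]
        norm_triangle_ineq[of "g (v + t) - g t" "f (v + t) - g (v + t)"] by simp
  qed auto
  also have "\<dots> = (\<integral>t. norm (g (v + t) - g t) \<partial>lborel) + (\<integral>t. norm (f (v + t) - g (v + t)) \<partial>lborel)
      + (\<integral>t. norm (f t - g t) \<partial>lborel)"
    by simp
  also have "(\<integral>t. norm (f (v + t) - g (v + t)) \<partial>lborel) = (\<integral>t. norm (f t - g t) \<partial>lborel)"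
    by (rule integral_lborel_translate) measurable
  finally show ?thesis by simp
qed

text \<open>Functions with continuous translates form a closed set in L1: the approximation error is
  paid twice, once for \<open>f\<close> and once for its translate, so r/3 for it and r/3 for the
  oscillation of \<open>g\<close> suffice.\<close>

lemma translation_osc_limit:
  fixes f :: "'a::euclidean_space \<Rightarrow> 'b::{banach, second_countable_topology}"
  assumes f: "integrable lborel f"
    and approx: "\<And>e. e > 0 \<Longrightarrow> \<exists>g. integrable lborel g \<and> (\<integral>t. norm (f t - g t) \<partial>lborel) < e \<and>
      (\<lambda>n. \<integral>t. norm (g (v n + t) - g t) \<partial>lborel) \<longlonglongrightarrow> 0"
  shows "(\<lambda>n. \<integral>t. norm (f (v n + t) - f t) \<partial>lborel) \<longlonglongrightarrow> 0"
proof (rule LIMSEQ_I)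
  fix r :: real assume "r > 0"
  then obtain g where g: "integrable lborel g" "(\<integral>t. norm (f t - g t) \<partial>lborel) < r / 3"
    "(\<lambda>n. \<integral>t. norm (g (v n + t) - g t) \<partial>lborel) \<longlonglongrightarrow> 0"
    using approx[of "r/3"] by auto
  obtain N where N: "\<And>n. n \<ge> N \<Longrightarrow> norm ((\<integral>t. norm (g (v n + t) - g t) \<partial>lborel) - 0) < r / 3"
    using LIMSEQ_D[OF g(3), of "r/3"] \<open>r > 0\<close> by auto
  show "\<exists>N. \<forall>n\<ge>N. norm ((\<integral>t. norm (f (v n + t) - f t) \<partial>lborel) - 0) < r"
  proof (intro exI allI impI)
    fix n assume "n \<ge> N"
    have "0 \<le> (\<integral>t. norm (f (v n + t) - f t) \<partial>lborel)" by simp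
    then show "norm ((\<integral>t. norm (f (v n + t) - f t) \<partial>lborel) - 0) < r"
      using translation_osc_approx[OF f g(1), of "v n"] N[OF \<open>n \<ge> N\<close>] g(2) by simp
  qed
qed

text \<open>At a boundary point of \<open>U\<close> the translated indicators may oscillate, so
  dominated convergence does not apply to the symmetric difference directly. The one-sided part
  \<open>q\<close>, points of \<open>U\<close> moved out of \<open>U\<close>, does vanish pointwise
  because \<open>U\<close> is open; the other part becomes \<open>q (- v)\<close> after translating
  back.\<close>

lemma translation_osc_open:
  fixes U :: "'a::euclidean_space set" and c :: "'b::{banach, second_countable_topology}"
  assumes "open U" "emeasure lborel U < \<infinity>" "v \<longlonglongrightarrow> 0"
  shows "(\<lambda>n. \<integral>t. norm (indicator U (v n + t) *\<^sub>R c - indicator U t *\<^sub>R c) \<partial>lborel) \<longlonglongrightarrow> 0"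
proof -
  have [measurable]: "U \<in> sets borel" using assms(1) by simp
  have iU: "integrable lborel (indicator U :: 'a \<Rightarrow> real)"
    using assms(2) by (intro integrable_real_indicator) auto
  note iU' = integrable_lborel_translate[OF iU]
  define q where "q v = (\<integral>t. indicator U t * (1 - indicator U (v + t)) \<partial>lborel :: real)" for v
  have ib: "integrable lborel (\<lambda>t. indicator U t * (1 - indicator U (v + t)) :: real)" for v
    by (rule Bochner_Integration.integrable_bound[OF iU]) (auto split: split_indicator)
  have lim: "(\<lambda>n. q (w n)) \<longlonglongrightarrow> 0" if "w \<longlonglongrightarrow> 0" for w
  proof -
    have "(\<lambda>n. q (w n)) \<longlonglongrightarrow> (\<integral>t. 0 \<partial>(lborel :: 'a measure))"
      unfolding q_def
    proof (rule integral_dominated_convergence[OF _ _ iU])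
      show "AE t in lborel. (\<lambda>n. indicator U t * (1 - indicator U (w n + t)) :: real) \<longlonglongrightarrow> 0"
      proof (rule AE_I2)
        fix t :: 'a
        show "(\<lambda>n. indicator U t * (1 - indicator U (w n + t)) :: real) \<longlonglongrightarrow> 0"
        proof (cases "t \<in> U")
          case True
          have "(\<lambda>n. w n + t) \<longlonglongrightarrow> 0 + t" by (intro tendsto_intros that)
          then have "eventually (\<lambda>n. w n + t \<in> U) sequentially"
            using True assms(1) by (auto dest: topological_tendstoD)
          then have "eventually (\<lambda>n. indicator U t * (1 - indicator U (w n + t)) = (0::real)) sequentially"
            by eventually_elim simp
          then show ?thesis by (rule tendsto_eventually)
        qed simp
      qed
    qed (auto split: split_indicator)
    then show ?thesis by simp
  qed
  have "(\<integral>t. norm (indicator U (v + t) *\<^sub>R c - indicator U t *\<^sub>R c) \<partial>lborel) = (q v + q (- v)) * norm c" for v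
  proof -
    have "(\<integral>t. norm (indicator U (v + t) *\<^sub>R c - indicator U t *\<^sub>R c) \<partial>lborel)
       = (\<integral>t. (indicator U t * (1 - indicator U (v + t)) +
              indicator U (v + t) * (1 - indicator U (- v + (v + t)))) * norm c \<partial>lborel)"
      by (intro Bochner_Integration.integral_cong) (auto split: split_indicator)
    also have "\<dots> = (q v + (\<integral>t. indicator U (v + t) * (1 - indicator U (- v + (v + t))) \<partial>lborel)) * norm c"
      using integrable_lborel_translate[OF ib, of v "- v"] ib[of v] by (simp add: q_def)
    also have "(\<integral>t. indicator U (v + t) * (1 - indicator U (- v + (v + t))) \<partial>lborel :: real) = q (- v)"
      unfolding q_def by (rule integral_lborel_translate) measurable
    finally show ?thesis .
  qed
  moreover have "(\<lambda>n. (q (v n) + q (- v n)) * norm c) \<longlonglongrightarrow> (0 + 0) * norm c"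
    using tendsto_minus[OF assms(3)] by (intro tendsto_intros lim assms(3)) simp
  ultimately show ?thesis by simp
qed

text \<open>Induction over integrable functions. For indicators, outer regularity of Lebesgue
  measure reduces a Borel set of finite measure to an open one; sums use the triangle inequality,
  and dominated limits use \<open>translation_osc_limit\<close>.\<close>

lemma L1_translation_continuous:
  fixes f :: "'a::euclidean_space \<Rightarrow> 'b::{banach, second_countable_topology}"
  assumes "integrable lborel f" "v \<longlonglongrightarrow> 0"
  shows "(\<lambda>n. \<integral>t. norm (f (v n + t) - f t) \<partial>lborel) \<longlonglongrightarrow> 0"
  using assms(1)
proof induction
  case (base A c)
  have [measurable]: "A \<in> sets borel" using base by simp
  have iA: "integrable lborel (\<lambda>x. indicator A x *\<^sub>R c)"
    using base by (intro integrable_scaleR_left integrable_real_indicator) auto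
  show ?case
  proof (rule translation_osc_limit[OF iA])
    fix e :: real assume "e > 0"
    \<comment> \<open>The added 1 keeps the quotient meaningful when \<open>c\<close> is 0 and makes
      the final inequality strict.\<close>
    define e' where "e' = e / (norm c + 1)"
    have e': "e' > 0" using \<open>e > 0\<close> by (auto simp: e'_def add_nonneg_pos)
    obtain U where U: "open U" "A \<subseteq> U" "emeasure lborel (U - A) < e'"
      using outer_regular_lborel[OF \<open>A \<in> sets borel\<close> e'] by blast
    have [measurable]: "U \<in> sets borel" using U by simp
    have "emeasure lborel U \<le> emeasure lborel A + emeasure lborel (U - A)"
      using U(2) by (subst plus_emeasure) (auto simp: Un_absorb1)
    also have "\<dots> < \<infinity>"
      using base U(3) by (simp add: order.strict_trans[OF U(3)])
    finally have fU: "emeasure lborel U < \<infinity>" .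
    have iU: "integrable lborel (\<lambda>x. indicator U x *\<^sub>R c)"
      using fU by (intro integrable_scaleR_left integrable_real_indicator) auto
    have "(\<integral>t. norm (indicator A t *\<^sub>R c - indicator U t *\<^sub>R c) \<partial>lborel) = (\<integral>t. indicator (U - A) t * norm c \<partial>lborel)"
      using U(2) by (intro Bochner_Integration.integral_cong) (auto split: split_indicator)
    also have "\<dots> = measure lborel (U - A) * norm c" by simp
    also have "\<dots> \<le> e' * norm c"
      using U(3) e' by (intro mult_right_mono) (auto simp: measure_def enn2real_leI less_imp_le)
    also have "\<dots> < e"
      using \<open>e > 0\<close> by (simp add: e'_def divide_less_eq add_nonneg_pos distrib_left)
    finally show "\<exists>g. integrable lborel g \<and> (\<integral>t. norm (indicator A t *\<^sub>R c - g t) \<partial>lborel) < e \<and>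
      (\<lambda>n. \<integral>t. norm (g (v n + t) - g t) \<partial>lborel) \<longlonglongrightarrow> 0"
      using iU translation_osc_open[OF U(1) fU assms(2), of c] by blast
  qed
next
  case (add f g)
  note [simp] = add(1,2) integrable_lborel_translate[OF add(1)] integrable_lborel_translate[OF add(2)]
  have le: "(\<integral>t. norm (f (v n + t) + g (v n + t) - (f t + g t)) \<partial>lborel) \<le>
      (\<integral>t. norm (f (v n + t) - f t) \<partial>lborel) + (\<integral>t. norm (g (v n + t) - g t) \<partial>lborel)" for n
  proof -
    have "(\<integral>t. norm (f (v n + t) + g (v n + t) - (f t + g t)) \<partial>lborel) \<le>
       (\<integral>t. norm (f (v n + t) - f t) + norm (g (v n + t) - g t) \<partial>lborel)"
      by (rule integral_mono) (auto simp: norm_diff_triangle_ineq)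
    then show ?thesis by simp
  qed
  show ?case
    by (rule tendsto_sandwich[OF _ _ tendsto_const tendsto_add_zero[OF add(3,4)]])
       (auto simp: le)
next
  case (lim f s)
  show ?case
  proof (rule translation_osc_limit[OF lim(4)])
    fix e :: real assume "e > 0"
    have [measurable]: "f \<in> borel_measurable borel" "\<And>i. s i \<in> borel_measurable borel"
      using borel_measurable_integrable[OF lim(4)] borel_measurable_integrable[OF lim(1)] by auto
    \<comment> \<open>The induction rule provides approximants with norm at most twice that of
      \<open>f\<close>, hence the majorant with factor 3.\<close>
    have "(\<lambda>i. \<integral>t. norm (f t - s i t) \<partial>lborel) \<longlonglongrightarrow> (\<integral>t. 0 \<partial>(lborel :: 'a measure))"
    proof (rule integral_dominated_convergence[where w="\<lambda>t. 3 * norm (f t)"])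
      show "AE x in lborel. (\<lambda>i. norm (f x - s i x)) \<longlonglongrightarrow> 0"
        using lim(2) by (intro AE_I2) (auto intro!: tendsto_eq_intros)
      show "AE x in lborel. norm (norm (f x - s i x)) \<le> 3 * norm (f x)" for i
      proof (intro AE_I2)
        fix x
        have "norm (f x - s i x) \<le> norm (f x) + norm (s i x)" by (rule norm_triangle_ineq4)
        then show "norm (norm (f x - s i x)) \<le> 3 * norm (f x)" using lim(3)[of x i] by simp
      qed
    qed (use lim in auto)
    then obtain i where "(\<integral>t. norm (f t - s i t) \<partial>lborel) < e"
      using \<open>e > 0\<close> by (auto dest!: order_tendstoD(2) eventually_happens)
    then show "\<exists>g. integrable lborel g \<and> (\<integral>t. norm (f t - g t) \<partial>lborel) < e \<and>
      (\<lambda>n. \<integral>t. norm (g (v n + t) - g t) \<partial>lborel) \<longlonglongrightarrow> 0"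
      using lim by blast
  qed
qed

text \<open>Passing from f to |f| f reduces the continuity of translations in L2 to that in L1.\<close>

lemma power2_norm_diff_le:
  fixes a b :: "'a::real_inner"
  shows "(norm (a - b))\<^sup>2 \<le> 2 * norm (norm a *\<^sub>R a - norm b *\<^sub>R b)"
proof (cases "a = b")
  case False
  define r s p where "r = norm a" and "s = norm b" and "p = a \<bullet> b"
  define d where "d = norm (a - b)"
  have d0: "d > 0" using False by (simp add: d_def)
  have rs: "r \<ge> 0" "s \<ge> 0" by (auto simp: r_def s_def)
  have aa: "a \<bullet> a = r\<^sup>2" "b \<bullet> b = s\<^sup>2" "b \<bullet> a = p" "a \<bullet> b = p"
    by (auto simp: r_def s_def p_def power2_norm_eq_inner inner_commute)
  have dd: "d\<^sup>2 = r\<^sup>2 + s\<^sup>2 - 2 * p"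
    by (simp add: d_def power2_norm_eq_inner inner_diff_left inner_diff_right aa)
  \<comment> \<open>The key identity is 2 <a - b, r a - s b> = (r + s) (d^2 + (r - s)^2). Dropping
    the last square and using d \<le> r + s leaves d^3 on one side and d times the wanted norm on
    the other.\<close>
  have "(a - b) \<bullet> (r *\<^sub>R a - s *\<^sub>R b) = r ^ 3 + s ^ 3 - (r + s) * p"
    by (simp add: inner_diff_left inner_diff_right aa algebra_simps power2_eq_square power3_eq_cube)
  also have "2 * \<dots> - (r + s) * d\<^sup>2 = (r + s) * (r - s)\<^sup>2"
    unfolding dd by (simp add: algebra_simps power2_eq_square power3_eq_cube)
  finally have "(r + s) * d\<^sup>2 \<le> 2 * ((a - b) \<bullet> (r *\<^sub>R a - s *\<^sub>R b))"
    using mult_nonneg_nonneg[OF add_nonneg_nonneg[OF rs] zero_le_power2, of "r - s"] by linarith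
  also have "\<dots> \<le> 2 * (d * norm (r *\<^sub>R a - s *\<^sub>R b))"
    using norm_cauchy_schwarz[of "a - b" "r *\<^sub>R a - s *\<^sub>R b"] by (simp add: d_def)
  finally have 1: "(r + s) * d\<^sup>2 \<le> 2 * (d * norm (r *\<^sub>R a - s *\<^sub>R b))" .
  have "d \<le> r + s" unfolding d_def r_def s_def by (rule norm_triangle_ineq4)
  then have "d * d\<^sup>2 \<le> (r + s) * d\<^sup>2" by (intro mult_right_mono) auto
  with 1 have "d * d\<^sup>2 \<le> d * (2 * norm (r *\<^sub>R a - s *\<^sub>R b))" by (simp add: algebra_simps)
  then show ?thesis using d0 unfolding d_def r_def s_def by (simp only: mult_le_cancel_left_pos)
qed simp

lemma L2_translation_continuous:
  fixes f :: "'a::euclidean_space \<Rightarrow> complex"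
  assumes [measurable]: "f \<in> borel_measurable borel"
    and f2: "integrable lborel (\<lambda>x. (cmod (f x))\<^sup>2)" and v: "v \<longlonglongrightarrow> 0"
  shows "(\<lambda>n. \<integral>t. (cmod (f (v n + t) - f t))\<^sup>2 \<partial>lborel) \<longlonglongrightarrow> 0"
proof -
  define g where "g t = norm (f t) *\<^sub>R f t" for t
  have [measurable]: "g \<in> borel_measurable borel" unfolding g_def by measurable
  have g: "integrable lborel g"
    by (rule Bochner_Integration.integrable_bound[OF f2]) (auto simp: g_def power2_eq_square)
  note gi = integrable_lborel_translate[OF g]
  have le: "(\<integral>t. (cmod (f (v n + t) - f t))\<^sup>2 \<partial>lborel) \<le> 2 * (\<integral>t. norm (g (v n + t) - g t) \<partial>lborel)" for n
  proof -
    have "(\<integral>t. (cmod (f (v n + t) - f t))\<^sup>2 \<partial>lborel) \<le> (\<integral>t. 2 * norm (g (v n + t) - g t) \<partial>lborel)"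
    proof (rule integral_mono)
      have i: "integrable lborel (\<lambda>t. 2 * norm (g (v n + t) - g t))" using g gi by auto
      then show "integrable lborel (\<lambda>t. 2 * norm (g (v n + t) - g t))" .
      show "(cmod (f (v n + t) - f t))\<^sup>2 \<le> 2 * norm (g (v n + t) - g t)" for t
        unfolding g_def by (rule power2_norm_diff_le)
      then show "integrable lborel (\<lambda>t. (cmod (f (v n + t) - f t))\<^sup>2)"
        by (intro Bochner_Integration.integrable_bound[OF i]) auto
    qed
    then show ?thesis by simp
  qed
  show ?thesis
    by (rule tendsto_sandwich[OF _ _ tendsto_const tendsto_mult_right_zero[OF L1_translation_continuous[OF g v], of 2]])
       (auto simp: le)
qed


subsection \<open>Plancherel's theorem\<close>

definition fourier :: "('a::euclidean_space \<Rightarrow> complex) \<Rightarrow> 'a \<Rightarrow> complex" where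
  "fourier F \<xi> = (\<integral>t. F t * cis (- 2 * pi * (\<xi> \<bullet> t)) \<partial>lborel)"

lemma borel_measurable_cis [measurable (raw)]:
  "f \<in> borel_measurable M \<Longrightarrow> (\<lambda>x. cis (f x)) \<in> borel_measurable M"
  by (rule measurable_compose[OF _ borel_measurable_continuous_onI[of cis]])
     (auto intro!: continuous_on_cis continuous_on_id)

lemma cis_sum: "cis (\<Sum>i\<in>I. f i) = (\<Prod>i\<in>I. cis (f i))"
  by (induction I rule: infinite_finite_induct) (auto simp: cis_mult[symmetric])

section \<open>The Gaussian and its Fourier transform\<close>

definition gauss :: "'a::euclidean_space \<Rightarrow> real" where
  "gauss \<xi> = exp (- (norm \<xi>)\<^sup>2 / 2)"

text \<open>With the character exp(-2 pi i x u), the transform of exp(-x^2/2) is the normal density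
  of standard deviation 1 / (2 pi). Written as a probability density it is visibly an approximate
  identity after scaling.\<close>

definition gauss_hat :: "'a::euclidean_space \<Rightarrow> real" where
  "gauss_hat u = (\<Prod>b\<in>Basis. normal_density 0 (1 / (2 * pi)) (u \<bullet> b))"

lemma gauss_prod: "gauss \<xi> = (\<Prod>b\<in>Basis. exp (- (\<xi> \<bullet> b)\<^sup>2 / 2))"
proof -
  have "- (norm \<xi>)\<^sup>2 / 2 = (\<Sum>b\<in>Basis. - (\<xi> \<bullet> b)\<^sup>2 / 2)"
    unfolding power2_norm_eq_inner
    by (subst euclidean_inner) (simp add: sum_negf sum_divide_distrib[symmetric] power2_eq_square)
  then show ?thesis by (simp add: gauss_def exp_sum)
qed

lemma gauss_measurable [measurable]: "gauss \<in> borel_measurable borel"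
  unfolding gauss_def by measurable

lemma gauss_hat_measurable [measurable]: "gauss_hat \<in> borel_measurable borel"
  unfolding gauss_hat_def by measurable

lemma gauss_hat_nonneg [simp]: "gauss_hat u \<ge> 0"
  by (simp add: gauss_hat_def prod_nonneg)

text \<open>This is the characteristic function of the standard normal distribution at
  \<open>- 2 * pi * u\<close>; the factor \<open>sqrt (2 * pi)\<close> undoes the normalization of
  the density.\<close>

lemma gauss_fourier_1d:
  fixes u :: real
  shows "integrable lborel (\<lambda>x. complex_of_real (exp (- x\<^sup>2 / 2)) * cis (- 2 * pi * (x * u)))" (is ?A)
    and "(\<integral>x. complex_of_real (exp (- x\<^sup>2 / 2)) * cis (- 2 * pi * (x * u)) \<partial>lborel)
      = complex_of_real (normal_density 0 (1 / (2 * pi)) u)" (is ?B)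
proof -
  have i: "integrable lborel (\<lambda>x. sqrt (2 * pi) * std_normal_density x)"
    by (intro integrable_mult_right integrable_normal_density) simp
  have e: "exp (- x\<^sup>2 / 2) = sqrt (2 * pi) * std_normal_density x" for x
    by (simp add: std_normal_density_def)
  show ?A
    by (rule Bochner_Integration.integrable_bound[OF i]) (auto simp: std_normal_density_def norm_mult)
  have "(\<integral>x. complex_of_real (exp (- x\<^sup>2 / 2)) * cis (- 2 * pi * (x * u)) \<partial>lborel)
     = sqrt (2 * pi) * (\<integral>x. std_normal_density x *\<^sub>R iexp ((- 2 * pi * u) * x) \<partial>lborel)"
    unfolding e by (subst integral_mult_right_zero[symmetric])
      (simp add: scaleR_conv_of_real cis_conv_exp mult.assoc mult.commute mult.left_commute)
  also have "(\<integral>x. std_normal_density x *\<^sub>R iexp ((- 2 * pi * u) * x) \<partial>lborel) = char std_normal_distribution (- 2 * pi * u)"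
    unfolding char_def by (subst integral_density) auto
  also have "\<dots> = complex_of_real (exp (- (2 * pi * u)\<^sup>2 / 2))"
    by (simp add: char_std_normal_distribution)
  also have "complex_of_real (sqrt (2 * pi)) * \<dots> = complex_of_real (normal_density 0 (1 / (2 * pi)) u)"
    by (simp add: normal_density_def real_sqrt_divide real_sqrt_mult power2_eq_square field_simps)
  finally show ?B .
qed

lemma gauss_fourier:
  fixes u :: "'a::euclidean_space"
  shows "(\<integral>\<xi>. complex_of_real (gauss \<xi>) * cis (- 2 * pi * (\<xi> \<bullet> u)) \<partial>lborel) = complex_of_real (gauss_hat u)"
proof -
  have eq: "complex_of_real (gauss \<xi>) * cis (- 2 * pi * (\<xi> \<bullet> u))
      = (\<Prod>b\<in>Basis. complex_of_real (exp (- (\<xi> \<bullet> b)\<^sup>2 / 2)) * cis (- 2 * pi * ((\<xi> \<bullet> b) * (u \<bullet> b))))" for \<xi>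
    by (simp only: euclidean_inner[of \<xi> u] sum_distrib_left cis_sum gauss_prod of_real_prod prod.distrib)
  show ?thesis
    unfolding eq
    by (subst integral_lborel_prod[of "\<lambda>b x. complex_of_real (exp (- x\<^sup>2 / 2)) * cis (- 2 * pi * (x * (u \<bullet> b)))"])
       (simp_all only: gauss_fourier_1d gauss_hat_def of_real_prod)
qed

lemma integrable_gauss: "integrable lborel (gauss :: 'a::euclidean_space \<Rightarrow> real)"
proof -
  have "integrable lborel (\<lambda>\<xi>::'a. \<Prod>b\<in>Basis. complex_of_real (exp (- (\<xi> \<bullet> b)\<^sup>2 / 2)))"
    using gauss_fourier_1d(1)[of 0] by (intro integrable_lborel_prod[of "\<lambda>b x. complex_of_real (exp (- x\<^sup>2 / 2))"]) simp
  then have "integrable lborel (\<lambda>\<xi>::'a. complex_of_real (gauss \<xi>))"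
    by (simp add: gauss_prod)
  then show ?thesis by (simp add: complex_of_real_integrable_eq)
qed

lemma gauss_hat_integral:
  "integrable lborel (gauss_hat :: 'a::euclidean_space \<Rightarrow> real)" (is ?A)
  "(\<integral>u. gauss_hat u \<partial>(lborel :: 'a measure)) = 1" (is ?B)
proof -
  have n: "integrable lborel (\<lambda>x. complex_of_real (normal_density 0 (1 / (2 * pi)) x))"
    by (subst complex_of_real_integrable_eq) (simp add: integrable_normal_density)
  note P = lborel_prod_functions[where 'a='a, of "\<lambda>b x. complex_of_real (normal_density 0 (1 / (2 * pi)) x)", OF n]
  have "integrable lborel (\<lambda>u::'a. complex_of_real (gauss_hat u))"
    using P(1) by (simp add: gauss_hat_def)
  then show ?A by (simp add: complex_of_real_integrable_eq)
  have "(\<integral>u. complex_of_real (gauss_hat u) \<partial>(lborel :: 'a measure)) = 1"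
    using P(2) by (simp add: gauss_hat_def integral_normal_density)
  then show ?B by simp
qed

lemma gauss_fourier_scaled:
  fixes u :: "'a::euclidean_space"
  assumes "\<epsilon> > 0"
  shows "(\<integral>\<xi>. complex_of_real (gauss (\<epsilon> *\<^sub>R \<xi>)) * cis (- 2 * pi * (\<xi> \<bullet> u)) \<partial>lborel)
    = complex_of_real (gauss_hat (u /\<^sub>R \<epsilon>) / \<epsilon> ^ DIM('a))"
proof -
  define k where "k \<xi> = complex_of_real (gauss \<xi>) * cis (- 2 * pi * (\<xi> \<bullet> (u /\<^sub>R \<epsilon>)))" for \<xi>
  have [measurable]: "k \<in> borel_measurable borel" unfolding k_def by measurable
  have "complex_of_real (gauss_hat (u /\<^sub>R \<epsilon>)) = (\<integral>\<xi>. k \<xi> \<partial>lborel)"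
    unfolding k_def by (rule gauss_fourier[symmetric])
  also have "\<dots> = \<epsilon> ^ DIM('a) *\<^sub>R (\<integral>\<xi>. k (\<epsilon> *\<^sub>R \<xi>) \<partial>lborel)"
    by (rule integral_lborel_scale) (use assms in auto)
  also have "(\<integral>\<xi>. k (\<epsilon> *\<^sub>R \<xi>) \<partial>lborel) = (\<integral>\<xi>. complex_of_real (gauss (\<epsilon> *\<^sub>R \<xi>)) * cis (- 2 * pi * (\<xi> \<bullet> u)) \<partial>lborel)"
    unfolding k_def using assms by (intro Bochner_Integration.integral_cong) (auto simp: mult.assoc[symmetric])
  finally show ?thesis using assms by (simp add: scaleR_conv_of_real field_simps)
qed

lemma borel_measurable_fst_snd:
  fixes f :: "'c \<Rightarrow> 'a::topological_space \<times> 'b::topological_space"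
  assumes "f \<in> borel_measurable M"
  shows borel_measurable_fst_comp [measurable (raw)]: "(\<lambda>x. fst (f x)) \<in> borel_measurable M"
    and borel_measurable_snd_comp [measurable (raw)]: "(\<lambda>x. snd (f x)) \<in> borel_measurable M"
  using assms by (auto intro!: measurable_compose[OF assms] borel_measurable_continuous_onI continuous_intros)

lemma integrable_lborel_tensor_complex:
  fixes f :: "'a::euclidean_space \<Rightarrow> complex" and g :: "'b::euclidean_space \<Rightarrow> complex"
  assumes "integrable lborel f" "integrable lborel g"
  shows "integrable (lborel \<Otimes>\<^sub>M lborel) (\<lambda>p. f (fst p) * g (snd p))"
proof (rule Bochner_Integration.integrable_bound)
  show "integrable (lborel \<Otimes>\<^sub>M lborel) (\<lambda>p. norm (f (fst p)) * norm (g (snd p)))"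
    using assms by (intro integrable_lborel_tensor integrable_norm)
  have [measurable]: "f \<in> borel_measurable borel" "g \<in> borel_measurable borel"
    using assms[THEN borel_measurable_integrable] by auto
  show "(\<lambda>p. f (fst p) * g (snd p)) \<in> borel_measurable (lborel \<Otimes>\<^sub>M lborel)" by measurable
qed (auto simp: norm_mult)

lemma integral_lborel_tensor:
  fixes f :: "'a::euclidean_space \<Rightarrow> complex" and g :: "'b::euclidean_space \<Rightarrow> complex"
  assumes "integrable lborel f" "integrable lborel g"
  shows "(\<integral>p. f (fst p) * g (snd p) \<partial>lborel) = (\<integral>x. f x \<partial>lborel) * (\<integral>y. g y \<partial>lborel)"
  unfolding lborel_prod[symmetric]
  by (subst lborel_pair.integral_fst'[OF integrable_lborel_tensor_complex[OF assms], symmetric]) simp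

section \<open>Gaussian regularization of the Fourier transform\<close>

lemma fourier_measurable [measurable]:
  assumes [measurable]: "F \<in> borel_measurable borel"
  shows "fourier F \<in> borel_measurable borel"
  unfolding fourier_def by measurable

lemma integrable_fourier_integrand:
  assumes "integrable lborel F"
  shows "integrable lborel (\<lambda>t. F t * cis (c * (\<xi> \<bullet> t)))"
proof (rule Bochner_Integration.integrable_bound[OF assms])
  have [measurable]: "F \<in> borel_measurable borel"
    using borel_measurable_integrable[OF assms] by simp
  show "(\<lambda>t. F t * cis (c * (\<xi> \<bullet> t))) \<in> borel_measurable lborel" by measurable
qed (auto simp: norm_mult)

lemma gauss_scaled_integrable: "\<epsilon> > 0 \<Longrightarrow> integrable lborel (\<lambda>\<xi>::'a::euclidean_space. gauss (\<epsilon> *\<^sub>R \<xi>))"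
  using integrable_lborel_scale[of gauss \<epsilon>] integrable_gauss by auto

text \<open>The squared transform is a double integral in time, but integrating it in frequency need
  not converge absolutely. With the Gaussian weight, \<open>K\<close> is integrable in all three
  variables: integrating out the time pair \<open>p\<close> gives the weighted squared transform,
  integrating out the frequency gives \<open>W p\<close>.\<close>

lemma fourier_gauss_weighted:
  fixes F :: "'a::euclidean_space \<Rightarrow> complex"
  assumes F: "integrable lborel F" and \<epsilon>: "\<epsilon> > 0"
  defines "W \<equiv> (\<lambda>p. F (snd p) * cnj (F (fst p)) * complex_of_real (gauss_hat ((snd p - fst p) /\<^sub>R \<epsilon>) / \<epsilon> ^ DIM('a)))"
  shows "integrable (lborel \<Otimes>\<^sub>M lborel) W"
    and "integrable lborel (\<lambda>\<xi>. gauss (\<epsilon> *\<^sub>R \<xi>) * (cmod (fourier F \<xi>))\<^sup>2)"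
    and "complex_of_real (\<integral>\<xi>. gauss (\<epsilon> *\<^sub>R \<xi>) * (cmod (fourier F \<xi>))\<^sup>2 \<partial>lborel) = (\<integral>p. W p \<partial>(lborel \<Otimes>\<^sub>M lborel))"
proof -
  have [measurable]: "F \<in> borel_measurable borel"
    using borel_measurable_integrable[OF F] by simp
  define K where "K \<xi> p = complex_of_real (gauss (\<epsilon> *\<^sub>R \<xi>)) * (F (snd p) * cnj (F (fst p)) * cis (- 2 * pi * (\<xi> \<bullet> (snd p - fst p))))"
    for \<xi> :: 'a and p :: "'a \<times> 'a"
  have [measurable]: "case_prod K \<in> borel_measurable (lborel \<Otimes>\<^sub>M lborel)"
    unfolding K_def case_prod_unfold
    by measurable
  have iF: "integrable lborel (\<lambda>p. norm (F (fst p)) * norm (F (snd p)))"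
    using integrable_lborel_tensor[OF integrable_norm[OF F] integrable_norm[OF F]] by (simp add: lborel_prod)
  have iK: "integrable (lborel \<Otimes>\<^sub>M lborel) (case_prod K)"
    by (rule Bochner_Integration.integrable_bound[OF integrable_lborel_tensor[OF gauss_scaled_integrable[OF \<epsilon>] iF]])
       (auto simp: K_def case_prod_unfold norm_mult abs_mult mult_ac)
  have 1: "(\<integral>\<xi>. K \<xi> p \<partial>lborel) = W p" for p
  proof -
    have "(\<integral>\<xi>. K \<xi> p \<partial>lborel) = F (snd p) * cnj (F (fst p)) *
        (\<integral>\<xi>. complex_of_real (gauss (\<epsilon> *\<^sub>R \<xi>)) * cis (- 2 * pi * (\<xi> \<bullet> (snd p - fst p))) \<partial>lborel)"
      by (subst integral_mult_right_zero[symmetric]) (simp add: K_def mult_ac)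
    then show ?thesis by (simp only: gauss_fourier_scaled[OF \<epsilon>] W_def)
  qed
  have 2: "(\<integral>p. K \<xi> p \<partial>lborel) = complex_of_real (gauss (\<epsilon> *\<^sub>R \<xi>) * (cmod (fourier F \<xi>))\<^sup>2)" for \<xi>
  proof -
    define a where "a t = F t * cis (- 2 * pi * (\<xi> \<bullet> t))" for t
    have ia: "integrable lborel a" unfolding a_def by (rule integrable_fourier_integrand[OF F])
    have ica: "integrable lborel (\<lambda>t. cnj (a t))" using ia by simp
    have "K \<xi> p = complex_of_real (gauss (\<epsilon> *\<^sub>R \<xi>)) * (cnj (a (fst p)) * a (snd p))" for p
    proof -
      have "cis (- 2 * pi * (\<xi> \<bullet> (snd p - fst p))) = cnj (cis (- 2 * pi * (\<xi> \<bullet> fst p))) * cis (- 2 * pi * (\<xi> \<bullet> snd p))"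
        by (simp add: cis_cnj cis_mult inner_diff_right algebra_simps)
      then show ?thesis unfolding K_def a_def by (simp only: complex_cnj_mult mult_ac)
    qed
    then have "(\<integral>p. K \<xi> p \<partial>lborel) = complex_of_real (gauss (\<epsilon> *\<^sub>R \<xi>)) * (cnj (\<integral>t. a t \<partial>lborel) * (\<integral>t. a t \<partial>lborel))"
      using integral_lborel_tensor[OF ica ia] by simp
    also have "\<dots> = complex_of_real (gauss (\<epsilon> *\<^sub>R \<xi>)) * complex_of_real ((cmod (fourier F \<xi>))\<^sup>2)"
      by (simp only: complex_norm_square fourier_def a_def mult.commute)
    finally show ?thesis by simp
  qed
  show "integrable (lborel \<Otimes>\<^sub>M lborel) W"
    using lborel_pair.integrable_snd[OF iK] by (simp add: 1 lborel_prod)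
  show "integrable lborel (\<lambda>\<xi>. gauss (\<epsilon> *\<^sub>R \<xi>) * (cmod (fourier F \<xi>))\<^sup>2)"
    using lborel_pair.integrable_fst[OF iK] unfolding 2 complex_of_real_integrable_eq .
  show "complex_of_real (\<integral>\<xi>. gauss (\<epsilon> *\<^sub>R \<xi>) * (cmod (fourier F \<xi>))\<^sup>2 \<partial>lborel) = (\<integral>p. W p \<partial>(lborel \<Otimes>\<^sub>M lborel))"
    using lborel_pair.Fubini_integral[OF iK] unfolding 1 2 integral_complex_of_real lborel_prod by simp
qed

lemma L2_norm_borel: "f \<in> borel_measurable borel \<Longrightarrow> (L2_norm f)\<^sup>2 = (\<integral>x. (cmod (f x))\<^sup>2 \<partial>lborel)"
  unfolding L2_norm_sq by (rule integral_completion) simp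

lemma L2_inner_borel: "f \<in> borel_measurable borel \<Longrightarrow> g \<in> borel_measurable borel \<Longrightarrow>
    L2_inner f g = (\<integral>x. f x * cnj (g x) \<partial>lborel)"
  unfolding L2_inner_def by (rule integral_completion) simp

lemma L2_translate:
  assumes [measurable]: "f \<in> borel_measurable borel" and "L2 f"
  shows "L2 (\<lambda>t. f (c + t))" "L2_norm (\<lambda>t. f (c + t)) = L2_norm f"
proof -
  show "L2 (\<lambda>t. f (c + t))"
    using assms(2) integrable_lborel_translate[of "\<lambda>x. (cmod (f x))\<^sup>2" c] by (simp add: L2_borel_iff)
  have "(L2_norm (\<lambda>t. f (c + t)))\<^sup>2 = (L2_norm f)\<^sup>2"
    using integral_lborel_translate[of "\<lambda>x. (cmod (f x))\<^sup>2" c] by (simp add: L2_norm_borel)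
  then show "L2_norm (\<lambda>t. f (c + t)) = L2_norm f" by simp
qed

definition autocorr :: "('a::euclidean_space \<Rightarrow> complex) \<Rightarrow> 'a \<Rightarrow> complex" where
  "autocorr F v = (\<integral>t. F (v + t) * cnj (F t) \<partial>lborel)"

lemma autocorr_inner: "F \<in> borel_measurable borel \<Longrightarrow> autocorr F v = L2_inner (\<lambda>t. F (v + t)) F"
  unfolding autocorr_def by (subst L2_inner_borel) auto

lemma autocorr_bound:
  assumes "F \<in> borel_measurable borel" "L2 F"
  shows "cmod (autocorr F v) \<le> (L2_norm F)\<^sup>2"
  using L2_Cauchy_Schwarz[OF L2_translate(1)[OF assms] assms(2), of v] L2_translate(2)[OF assms]
  by (simp add: autocorr_inner assms power2_eq_square)

text \<open>At 0 the autocorrelation is the squared norm; the deviation is the inner product of a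
  translation difference with \<open>F\<close>. Here continuity of translations in L2 enters
  Plancherel's theorem.\<close>

lemma autocorr_continuous_0:
  assumes [measurable]: "F \<in> borel_measurable borel" and F: "L2 F" and v: "v \<longlonglongrightarrow> 0"
  shows "(\<lambda>n. autocorr F (v n)) \<longlonglongrightarrow> complex_of_real ((L2_norm F)\<^sup>2)"
proof -
  have "(\<lambda>n. L2_norm (\<lambda>t. F (v n + t) - F t)) \<longlonglongrightarrow> sqrt 0"
  proof -
    have "L2_norm (\<lambda>t. F (v n + t) - F t) = sqrt (\<integral>t. (cmod (F (v n + t) - F t))\<^sup>2 \<partial>lborel)" for n
      by (subst L2_norm_borel[symmetric]) auto
    then show ?thesis
      using L2_translation_continuous[OF assms(1) _ v] F tendsto_real_sqrt[where x=0] by (fastforce simp: L2_borel_iff)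
  qed
  then have lim: "(\<lambda>n. L2_norm (\<lambda>t. F (v n + t) - F t) * L2_norm F) \<longlonglongrightarrow> 0"
    by (auto intro!: tendsto_eq_intros)
  have "norm (autocorr F (v n) - complex_of_real ((L2_norm F)\<^sup>2)) \<le> L2_norm (\<lambda>t. F (v n + t) - F t) * L2_norm F" for n
  proof -
    have "autocorr F (v n) - complex_of_real ((L2_norm F)\<^sup>2) = L2_inner (\<lambda>t. F (v n + t) - F t) F"
      by (simp only: autocorr_inner[OF assms(1)] L2_inner_self[symmetric] L2_inner_diff_left[OF L2_translate(1)[OF assms(1) F] F F])
    then show ?thesis
      using L2_Cauchy_Schwarz[OF L2_diff[OF L2_translate(1)[OF assms(1) F, of "v n"] F] F] by simp
  qed
  then have "(\<lambda>n. autocorr F (v n) - complex_of_real ((L2_norm F)\<^sup>2)) \<longlonglongrightarrow> 0"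
    by (intro Lim_null_comparison[OF _ lim]) auto
  then show ?thesis by (simp add: LIM_zero_iff)
qed

text \<open>The substitution s = t + \<epsilon> u cancels the normalizing power of \<epsilon> and
  moves \<epsilon> from the density into the argument of the autocorrelation. The density
  \<open>gauss_hat\<close> is then fixed, and can dominate the limit of small \<epsilon>.\<close>

lemma integral_gauss_kernel_eq_autocorr:
  fixes F :: "'a::euclidean_space \<Rightarrow> complex"
  assumes F: "integrable lborel F" and F2: "L2 F" and \<epsilon>: "\<epsilon> > 0"
  shows "complex_of_real (\<integral>\<xi>. gauss (\<epsilon> *\<^sub>R \<xi>) * (cmod (fourier F \<xi>))\<^sup>2 \<partial>lborel)
     = (\<integral>u. complex_of_real (gauss_hat u) * autocorr F (\<epsilon> *\<^sub>R u) \<partial>lborel)"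
proof -
  have [measurable]: "F \<in> borel_measurable borel"
    using borel_measurable_integrable[OF F] by simp
  define W where "W p = F (snd p) * cnj (F (fst p)) * complex_of_real (gauss_hat ((snd p - fst p) /\<^sub>R \<epsilon>) / \<epsilon> ^ DIM('a))" for p
  have iW: "integrable (lborel \<Otimes>\<^sub>M lborel) W"
    and eW: "complex_of_real (\<integral>\<xi>. gauss (\<epsilon> *\<^sub>R \<xi>) * (cmod (fourier F \<xi>))\<^sup>2 \<partial>lborel) = (\<integral>p. W p \<partial>(lborel \<Otimes>\<^sub>M lborel))"
    using fourier_gauss_weighted[OF F \<epsilon>] unfolding W_def by auto
  define Q where "Q u t = complex_of_real (gauss_hat u) * (F (\<epsilon> *\<^sub>R u + t) * cnj (F t))" for u t
  have [measurable]: "case_prod Q \<in> borel_measurable (lborel \<Otimes>\<^sub>M lborel)"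
    unfolding Q_def by measurable
  have FF: "integrable lborel (\<lambda>t. F (v + t) * cnj (F t))" for v
    using integrable_L2_mult[OF L2_translate(1)[OF \<open>F \<in> borel_measurable borel\<close> F2] F2]
    by (subst (asm) integrable_completion) auto
  have iQ: "integrable (lborel \<Otimes>\<^sub>M lborel) (case_prod Q)"
  proof (rule lborel_pair.Fubini_integrable)
    show "integrable lborel (\<lambda>u. \<integral>t. norm (case_prod Q (u, t)) \<partial>lborel)"
    proof (rule Bochner_Integration.integrable_bound[where f="\<lambda>u. gauss_hat u * (L2_norm F)\<^sup>2"])
      show "integrable lborel (\<lambda>u::'a. gauss_hat u * (L2_norm F)\<^sup>2)"
        using gauss_hat_integral(1) by auto
      have "(\<integral>t. norm (case_prod Q (u, t)) \<partial>lborel) \<le> gauss_hat u * (L2_norm F)\<^sup>2" for u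
      proof -
        have "(\<integral>t. norm (case_prod Q (u, t)) \<partial>lborel) = gauss_hat u * (\<integral>t. cmod (F (\<epsilon> *\<^sub>R u + t)) * cmod (F t) \<partial>lborel)"
          by (simp add: Q_def norm_mult)
        also have "(\<integral>t. cmod (F (\<epsilon> *\<^sub>R u + t)) * cmod (F t) \<partial>lborel) = (\<integral>t. cmod (F (\<epsilon> *\<^sub>R u + t)) * cmod (F t) \<partial>lebesgue)"
          by (rule integral_completion[symmetric]) measurable
        also have "\<dots> \<le> (L2_norm F)\<^sup>2"
          using L2_abs_Cauchy_Schwarz[OF L2_translate(1) F2, of F "\<epsilon> *\<^sub>R u"] L2_translate(2)[of F "\<epsilon> *\<^sub>R u"] F2
          by (simp add: power2_eq_square)
        finally show ?thesis by (simp add: mult_left_mono)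
      qed
      then show "AE u in lborel. norm (\<integral>t. norm (case_prod Q (u, t)) \<partial>lborel) \<le> norm (gauss_hat u * (L2_norm F)\<^sup>2)"
        by (intro AE_I2) (simp add: abs_of_nonneg)
    qed measurable
    show "AE u in lborel. integrable lborel (\<lambda>t. case_prod Q (u, t))"
      using FF by (intro AE_I2) (simp add: Q_def)
  qed measurable
  have inner: "(\<integral>s. W (t, s) \<partial>lborel) = (\<integral>u. Q u t \<partial>lborel)" for t
  proof -
    have "(\<integral>s. W (t, s) \<partial>lborel) = (\<integral>u. W (t, t + u) \<partial>lborel)"
      by (rule integral_lborel_translate[symmetric]) (simp add: W_def)
    also have "\<dots> = \<epsilon> ^ DIM('a) *\<^sub>R (\<integral>u. W (t, t + \<epsilon> *\<^sub>R u) \<partial>lborel)"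
      by (rule integral_lborel_scale[OF _ \<epsilon>]) (simp add: W_def)
    also have "\<dots> = (\<integral>u. \<epsilon> ^ DIM('a) *\<^sub>R W (t, t + \<epsilon> *\<^sub>R u) \<partial>lborel)"
      by simp
    also have "\<dots> = (\<integral>u. Q u t \<partial>lborel)"
      using \<epsilon> by (intro Bochner_Integration.integral_cong) (auto simp: W_def Q_def scaleR_conv_of_real add.commute)
    finally show ?thesis .
  qed
  have "(\<integral>p. W p \<partial>(lborel \<Otimes>\<^sub>M lborel)) = (\<integral>t. (\<integral>u. Q u t \<partial>lborel) \<partial>lborel)"
    by (subst lborel_pair.integral_fst'[OF iW, symmetric]) (simp only: inner)
  also have "\<dots> = (\<integral>u. (\<integral>t. Q u t \<partial>lborel) \<partial>lborel)"
    by (rule lborel_pair.Fubini_integral[OF iQ])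
  also have "\<dots> = (\<integral>u. complex_of_real (gauss_hat u) * autocorr F (\<epsilon> *\<^sub>R u) \<partial>lborel)"
    by (simp add: Q_def autocorr_def)
  finally show ?thesis using eW by simp
qed

text \<open>Let the width parameter decrease to 0 in the two expressions for the weighted energy.
  The frequency side increases, so monotone convergence applies and finiteness of the left integral
  is part of the conclusion; the time side is dominated because \<open>autocorr\<close> is bounded
  by the squared norm, and its limit uses that \<open>gauss_hat\<close> has total mass 1.\<close>

theorem Plancherel:
  fixes F :: "'a::euclidean_space \<Rightarrow> complex"
  assumes F: "integrable lborel F" and F2: "L2 F"
  shows "(\<integral>\<^sup>+\<xi>. ennreal ((cmod (fourier F \<xi>))\<^sup>2) \<partial>lborel) = ennreal ((L2_norm F)\<^sup>2)"
proof -
  have FB [measurable]: "F \<in> borel_measurable borel"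
    using borel_measurable_integrable[OF F] by simp
  define \<epsilon> :: "nat \<Rightarrow> real" where "\<epsilon> n = 1 / Suc n" for n
  have \<epsilon>: "\<epsilon> n > 0" for n by (simp add: \<epsilon>_def)
  have \<epsilon>0: "\<epsilon> \<longlonglongrightarrow> 0" unfolding \<epsilon>_def using LIMSEQ_Suc[OF lim_1_over_n] by simp
  define a where "a n = (\<integral>\<xi>. gauss (\<epsilon> n *\<^sub>R \<xi>) * (cmod (fourier F \<xi>))\<^sup>2 \<partial>lborel)" for n
  have "(\<lambda>n. complex_of_real (a n)) \<longlonglongrightarrow> (\<integral>u. complex_of_real (gauss_hat u) * complex_of_real ((L2_norm F)\<^sup>2) \<partial>(lborel :: 'a measure))"
    unfolding a_def integral_gauss_kernel_eq_autocorr[OF F F2 \<epsilon>]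
  proof (rule integral_dominated_convergence[where w="\<lambda>u. gauss_hat u * (L2_norm F)\<^sup>2"])
    show "integrable lborel (\<lambda>u::'a. gauss_hat u * (L2_norm F)\<^sup>2)"
      using gauss_hat_integral(1) by auto
    show "AE u in lborel. (\<lambda>n. complex_of_real (gauss_hat u) * autocorr F (\<epsilon> n *\<^sub>R u)) \<longlonglongrightarrow>
        complex_of_real (gauss_hat u) * complex_of_real ((L2_norm F)\<^sup>2)"
    proof (intro AE_I2 tendsto_mult_left autocorr_continuous_0[OF FB F2])
      show "(\<lambda>n. \<epsilon> n *\<^sub>R u) \<longlonglongrightarrow> 0" for u :: 'a
        using tendsto_scaleR[OF \<epsilon>0 tendsto_const[of u]] by simp
    qed
    show "AE u in lborel. cmod (complex_of_real (gauss_hat u) * autocorr F (\<epsilon> n *\<^sub>R u)) \<le> gauss_hat u * (L2_norm F)\<^sup>2" for n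
      using autocorr_bound[OF FB F2] by (intro AE_I2) (auto simp: norm_mult intro!: mult_left_mono)
    show "(\<lambda>u. complex_of_real (gauss_hat u) * autocorr F (\<epsilon> n *\<^sub>R u)) \<in> borel_measurable lborel" for n
      unfolding autocorr_def by measurable
  qed measurable
  also have "(\<integral>u. complex_of_real (gauss_hat u) * complex_of_real ((L2_norm F)\<^sup>2) \<partial>(lborel :: 'a measure)) = complex_of_real ((L2_norm F)\<^sup>2)"
    using gauss_hat_integral(2)[where 'a='a] by simp
  finally have "a \<longlonglongrightarrow> (L2_norm F)\<^sup>2"
    by (simp only: tendsto_of_real_iff)
  then have lim1: "(\<lambda>n. ennreal (a n)) \<longlonglongrightarrow> ennreal ((L2_norm F)\<^sup>2)"
    by (rule tendsto_ennrealI)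
  have nn: "(\<integral>\<^sup>+\<xi>. ennreal (gauss (\<epsilon> n *\<^sub>R \<xi>) * (cmod (fourier F \<xi>))\<^sup>2) \<partial>lborel) = ennreal (a n)" for n
    unfolding a_def by (rule nn_integral_eq_integral[OF fourier_gauss_weighted(2)[OF F \<epsilon>]]) (auto simp: gauss_def)
  have "(\<lambda>n. \<integral>\<^sup>+\<xi>. ennreal (gauss (\<epsilon> n *\<^sub>R \<xi>) * (cmod (fourier F \<xi>))\<^sup>2) \<partial>lborel)
      \<longlonglongrightarrow> (\<integral>\<^sup>+\<xi>. ennreal ((cmod (fourier F \<xi>))\<^sup>2) \<partial>lborel)"
  proof (rule nn_integral_LIMSEQ)
    show "incseq (\<lambda>n \<xi>. ennreal (gauss (\<epsilon> n *\<^sub>R \<xi>) * (cmod (fourier F \<xi>))\<^sup>2))"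
    proof (intro incseq_SucI le_funI ennreal_leI mult_right_mono zero_le_power2)
      fix n and \<xi> :: 'a
      have "\<epsilon> (Suc n) * norm \<xi> \<le> \<epsilon> n * norm \<xi>"
        by (intro mult_right_mono) (auto simp: \<epsilon>_def field_simps)
      show "gauss (\<epsilon> n *\<^sub>R \<xi>) \<le> gauss (\<epsilon> (Suc n) *\<^sub>R \<xi>)"
        using \<open>\<epsilon> (Suc n) * norm \<xi> \<le> \<epsilon> n * norm \<xi>\<close> \<epsilon>[of n] \<epsilon>[of "Suc n"]
        by (auto simp: gauss_def intro!: power_mono mult_nonneg_nonneg less_imp_le[OF \<epsilon>])
    qed
    show "(\<lambda>n. ennreal (gauss (\<epsilon> n *\<^sub>R \<xi>) * (cmod (fourier F \<xi>))\<^sup>2)) \<longlonglongrightarrow> ennreal ((cmod (fourier F \<xi>))\<^sup>2)" for \<xi>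
    proof (rule tendsto_ennrealI)
      have "(\<lambda>n. gauss (\<epsilon> n *\<^sub>R \<xi>) * (cmod (fourier F \<xi>))\<^sup>2) \<longlonglongrightarrow> exp (- (norm (0 *\<^sub>R \<xi>))\<^sup>2 / 2) * (cmod (fourier F \<xi>))\<^sup>2"
        unfolding gauss_def by (intro tendsto_intros \<epsilon>0) auto
      then show "(\<lambda>n. gauss (\<epsilon> n *\<^sub>R \<xi>) * (cmod (fourier F \<xi>))\<^sup>2) \<longlonglongrightarrow> (cmod (fourier F \<xi>))\<^sup>2" by simp
    qed
  qed measurable
  then show ?thesis
    using LIMSEQ_unique[OF lim1] unfolding nn by simp
qed

subsection \<open>Decay of the ambiguity function of a Schwartz window\<close>

text \<open>A product over coordinates instead of a power of the norm: its reciprocal is integrable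
  by reduction to one dimension, and each factor can be won separately by two derivatives in one
  coordinate direction.\<close>

definition wt :: "'a::euclidean_space \<Rightarrow> real" where
  "wt t = (\<Prod>b\<in>Basis. 1 + (t \<bullet> b)\<^sup>2)"

lemma wt_ge_1: "1 \<le> wt t"
  unfolding wt_def by (intro prod_ge_1) auto

lemma wt_pos [simp]: "0 < wt t"
  using wt_ge_1[of t] by linarith

lemma wt_nonneg [simp]: "0 \<le> wt t"
  using wt_ge_1[of t] by linarith

lemma wt_measurable [measurable]: "wt \<in> borel_measurable borel"
  unfolding wt_def by measurable

lemma wt_minus [simp]: "wt (- x) = wt x"
  by (simp add: wt_def)

text \<open>The weight is moderate. In each coordinate the right side exceeds the left by (a - b)^2
  + 2 a^2 b^2 + 1, where a and b are the coordinates of \<open>x\<close> and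
  \<open>y\<close>.\<close>

lemma wt_add_le: "wt (x + y) \<le> 2 ^ DIM('a) * wt x * wt (y :: 'a::euclidean_space)"
proof -
  have "wt (x + y) \<le> (\<Prod>b\<in>Basis. 2 * ((1 + (x \<bullet> b)\<^sup>2) * (1 + (y \<bullet> b)\<^sup>2)))"
    unfolding wt_def
  proof (intro prod_mono conjI)
    fix b :: 'a
    have "0 \<le> (x \<bullet> b - y \<bullet> b)\<^sup>2 + 2 * (x \<bullet> b)\<^sup>2 * (y \<bullet> b)\<^sup>2 + 1" by (intro add_nonneg_nonneg) auto
    then show "1 + ((x + y) \<bullet> b)\<^sup>2 \<le> 2 * ((1 + (x \<bullet> b)\<^sup>2) * (1 + (y \<bullet> b)\<^sup>2))"
      by (simp add: inner_add_left power2_eq_square algebra_simps)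
  qed (auto intro: add_nonneg_nonneg)
  also have "\<dots> = 2 ^ DIM('a) * wt x * wt y"
    by (simp add: prod.distrib wt_def)
  finally show ?thesis .
qed

lemma wt_le: "wt t \<le> (1 + (norm t)\<^sup>2) ^ DIM('a)" for t :: "'a::euclidean_space"
proof -
  have "(t \<bullet> b)\<^sup>2 \<le> (norm t)\<^sup>2" if "b \<in> Basis" for b
    using power_mono[OF Basis_le_norm[OF that, of t], of 2] by simp
  then have "wt t \<le> (\<Prod>b\<in>(Basis::'a set). 1 + (norm t)\<^sup>2)"
    unfolding wt_def by (intro prod_mono) (auto intro: add_nonneg_nonneg)
  then show ?thesis by simp
qed

lemma integrable_inverse_wt: "integrable lborel (\<lambda>t::'a::euclidean_space. 1 / wt t)"
proof -
  have "integrable lborel (\<lambda>x::real. inverse (1 + x\<^sup>2))"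
    using integrable_inverse_1_plus_square by (simp add: set_integrable_def)
  then have "integrable lborel (\<lambda>x. complex_of_real (inverse (1 + x\<^sup>2)))"
    unfolding complex_of_real_integrable_eq .
  then have "integrable lborel (\<lambda>t::'a. \<Prod>b\<in>Basis. complex_of_real (inverse (1 + (t \<bullet> b)\<^sup>2)))"
    by (intro integrable_lborel_prod[of "\<lambda>b x. complex_of_real (inverse (1 + x\<^sup>2))"])
  then have "integrable lborel (\<lambda>t::'a. complex_of_real (1 / wt t))"
    by (simp only: of_real_prod[symmetric] wt_def prod_inversef inverse_eq_divide prod_dividef) simp
  then show ?thesis unfolding complex_of_real_integrable_eq .
qed

lemma integrable_wt_bound:
  fixes F :: "'a::euclidean_space \<Rightarrow> complex"
  assumes "F \<in> borel_measurable borel" "\<And>t. cmod (F t) \<le> C / wt t"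
  shows "integrable lborel F"
proof (rule Bochner_Integration.integrable_bound)
  show "integrable lborel (\<lambda>t. C * (1 / wt (t::'a)))"
    using integrable_inverse_wt by (rule integrable_mult_right)
  show "AE x in lborel. norm (F x) \<le> norm (C * (1 / wt x))"
    using assms(2) by (intro AE_I2) (auto intro!: order_trans[OF assms(2)] divide_right_mono)
qed (use assms in simp)

section \<open>Schwartz windows: pointwise decay and integration by parts\<close>

lemma pderivs_has_derivative:
  assumes "schwartz \<phi>" "set vs \<subseteq> Basis"
  shows "(pderivs vs \<phi> has_derivative (\<lambda>h. frechet_derivative (pderivs vs \<phi>) (at t) h)) (at t)"
  using assms unfolding schwartz_def by (simp add: frechet_derivative_works[symmetric])

lemma pderivs_continuous:
  assumes "schwartz \<phi>" "set vs \<subseteq> Basis"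
  shows "continuous_on UNIV (pderivs vs \<phi>)"
  using pderivs_has_derivative[OF assms] by (intro continuous_at_imp_continuous_on) (auto dest: has_derivative_continuous)

lemma pderivs_decay:
  fixes \<phi> :: "'a::euclidean_space \<Rightarrow> complex"
  assumes "schwartz \<phi>" "set vs \<subseteq> Basis"
  obtains C where "C \<ge> 0" "\<And>t. cmod (pderivs vs \<phi> t) \<le> C / wt t ^ j"
proof -
  define n where "n = DIM('a) * j"
  have "bounded (range (\<lambda>x. norm x ^ k *\<^sub>R pderivs vs \<phi> x))" for k
    using assms unfolding schwartz_def by blast
  then have "\<exists>B. \<forall>t. norm t ^ k * cmod (pderivs vs \<phi> t) \<le> B" for k
    unfolding bounded_iff by auto
  then obtain B where B: "\<And>k t. norm t ^ k * cmod (pderivs vs \<phi> t) \<le> B k"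
    by metis
  \<comment> \<open>Only the seminorms with k = 0 and k = 2 n are used: the power
    \<open>wt t ^ j\<close> is at most (1 + |t|^2)^n, which is at most 2^n inside the unit ball and
    2^n |t|^(2 n) outside.\<close>
  define C where "C = 2 ^ n * (B 0 + B (2 * n))"
  have main: "wt t ^ j * cmod (pderivs vs \<phi> t) \<le> C" for t
  proof -
    have "(1 + (norm t)\<^sup>2) ^ n \<le> 2 ^ n * (1 + norm t ^ (2 * n))"
    proof (cases "norm t \<le> 1")
      case True
      then have "(norm t)\<^sup>2 \<le> 1" by (simp add: power_le_one)
      then have "(1 + (norm t)\<^sup>2) ^ n \<le> 2 ^ n" by (intro power_mono) auto
      then show ?thesis by (simp add: distrib_left add_increasing2)
    next
      case False
      then have "1 \<le> (norm t)\<^sup>2" by (simp add: one_le_power)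
      then have "(1 + (norm t)\<^sup>2) ^ n \<le> (2 * (norm t)\<^sup>2) ^ n" by (intro power_mono) auto
      also have "\<dots> = 2 ^ n * norm t ^ (2 * n)" by (simp add: power_mult_distrib power_mult)
      finally show ?thesis by (simp add: distrib_left add_increasing)
    qed
    moreover have "wt t ^ j \<le> (1 + (norm t)\<^sup>2) ^ n"
      unfolding n_def power_mult by (intro power_mono wt_le) simp
    ultimately have "wt t ^ j * cmod (pderivs vs \<phi> t) \<le> 2 ^ n * (1 + norm t ^ (2 * n)) * cmod (pderivs vs \<phi> t)"
      by (intro mult_right_mono) auto
    also have "\<dots> = 2 ^ n * (norm t ^ 0 * cmod (pderivs vs \<phi> t) + norm t ^ (2 * n) * cmod (pderivs vs \<phi> t))"
      by (simp add: algebra_simps)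
    also have "\<dots> \<le> C"
      unfolding C_def by (intro mult_left_mono add_mono B) auto
    finally show ?thesis .
  qed
  show thesis
  proof (rule that)
    have "0 \<le> wt (0::'a) ^ j * cmod (pderivs vs \<phi> 0)" by simp
    then show "C \<ge> 0" using main[of 0] by linarith
    show "cmod (pderivs vs \<phi> t) \<le> C / wt t ^ j" for t
      using main[of t] by (simp add: pos_le_divide_eq mult.commute)
  qed
qed

text \<open>The difference quotients have vanishing integral by translation invariance, and the weight is
  moderate, so dominated convergence applies.\<close>

lemma integral_directional_derivative:
  fixes F :: "'a::euclidean_space \<Rightarrow> complex"
  assumes der: "\<And>t. (F has_derivative F' t) (at t)" and b: "b \<in> Basis"
    and F: "\<And>t. cmod (F t) \<le> C / wt t" and G: "\<And>t. cmod (F' t b) \<le> D / wt t"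
    and Gm: "(\<lambda>t. F' t b) \<in> borel_measurable borel"
  shows "(\<integral>t. F' t b \<partial>lborel) = 0"
proof -
  have [measurable]: "F \<in> borel_measurable borel"
    using der by (intro borel_measurable_continuous_onI continuous_at_imp_continuous_on) (auto dest: has_derivative_continuous)
  have iF: "integrable lborel F"
    by (rule integrable_wt_bound[OF _ F]) simp
  have D: "D \<ge> 0" using G[of 0] norm_ge_zero[of "F' 0 b"] wt_pos[of "0::'a"]
    by (smt (verit) divide_neg_pos)
  define h :: "nat \<Rightarrow> real" where "h n = 1 / Suc n" for n
  have h: "h n > 0" "h n \<le> 1" for n by (auto simp: h_def)
  have h0: "h \<longlonglongrightarrow> 0" unfolding h_def using LIMSEQ_Suc[OF lim_1_over_n] by simp
  define Q where "Q n t = (F (h n *\<^sub>R b + t) - F t) /\<^sub>R h n" for n t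
  have "(\<integral>t. Q n t \<partial>lborel) = 0" for n
    unfolding Q_def using iF integrable_lborel_translate[OF iF, of "h n *\<^sub>R b"] integral_lborel_translate[of F "h n *\<^sub>R b"]
    by simp
  moreover have "(\<lambda>n. \<integral>t. Q n t \<partial>lborel) \<longlonglongrightarrow> (\<integral>t. F' t b \<partial>lborel)"
  proof (rule integral_dominated_convergence[where w="\<lambda>t. (D * 4 ^ DIM('a)) * (1 / wt t)"])
    show "integrable lborel (\<lambda>t::'a. (D * 4 ^ DIM('a)) * (1 / wt t))"
      using integrable_inverse_wt by (rule integrable_mult_right)
    show "Q n \<in> borel_measurable lborel" for n unfolding Q_def by measurable
    show "AE t in lborel. (\<lambda>n. Q n t) \<longlonglongrightarrow> F' t b"
    proof (intro AE_I2)
      fix t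
      have lin: "linear (F' t)" using der has_derivative_linear by blast
      have "(\<lambda>k. norm (F (t + k) - F t - F' t k) / norm k) \<midarrow>0\<rightarrow> 0"
        using der[of t] by (simp add: has_derivative_at)
      moreover have "filterlim (\<lambda>n. h n *\<^sub>R b) (at 0) sequentially"
        unfolding filterlim_at using tendsto_scaleR[OF h0 tendsto_const[of b]] h(1) nonzero_Basis[OF b]
        by (auto simp: less_imp_neq[OF h(1), symmetric])
      ultimately have "(\<lambda>n. norm (F (t + h n *\<^sub>R b) - F t - F' t (h n *\<^sub>R b)) / norm (h n *\<^sub>R b)) \<longlonglongrightarrow> 0"
        by (rule filterlim_compose)
      moreover have "norm (F (t + h n *\<^sub>R b) - F t - F' t (h n *\<^sub>R b)) / norm (h n *\<^sub>R b) = norm (Q n t - F' t b)" for n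
      proof -
        have "Q n t - F' t b = (F (t + h n *\<^sub>R b) - F t - F' t (h n *\<^sub>R b)) /\<^sub>R h n"
          using h(1)[of n] by (simp add: Q_def linear_scale[OF lin] scaleR_diff_right add.commute)
        then show ?thesis using h(1)[of n] b by (simp add: divide_inverse mult.commute)
      qed
      ultimately have "(\<lambda>n. norm (Q n t - F' t b)) \<longlonglongrightarrow> 0" by simp
      then show "(\<lambda>n. Q n t) \<longlonglongrightarrow> F' t b"
        by (simp only: tendsto_norm_zero_iff LIM_zero_iff)
    qed
    show "AE t in lborel. norm (Q n t) \<le> (D * 4 ^ DIM('a)) * (1 / wt t)" for n
    proof (intro AE_I2)
      fix t
      have d: "((\<lambda>s. F (t + s *\<^sub>R b)) has_derivative (\<lambda>k. F' (t + s *\<^sub>R b) (k *\<^sub>R b))) (at s)" for s :: real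
        by (rule has_derivative_compose[OF _ der]) (auto intro!: derivative_eq_intros)
      have "\<exists>s\<in>{0<..<h n}. norm (F (t + h n *\<^sub>R b) - F (t + 0 *\<^sub>R b)) \<le> norm (F' (t + s *\<^sub>R b) ((h n - 0) *\<^sub>R b))"
      proof (rule mvt_general[OF h(1)])
        show "continuous_on {0..h n} (\<lambda>s. F (t + s *\<^sub>R b))"
          using d by (intro continuous_at_imp_continuous_on) (auto dest: has_derivative_continuous)
      qed (rule d)
      then obtain s where s: "0 < s" "s < h n" "norm (F (t + h n *\<^sub>R b) - F t) \<le> norm (F' (t + s *\<^sub>R b) (h n *\<^sub>R b))"
        by auto
      have lin: "linear (F' (t + s *\<^sub>R b))" using der has_derivative_linear by blast
      \<comment> \<open>The mean value point differs from \<open>t\<close> by a vector of length at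
        most 1. Moderateness costs one factor \<open>2 ^ DIM('a)\<close>, the weight of that vector
        a second one; this is the origin of \<open>4 ^ DIM('a)\<close> in the majorant.\<close>
      have "s\<^sup>2 \<le> 1" using s(1,2) h(2)[of n] by (simp add: power_le_one)
      then have "(1 + (norm (- (s *\<^sub>R b)))\<^sup>2) ^ DIM('a) \<le> 2 ^ DIM('a)"
        using b by (intro power_mono) auto
      then have w: "wt (- (s *\<^sub>R b)) \<le> 2 ^ DIM('a)" using wt_le order_trans by blast
      have "wt t = wt ((t + s *\<^sub>R b) + - (s *\<^sub>R b))" by simp
      also have "\<dots> \<le> 2 ^ DIM('a) * wt (t + s *\<^sub>R b) * wt (- (s *\<^sub>R b))" by (rule wt_add_le)
      also have "\<dots> \<le> 2 ^ DIM('a) * wt (t + s *\<^sub>R b) * 2 ^ DIM('a)"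
        by (intro mult_left_mono w) auto
      also have "\<dots> = 4 ^ DIM('a) * wt (t + s *\<^sub>R b)"
        by (simp add: power_mult_distrib[symmetric])
      finally have w2: "wt t \<le> 4 ^ DIM('a) * wt (t + s *\<^sub>R b)" .
      have "norm (Q n t) = norm (F (t + h n *\<^sub>R b) - F t) / h n"
        using h(1)[of n] by (simp add: Q_def add.commute divide_inverse mult.commute)
      also have "\<dots> \<le> norm (F' (t + s *\<^sub>R b) (h n *\<^sub>R b)) / h n"
        using s(3) h(1)[of n] by (intro divide_right_mono) auto
      also have "\<dots> = norm (F' (t + s *\<^sub>R b) b)"
        using h(1)[of n] by (simp add: linear_scale[OF lin])
      also have "\<dots> \<le> D / wt (t + s *\<^sub>R b)" by (rule G)
      also have "\<dots> \<le> (D * 4 ^ DIM('a)) * (1 / wt t)"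
        using mult_left_mono[OF w2 D] by (simp add: divide_le_eq mult_ac pos_le_divide_eq)
      finally show "norm (Q n t) \<le> (D * 4 ^ DIM('a)) * (1 / wt t)" .
    qed
  qed (use Gm in simp)
  ultimately have "(\<lambda>n::nat. 0) \<longlonglongrightarrow> (\<integral>t. F' t b \<partial>lborel)" by simp
  then show ?thesis by (metis LIMSEQ_const_iff)
qed

text \<open>Integration by parts without boundary terms: the derivative of \<open>P\<close> times
  the character has integral 0 by \<open>integral_directional_derivative\<close>, and the product
  rule splits it into the two transforms.\<close>

lemma fourier_directional_derivative:
  fixes P :: "'a::euclidean_space \<Rightarrow> complex"
  assumes der: "\<And>t. (P has_derivative P' t) (at t)" and b: "b \<in> Basis"
    and P: "\<And>t. cmod (P t) \<le> C / wt t" and G: "\<And>t. cmod (P' t b) \<le> D / wt t"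
    and Gm [measurable]: "(\<lambda>t. P' t b) \<in> borel_measurable borel"
  shows "fourier (\<lambda>t. P' t b) \<xi> = complex_of_real (2 * pi * (\<xi> \<bullet> b)) * \<i> * fourier P \<xi>"
proof -
  define c where "c t = cis (- 2 * pi * (\<xi> \<bullet> t))" for t
  have dc: "(c has_derivative (\<lambda>k. c t * (complex_of_real (- 2 * pi * (\<xi> \<bullet> k)) * \<i>))) (at t)" for t
  proof -
    have "((\<lambda>t. \<i> * complex_of_real (- 2 * pi * (\<xi> \<bullet> t))) has_derivative (\<lambda>k. \<i> * complex_of_real (- 2 * pi * (\<xi> \<bullet> k)))) (at t)"
      by (auto intro!: derivative_eq_intros)
    moreover have "(exp has_derivative (\<lambda>k. exp z * k)) (at z)" for z :: complex
      using DERIV_exp[of z] by (simp add: has_field_derivative_def)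
    ultimately show ?thesis
      unfolding c_def cis_conv_exp by (subst mult.commute[of _ \<i>]) (rule has_derivative_compose)
  qed
  have [measurable]: "P \<in> borel_measurable borel"
    using der by (intro borel_measurable_continuous_onI continuous_at_imp_continuous_on) (auto dest: has_derivative_continuous)
  have [measurable]: "c \<in> borel_measurable borel" unfolding c_def by measurable
  define F' where "F' t k = P t * (c t * (complex_of_real (- 2 * pi * (\<xi> \<bullet> k)) * \<i>)) + P' t k * c t" for t k
  have nc [simp]: "cmod (c t) = 1" for t by (simp add: c_def)
  have "(\<integral>t. F' t b \<partial>lborel) = 0"
  proof (rule integral_directional_derivative[OF _ b])
    show "((\<lambda>t. P t * c t) has_derivative F' t) (at t)" for t
      unfolding F'_def by (rule has_derivative_mult[OF der dc])
    show "cmod (P t * c t) \<le> C / wt t" for t using P by (simp add: norm_mult)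
    show "cmod (F' t b) \<le> (C * \<bar>2 * pi * (\<xi> \<bullet> b)\<bar> + D) / wt t" for t
    proof -
      have "cmod (F' t b) \<le> cmod (P t) * \<bar>2 * pi * (\<xi> \<bullet> b)\<bar> + cmod (P' t b)"
        unfolding F'_def by (rule order_trans[OF norm_triangle_ineq]) (simp add: norm_mult abs_mult)
      also have "\<dots> \<le> C / wt t * \<bar>2 * pi * (\<xi> \<bullet> b)\<bar> + D / wt t"
        by (intro add_mono mult_right_mono P G) auto
      finally show ?thesis by (simp add: add_divide_distrib)
    qed
    show "(\<lambda>t. F' t b) \<in> borel_measurable borel" unfolding F'_def by measurable
  qed
  moreover have "integrable lborel (\<lambda>t. P t * c t)" "integrable lborel (\<lambda>t. P' t b * c t)"
    using P G by (intro integrable_wt_bound[of _ C] integrable_wt_bound[of _ D]; simp add: norm_mult)+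
  moreover have "F' t b = complex_of_real (- 2 * pi * (\<xi> \<bullet> b)) * \<i> * (P t * c t) + P' t b * c t" for t
    by (simp add: F'_def mult_ac)
  ultimately have "complex_of_real (- 2 * pi * (\<xi> \<bullet> b)) * \<i> * (\<integral>t. P t * c t \<partial>lborel) + (\<integral>t. P' t b * c t \<partial>lborel) = 0"
    by (simp del: of_real_mult of_real_minus)
  then show ?thesis
    unfolding fourier_def c_def[symmetric] by (simp add: add_eq_0_iff)
qed

text \<open>For empty lists, the Fourier transform in \<open>t\<close> of this integrand is the
  ambiguity function of the window. The two lists make the family closed under differentiation in
  \<open>t\<close>: the product rule prolongs one list or the other.\<close>

definition amb :: "('a::euclidean_space \<Rightarrow> complex) \<Rightarrow> 'a list \<Rightarrow> 'a list \<Rightarrow> 'a \<Rightarrow> 'a \<Rightarrow> complex" where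
  "amb \<phi> vs ws x t = pderivs vs \<phi> t * cnj (pderivs ws \<phi> (t - x))"

lemma amb_measurable [measurable]:
  assumes "schwartz \<phi>" "set vs \<subseteq> Basis" "set ws \<subseteq> Basis"
  shows "amb \<phi> vs ws x \<in> borel_measurable borel"
proof -
  have [measurable]: "pderivs vs \<phi> \<in> borel_measurable borel" "pderivs ws \<phi> \<in> borel_measurable borel"
    using assms pderivs_continuous by (auto intro!: borel_measurable_continuous_onI)
  show ?thesis unfolding amb_def by measurable
qed

text \<open>The first factor is bounded with two powers of the weight. One of them, together with
  the decay of the translated factor, pays for the decay in \<open>x\<close> by moderateness; the
  other remains for integrability in \<open>t\<close>.\<close>

lemma amb_bound:
  fixes \<phi> :: "'a::euclidean_space \<Rightarrow> complex"
  assumes "schwartz \<phi>" "set vs \<subseteq> Basis" "set ws \<subseteq> Basis"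
  obtains C where "C \<ge> 0" "\<And>x t. cmod (amb \<phi> vs ws x t) \<le> C / wt x / wt t"
proof -
  obtain C where C: "C \<ge> 0" "\<And>t. cmod (pderivs vs \<phi> t) \<le> C / wt t ^ 2"
    using pderivs_decay[OF assms(1,2)] by blast
  obtain D where D: "D \<ge> 0" "\<And>t. cmod (pderivs ws \<phi> t) \<le> D / wt t ^ 1"
    using pderivs_decay[OF assms(1,3)] by blast
  show thesis
  proof (rule that)
    show "0 \<le> 2 ^ DIM('a) * C * D" using C D by simp
    fix x t :: 'a
    have "wt x = wt (t + - (t - x))" by simp
    also have "\<dots> \<le> 2 ^ DIM('a) * wt t * wt (t - x)"
      using wt_add_le[of t "- (t - x)"] by (simp only: wt_minus)
    finally have w: "wt x \<le> 2 ^ DIM('a) * wt t * wt (t - x)" .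
    have "cmod (amb \<phi> vs ws x t) \<le> (C / wt t ^ 2) * (D / wt (t - x))"
      unfolding amb_def norm_mult complex_mod_cnj using C D by (intro mult_mono) auto
    also have "\<dots> \<le> 2 ^ DIM('a) * C * D / wt x / wt t"
    proof -
      have "wt x * wt t / 2 ^ DIM('a) \<le> wt t ^ 2 * wt (t - x)"
        using mult_right_mono[OF w, of "wt t"] by (simp add: divide_le_eq power2_eq_square mult_ac)
      then have "C * D / (wt t ^ 2 * wt (t - x)) \<le> C * D / (wt x * wt t / 2 ^ DIM('a))"
        using C D by (intro divide_left_mono mult_pos_pos divide_pos_pos zero_less_power) auto
      then show ?thesis by (simp add: mult_ac)
    qed
    finally show "cmod (amb \<phi> vs ws x t) \<le> 2 ^ DIM('a) * C * D / wt x / wt t" .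
  qed
qed

text \<open>One frequency coordinate is traded for one derivative, falling on either copy of the
  window. The factor 2 pi is dropped, being at least 1.\<close>

lemma fourier_amb_derivative:
  fixes \<phi> :: "'a::euclidean_space \<Rightarrow> complex"
  assumes \<phi>: "schwartz \<phi>" and vs: "set vs \<subseteq> Basis" and ws: "set ws \<subseteq> Basis" and b: "b \<in> Basis"
  shows "\<bar>\<xi> \<bullet> b\<bar> * cmod (fourier (amb \<phi> vs ws x) \<xi>) \<le>
     cmod (fourier (amb \<phi> (b # vs) ws x) \<xi>) + cmod (fourier (amb \<phi> vs (b # ws) x) \<xi>)"
proof -
  have bvs: "set (b # vs) \<subseteq> Basis" and bws: "set (b # ws) \<subseteq> Basis" using assms by auto
  define P' where "P' t k = pderivs vs \<phi> t * cnj (frechet_derivative (pderivs ws \<phi>) (at (t - x)) k)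
      + frechet_derivative (pderivs vs \<phi>) (at t) k * cnj (pderivs ws \<phi> (t - x))" for t k
  have P'b: "P' t b = amb \<phi> (b # vs) ws x t + amb \<phi> vs (b # ws) x t" for t
    by (simp add: P'_def amb_def)
  have der: "(amb \<phi> vs ws x has_derivative P' t) (at t)" for t
  proof -
    have 1: "((\<lambda>t. t - x) has_derivative (\<lambda>h. h)) (at t)" by (auto intro!: derivative_eq_intros)
    have "((\<lambda>t. cnj (pderivs ws \<phi> (t - x))) has_derivative
        (\<lambda>h. cnj (frechet_derivative (pderivs ws \<phi>) (at (t - x)) h))) (at t)"
      by (rule bounded_linear.has_derivative[OF bounded_linear_cnj
            has_derivative_compose[OF 1 pderivs_has_derivative[OF \<phi> ws]]])
    from has_derivative_mult[OF pderivs_has_derivative[OF \<phi> vs] this]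
    show ?thesis unfolding P'_def amb_def .
  qed
  obtain C0 where C0: "C0 \<ge> 0" "\<And>x t. cmod (amb \<phi> vs ws x t) \<le> C0 / wt x / wt t"
    using amb_bound[OF \<phi> vs ws] by blast
  obtain C1 where C1: "C1 \<ge> 0" "\<And>x t. cmod (amb \<phi> (b # vs) ws x t) \<le> C1 / wt x / wt t"
    using amb_bound[OF \<phi> bvs ws] by blast
  obtain C2 where C2: "C2 \<ge> 0" "\<And>x t. cmod (amb \<phi> vs (b # ws) x t) \<le> C2 / wt x / wt t"
    using amb_bound[OF \<phi> vs bws] by blast
  have m1 [measurable]: "amb \<phi> (b # vs) ws x \<in> borel_measurable borel" by (rule amb_measurable[OF \<phi> bvs ws])
  have m2 [measurable]: "amb \<phi> vs (b # ws) x \<in> borel_measurable borel" by (rule amb_measurable[OF \<phi> vs bws])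
  have "fourier (\<lambda>t. P' t b) \<xi> = complex_of_real (2 * pi * (\<xi> \<bullet> b)) * \<i> * fourier (amb \<phi> vs ws x) \<xi>"
  proof (rule fourier_directional_derivative[OF der b C0(2)])
    show "cmod (P' t b) \<le> (C1 / wt x + C2 / wt x) / wt t" for t
      unfolding P'b add_divide_distrib by (rule order_trans[OF norm_triangle_ineq add_mono[OF C1(2) C2(2)]])
    show "(\<lambda>t. P' t b) \<in> borel_measurable borel" unfolding P'b by measurable
  qed
  moreover have "fourier (\<lambda>t. P' t b) \<xi> = fourier (amb \<phi> (b # vs) ws x) \<xi> + fourier (amb \<phi> vs (b # ws) x) \<xi>"
    unfolding fourier_def P'b distrib_right
    using integrable_wt_bound[OF m1 C1(2)] integrable_wt_bound[OF m2 C2(2)]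
    by (intro Bochner_Integration.integral_add integrable_fourier_integrand)
  ultimately have "cmod (complex_of_real (2 * pi * (\<xi> \<bullet> b)) * \<i> * fourier (amb \<phi> vs ws x) \<xi>) \<le>
     cmod (fourier (amb \<phi> (b # vs) ws x) \<xi>) + cmod (fourier (amb \<phi> vs (b # ws) x) \<xi>)"
    by (metis norm_triangle_ineq)
  moreover have "\<bar>\<xi> \<bullet> b\<bar> * cmod (fourier (amb \<phi> vs ws x) \<xi>) \<le> \<bar>2 * pi * (\<xi> \<bullet> b)\<bar> * cmod (fourier (amb \<phi> vs ws x) \<xi>)"
  proof (intro mult_right_mono)
    have "1 * \<bar>\<xi> \<bullet> b\<bar> \<le> (2 * pi) * \<bar>\<xi> \<bullet> b\<bar>" using pi_gt3 by (intro mult_right_mono) auto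
    then show "\<bar>\<xi> \<bullet> b\<bar> \<le> \<bar>2 * pi * (\<xi> \<bullet> b)\<bar>" by (simp add: abs_mult)
  qed simp
  ultimately show ?thesis by (simp add: norm_mult abs_mult)
qed

text \<open>Coordinates are treated one at a time, with \<open>vs\<close> and \<open>ws\<close>
  arbitrary because each coordinate differentiates the windows twice more. Two applications of
  \<open>fourier_amb_derivative\<close> give four terms, of which the two mixed ones coincide, hence
  \<open>2 * C3\<close>. For \<open>S = Basis\<close> the product is the full weight in
  \<xi>.\<close>

lemma fourier_amb_decay:
  fixes \<phi> :: "'a::euclidean_space \<Rightarrow> complex"
  assumes \<phi>: "schwartz \<phi>" and S: "finite S" "S \<subseteq> Basis"
    and "set vs \<subseteq> Basis" "set ws \<subseteq> Basis"
  shows "\<exists>C. \<forall>x \<xi>. wt x * (\<Prod>b\<in>S. 1 + (\<xi> \<bullet> b)\<^sup>2) * cmod (fourier (amb \<phi> vs ws x) \<xi>) \<le> C"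
  using S assms(4,5)
proof (induction S arbitrary: vs ws rule: finite_induct)
  case empty
  obtain C where C: "C \<ge> 0" "\<And>x t. cmod (amb \<phi> vs ws x t) \<le> C / wt x / wt t"
    using amb_bound[OF \<phi> empty(2,3)] by blast
  have "wt x * cmod (fourier (amb \<phi> vs ws x) \<xi>) \<le> C * (\<integral>t. 1 / wt (t::'a) \<partial>lborel)" for x \<xi>
  proof -
    have "integrable lborel (amb \<phi> vs ws x)"
      by (rule integrable_wt_bound[OF amb_measurable[OF \<phi> empty(2,3)] C(2)])
    then have i: "integrable lborel (\<lambda>t. amb \<phi> vs ws x t * cis (- 2 * pi * (\<xi> \<bullet> t)))"
      by (rule integrable_fourier_integrand)
    have "cmod (fourier (amb \<phi> vs ws x) \<xi>) \<le> (\<integral>t. C / wt x * (1 / wt (t::'a)) \<partial>lborel)"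
      unfolding fourier_def
    proof (rule order_trans[OF Bochner_Integration.integral_norm_bound Bochner_Integration.integral_mono])
      show "integrable lborel (\<lambda>t. cmod (amb \<phi> vs ws x t * cis (- 2 * pi * (\<xi> \<bullet> t))))"
        using i by (rule integrable_norm)
      show "integrable lborel (\<lambda>t. C / wt x * (1 / wt (t::'a)))"
        using integrable_inverse_wt by (rule integrable_mult_right)
      show "cmod (amb \<phi> vs ws x t * cis (- 2 * pi * (\<xi> \<bullet> t))) \<le> C / wt x * (1 / wt t)" for t
        using C(2)[of x t] by (simp add: norm_mult)
    qed
    also have "\<dots> = C / wt x * (\<integral>t. 1 / wt (t::'a) \<partial>lborel)" by (rule integral_mult_right_zero)
    finally show ?thesis by (simp add: pos_le_divide_eq mult.commute)
  qed
  then show ?case by auto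
next
  case (insert b S)
  have b: "b \<in> Basis" using insert.prems by auto
  have IH: "\<exists>C. \<forall>x \<xi>. wt x * (\<Prod>b\<in>S. 1 + (\<xi> \<bullet> b)\<^sup>2) * cmod (fourier (amb \<phi> vs ws x) \<xi>) \<le> C"
    if "set vs \<subseteq> Basis" "set ws \<subseteq> Basis" for vs ws
    using insert.IH[OF _ that] insert.prems by auto
  have L: "set vs \<subseteq> Basis" "set ws \<subseteq> Basis" using insert.prems by auto
  obtain C1 where C1: "\<And>x \<xi>. wt x * (\<Prod>b\<in>S. 1 + (\<xi> \<bullet> b)\<^sup>2) * cmod (fourier (amb \<phi> vs ws x) \<xi>) \<le> C1"
    using IH[of vs ws] L by auto
  obtain C2 where C2: "\<And>x \<xi>. wt x * (\<Prod>b\<in>S. 1 + (\<xi> \<bullet> b)\<^sup>2) * cmod (fourier (amb \<phi> (b # b # vs) ws x) \<xi>) \<le> C2"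
    using IH[of "b # b # vs" ws] L b by auto
  obtain C3 where C3: "\<And>x \<xi>. wt x * (\<Prod>b\<in>S. 1 + (\<xi> \<bullet> b)\<^sup>2) * cmod (fourier (amb \<phi> (b # vs) (b # ws) x) \<xi>) \<le> C3"
    using IH[of "b # vs" "b # ws"] L b by auto
  obtain C4 where C4: "\<And>x \<xi>. wt x * (\<Prod>b\<in>S. 1 + (\<xi> \<bullet> b)\<^sup>2) * cmod (fourier (amb \<phi> vs (b # b # ws) x) \<xi>) \<le> C4"
    using IH[of vs "b # b # ws"] L b by auto
  have "wt x * (\<Prod>b\<in>insert b S. 1 + (\<xi> \<bullet> b)\<^sup>2) * cmod (fourier (amb \<phi> vs ws x) \<xi>) \<le> C1 + C2 + 2 * C3 + C4" for x \<xi>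
  proof -
    let ?f = "\<lambda>vs ws. cmod (fourier (amb \<phi> vs ws x) \<xi>)"
    define M where "M = wt x * (\<Prod>b\<in>S. 1 + (\<xi> \<bullet> b)\<^sup>2)"
    have M: "M \<ge> 0" unfolding M_def by (intro mult_nonneg_nonneg prod_nonneg) (auto intro: add_nonneg_nonneg)
    have "(\<xi> \<bullet> b)\<^sup>2 * ?f vs ws = \<bar>\<xi> \<bullet> b\<bar> * (\<bar>\<xi> \<bullet> b\<bar> * ?f vs ws)"
      by (simp add: power2_eq_square mult.assoc[symmetric])
    also have "\<dots> \<le> \<bar>\<xi> \<bullet> b\<bar> * (?f (b # vs) ws + ?f vs (b # ws))"
      by (intro mult_left_mono fourier_amb_derivative \<phi> L b) auto
    also have "\<dots> \<le> (?f (b # b # vs) ws + ?f (b # vs) (b # ws)) + (?f (b # vs) (b # ws) + ?f vs (b # b # ws))"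
      unfolding distrib_left
      by (intro add_mono fourier_amb_derivative \<phi>) (use L b in auto)
    finally have "(1 + (\<xi> \<bullet> b)\<^sup>2) * ?f vs ws \<le> ?f vs ws + ?f (b # b # vs) ws + 2 * ?f (b # vs) (b # ws) + ?f vs (b # b # ws)"
      by (simp add: distrib_right)
    from mult_left_mono[OF this M] have "M * ((1 + (\<xi> \<bullet> b)\<^sup>2) * ?f vs ws) \<le> M * ?f vs ws + M * ?f (b # b # vs) ws + 2 * (M * ?f (b # vs) (b # ws)) + M * ?f vs (b # b # ws)"
      by (simp only: distrib_left mult.left_commute[of M 2])
    also have "\<dots> \<le> C1 + C2 + 2 * C3 + C4"
      using C1[of x \<xi>] C2[of x \<xi>] C3[of x \<xi>] C4[of x \<xi>] unfolding M_def by linarith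
    finally show ?thesis
      unfolding M_def using insert.hyps by (simp add: mult_ac)
  qed
  then show ?case by blast
qed

subsection \<open>Short-time Fourier transform and localization operators\<close>

text \<open>The time-frequency shift of the window. Through it the transform becomes a family of
  inner products, and \<open>loc_op\<close> a superposition of these shifts, so that Hilbert space
  inequalities apply to both.\<close>

definition tfs :: "('a::euclidean_space \<Rightarrow> complex) \<Rightarrow> 'a \<times> 'a \<Rightarrow> 'a \<Rightarrow> complex" where
  "tfs \<phi> z t = \<phi> (t - fst z) * cis (2 * pi * (snd z \<bullet> t))"

lemma stft_eq_inner: "stft \<phi> f z = L2_inner f (tfs \<phi> z)"
  unfolding stft_def L2_inner_def tfs_def by (simp add: cis_cnj mult.assoc)

lemma L2_wt_bound:
  fixes F :: "'a::euclidean_space \<Rightarrow> complex"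
  assumes [measurable]: "F \<in> borel_measurable borel" and F: "\<And>t. cmod (F t) \<le> C / wt t"
  shows "L2 F"
proof (rule L2_dominated[where h="\<lambda>t. C\<^sup>2 * (1 / wt t)"])
  show "F \<in> borel_measurable lebesgue" by (simp add: borel_imp_lebesgue)
  have "integrable lborel (\<lambda>t::'a. C\<^sup>2 * (1 / wt t))"
    using integrable_inverse_wt by (rule integrable_mult_right)
  then show "integrable lebesgue (\<lambda>t::'a. C\<^sup>2 * (1 / wt t))"
    by (subst integrable_completion) auto
  fix t :: 'a
  have "(cmod (F t))\<^sup>2 \<le> (C / wt t)\<^sup>2" by (intro power_mono F) auto
  also have "\<dots> = C\<^sup>2 * (1 / wt t) * (1 / wt t)" by (simp add: power2_eq_square)
  also have "\<dots> \<le> C\<^sup>2 * (1 / wt t) * 1"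
    using wt_ge_1[of t] by (intro mult_left_mono) auto
  finally show "(cmod (F t))\<^sup>2 \<le> C\<^sup>2 * (1 / wt t)" by simp
qed

text \<open>Approximation from within is chosen so that boundedness of \<open>S\<close> is inherited
  by the Borel set; finite measure and uniform bounds on the set then carry over.\<close>

lemma lebesgue_set_borel_representative:
  fixes S :: "'a::euclidean_space set"
  assumes "S \<in> sets lebesgue"
  obtains C where "C \<in> sets borel" "C \<subseteq> S" "AE z in lebesgue. indicator S z = (indicator C z :: real)"
proof -
  obtain C T where CT: "fsigma C" "T \<in> null_sets lebesgue" "C \<union> T = S"
    using lebesgue_set_almost_fsigma[OF assms] by metis
  show thesis
  proof
    show "C \<in> sets borel" using CT(1) by (auto simp: fsigma.simps)
    show "C \<subseteq> S" using CT(3) by auto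
    have "AE z in lebesgue. z \<notin> T" using CT(2) by (rule AE_not_in)
    then show "AE z in lebesgue. indicator S z = (indicator C z :: real)"
      by (rule eventually_mono) (use CT(3) in \<open>auto simp: indicator_def\<close>)
  qed
qed

lemma set_integral_borel_representative:
  fixes g :: "'a::euclidean_space \<Rightarrow> complex"
  assumes [measurable]: "g \<in> borel_measurable borel" "C \<in> sets borel" "S \<in> sets lebesgue"
    and ae: "AE z in lebesgue. indicator S z = (indicator C z :: real)"
  shows "(LINT z:S|lebesgue. g z) = (\<integral>z. indicator C z *\<^sub>R g z \<partial>lborel)"
proof -
  have [measurable]: "g \<in> borel_measurable lebesgue" by (simp add: borel_imp_lebesgue)
  have [measurable]: "C \<in> sets lebesgue" using assms(2) by simp
  have "(LINT z:S|lebesgue. g z) = (\<integral>z. indicator C z *\<^sub>R g z \<partial>lebesgue)"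
    unfolding set_lebesgue_integral_def
    by (rule integral_cong_AE) (use ae in \<open>auto elim!: eventually_mono\<close>)
  also have "\<dots> = (\<integral>z. indicator C z *\<^sub>R g z \<partial>lborel)"
    by (rule integral_completion) simp
  finally show ?thesis .
qed

section \<open>The isometry into phase space\<close>

locale schwartz_window =
  fixes \<phi> :: "'a::euclidean_space \<Rightarrow> complex"
  assumes schwartz: "schwartz \<phi>" and norm_1: "L2_norm \<phi> = 1"
begin

lemma window_measurable [measurable]: "\<phi> \<in> borel_measurable borel"
  using pderivs_continuous[OF schwartz, of "[]"] by (auto intro: borel_measurable_continuous_onI)

lemma window_bound: obtains C where "C \<ge> 0" "\<And>t. cmod (\<phi> t) \<le> C / wt t"
  using pderivs_decay[OF schwartz, of "[]" 1] by auto

lemma L2_window: "L2 \<phi>"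
  using window_bound L2_wt_bound[OF window_measurable] by blast

lemma tfs_measurable [measurable]: "tfs \<phi> z \<in> borel_measurable borel"
  unfolding tfs_def by measurable

lemma L2_tfs: "L2 (tfs \<phi> z)" "L2_norm (tfs \<phi> z) = 1"
proof -
  have eq: "cmod (tfs \<phi> z t) = cmod (\<phi> (- fst z + t))" for t
    by (simp add: tfs_def norm_mult)
  show "L2 (tfs \<phi> z)"
    using L2_translate(1)[OF window_measurable L2_window, of "- fst z"] by (simp add: L2_borel_iff eq)
  show "L2_norm (tfs \<phi> z) = 1"
    using L2_translate(2)[OF window_measurable L2_window, of "- fst z"] norm_1 by (simp add: L2_norm_def eq)
qed

lemma stft_le_norm: "L2 f \<Longrightarrow> cmod (stft \<phi> f z) \<le> L2_norm f"
  using L2_Cauchy_Schwarz[OF _ L2_tfs(1)] by (simp add: stft_eq_inner L2_tfs(2))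

lemma stft_cong_AE:
  assumes "L2 f" "L2 f'" "AE x in lebesgue. f x = f' x"
  shows "stft \<phi> f = stft \<phi> f'"
  using L2_inner_cong_AE_left[OF L2_measurable[OF assms(1)] L2_measurable[OF assms(2)] assms(3)]
  by (auto simp: stft_eq_inner L2_measurable L2_tfs)

lemma stft_eq_fourier:
  assumes [measurable]: "f \<in> borel_measurable borel"
  shows "stft \<phi> f (x, \<xi>) = fourier (\<lambda>t. f t * cnj (\<phi> (t - x))) \<xi>"
  unfolding stft_def fourier_def by (simp add: integral_completion)

lemma stft_measurable [measurable]:
  assumes "L2 f" shows "stft \<phi> f \<in> borel_measurable borel"
proof -
  obtain f' where f': "f' \<in> borel_measurable borel" "L2 f'" "AE x in lebesgue. f x = f' x"
    using L2_borel_representative[OF assms] by blast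
  note [measurable] = f'(1)
  have "stft \<phi> f = (\<lambda>z. \<integral>t. f' t * cnj (\<phi> (t - fst z)) * cis (- 2 * pi * (snd z \<bullet> t)) \<partial>lborel)"
    unfolding stft_cong_AE[OF assms f'(2,3)] by (auto simp: stft_def fun_eq_iff integral_completion)
  moreover have "\<dots> \<in> borel_measurable borel" by measurable
  ultimately show ?thesis by simp
qed

text \<open>For fixed \<open>x\<close>, the slice in frequency is the Fourier transform of
  \<open>f'\<close> times a conjugated translate of the window. Plancherel applies: this product is
  integrable because both factors are square integrable, and square integrable because the window is
  bounded. After the shift by \<open>x\<close> the window no longer depends on \<open>x\<close>, and
  Tonelli's theorem separates the two norms.\<close>

lemma nn_integral_stft:
  assumes "L2 f"
  shows "(\<integral>\<^sup>+z. ennreal ((cmod (stft \<phi> f z))\<^sup>2) \<partial>lborel) = ennreal ((L2_norm f)\<^sup>2)"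
proof -
  obtain f' where f' [measurable]: "f' \<in> borel_measurable borel" and f2: "L2 f'"
    and f3: "AE x in lebesgue. f x = f' x" "L2_norm f = L2_norm f'"
    using L2_borel_representative[OF assms] by blast
  have [measurable]: "stft \<phi> f' \<in> borel_measurable borel" by (rule stft_measurable[OF f2])
  obtain C where C: "C \<ge> 0" "\<And>t. cmod (\<phi> t) \<le> C / wt t" using window_bound by blast
  have Cb: "cmod (\<phi> t) \<le> C" for t
    using C(2)[of t] wt_ge_1[of t] C(1) divide_left_mono[of 1 "wt t" C] by auto
  have nf: "(\<integral>\<^sup>+x. ennreal ((cmod (f' (x + t)))\<^sup>2) \<partial>lborel) = ennreal ((L2_norm f)\<^sup>2)" for t
  proof -
    have "(\<integral>\<^sup>+x. ennreal ((cmod (f' (x + t)))\<^sup>2) \<partial>lborel) = (\<integral>\<^sup>+x. ennreal ((cmod (f' x))\<^sup>2) \<partial>lborel)"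
      using nn_integral_lborel_translate[of "\<lambda>x. ennreal ((cmod (f' x))\<^sup>2)" t] by (simp add: add.commute)
    also have "\<dots> = ennreal ((L2_norm f)\<^sup>2)"
      using f2 unfolding f3 by (subst nn_integral_eq_integral) (auto simp: L2_borel_iff L2_norm_borel)
    finally show ?thesis .
  qed
  have np: "(\<integral>\<^sup>+t. ennreal ((cmod (\<phi> t))\<^sup>2) \<partial>lborel) = 1"
    using L2_window norm_1 L2_norm_borel[of \<phi>] by (subst nn_integral_eq_integral) (auto simp: L2_borel_iff)
  have slice: "(\<integral>\<^sup>+\<xi>. ennreal ((cmod (stft \<phi> f' (x, \<xi>)))\<^sup>2) \<partial>lborel)
      = (\<integral>\<^sup>+t. ennreal ((cmod (f' (x + t)))\<^sup>2) * ennreal ((cmod (\<phi> t))\<^sup>2) \<partial>lborel)" for x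
  proof -
    define F where "F t = f' t * cnj (\<phi> (t - x))" for t
    have [measurable]: "F \<in> borel_measurable borel" unfolding F_def by measurable
    have tr: "L2 (\<lambda>t. \<phi> (t - x))"
      using L2_translate(1)[OF window_measurable L2_window, of "- x"] by simp
    have F1: "integrable lborel F"
      using integrable_L2_mult[OF f2 tr] unfolding F_def by (subst (asm) integrable_completion) auto
    have F2: "L2 F"
    proof (rule L2_dominated[where h="\<lambda>t. C\<^sup>2 * (cmod (f' t))\<^sup>2"])
      show "integrable lebesgue (\<lambda>t. C\<^sup>2 * (cmod (f' t))\<^sup>2)" using f2 by (auto simp: L2_def)
      show "(cmod (F t))\<^sup>2 \<le> C\<^sup>2 * (cmod (f' t))\<^sup>2" for t
        using power_mono[OF Cb[of "t - x"], of 2] by (simp add: F_def norm_mult power_mult_distrib mult_right_mono mult.commute[of "C\<^sup>2"] mult_left_mono)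
    qed (simp add: borel_imp_lebesgue)
    have "(\<integral>\<^sup>+\<xi>. ennreal ((cmod (stft \<phi> f' (x, \<xi>)))\<^sup>2) \<partial>lborel) = ennreal ((L2_norm F)\<^sup>2)"
      using Plancherel[OF F1 F2] by (simp add: stft_eq_fourier F_def[abs_def])
    also have "\<dots> = (\<integral>\<^sup>+t. ennreal ((cmod (F t))\<^sup>2) \<partial>lborel)"
      using F2 by (subst nn_integral_eq_integral) (auto simp: L2_borel_iff L2_norm_borel)
    also have "\<dots> = (\<integral>\<^sup>+t. ennreal ((cmod (F (x + t)))\<^sup>2) \<partial>lborel)"
      by (rule nn_integral_lborel_translate[symmetric]) simp
    also have "\<dots> = (\<integral>\<^sup>+t. ennreal ((cmod (f' (x + t)))\<^sup>2) * ennreal ((cmod (\<phi> t))\<^sup>2) \<partial>lborel)"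
      by (intro nn_integral_cong) (simp add: F_def norm_mult power_mult_distrib ennreal_mult)
    finally show ?thesis .
  qed
  have "(\<integral>\<^sup>+z. ennreal ((cmod (stft \<phi> f z))\<^sup>2) \<partial>lborel) = (\<integral>\<^sup>+z. ennreal ((cmod (stft \<phi> f' z))\<^sup>2) \<partial>(lborel \<Otimes>\<^sub>M lborel))"
    by (simp add: stft_cong_AE[OF assms f2 f3(1)] lborel_prod)
  also have "\<dots> = (\<integral>\<^sup>+x. (\<integral>\<^sup>+\<xi>. ennreal ((cmod (stft \<phi> f' (x, \<xi>)))\<^sup>2) \<partial>lborel) \<partial>lborel)"
    by (subst lborel.nn_integral_fst) (auto simp: lborel_prod)
  also have "\<dots> = (\<integral>\<^sup>+x. (\<integral>\<^sup>+t. ennreal ((cmod (f' (x + t)))\<^sup>2) * ennreal ((cmod (\<phi> t))\<^sup>2) \<partial>lborel) \<partial>lborel)"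
    by (simp only: slice)
  also have "\<dots> = (\<integral>\<^sup>+t. (\<integral>\<^sup>+x. ennreal ((cmod (f' (x + t)))\<^sup>2) * ennreal ((cmod (\<phi> t))\<^sup>2) \<partial>lborel) \<partial>lborel)"
    by (rule lborel_pair.Fubini') measurable
  also have "\<dots> = (\<integral>\<^sup>+t. ennreal ((L2_norm f)\<^sup>2) * ennreal ((cmod (\<phi> t))\<^sup>2) \<partial>lborel)"
    by (subst nn_integral_multc) (auto simp: nf)
  also have "\<dots> = ennreal ((L2_norm f)\<^sup>2)"
    by (simp add: nn_integral_cmult np)
  finally show ?thesis .
qed

lemma stft_isometry:
  assumes "L2 f"
  shows L2_stft: "L2 (stft \<phi> f)" and L2_norm_stft: "L2_norm (stft \<phi> f) = L2_norm f"
proof -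
  note [measurable] = stft_measurable[OF assms]
  have i: "integrable lborel (\<lambda>z. (cmod (stft \<phi> f z))\<^sup>2)"
    using nn_integral_stft[OF assms] by (intro integrableI_bounded) auto
  then show "L2 (stft \<phi> f)" by (simp add: L2_borel_iff)
  have "ennreal ((L2_norm (stft \<phi> f))\<^sup>2) = ennreal ((L2_norm f)\<^sup>2)"
    using nn_integral_eq_integral[OF i] nn_integral_stft[OF assms] by (simp add: L2_norm_borel)
  then show "L2_norm (stft \<phi> f) = L2_norm f" by simp
qed

lemma stft_add: "L2 f \<Longrightarrow> L2 g \<Longrightarrow> stft \<phi> (\<lambda>x. f x + g x) = (\<lambda>z. stft \<phi> f z + stft \<phi> g z)"
  by (auto simp: stft_eq_inner L2_inner_add_left L2_tfs)

lemma stft_cmult: "stft \<phi> (\<lambda>x. c * f x) = (\<lambda>z. c * stft \<phi> f z)"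
  by (auto simp: stft_eq_inner L2_inner_cmult_left)

text \<open>Polarization: equality of norms determines the real part of the inner product, and
  replacing \<open>f\<close> by i times \<open>f\<close> recovers the imaginary part.\<close>

lemma L2_inner_stft:
  assumes "L2 f" "L2 g"
  shows "L2_inner (stft \<phi> f) (stft \<phi> g) = L2_inner f g"
proof -
  have Re: "Re (L2_inner (stft \<phi> f) (stft \<phi> g)) = Re (L2_inner f g)" if "L2 f" for f
    using L2_norm_add_sq[OF that assms(2)] L2_norm_add_sq[OF L2_stft[OF that] L2_stft[OF assms(2)]]
      L2_norm_stft[OF L2_add[OF that assms(2)]]
    by (simp add: stft_add that assms(2) L2_norm_stft)
  show ?thesis
    using Re[OF assms(1)] Re[OF L2_cmult[OF assms(1), of \<i>]]
    by (simp add: complex_eq_iff stft_cmult L2_inner_cmult_left)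
qed

text \<open>By covariance, the transform of a shifted window is, up to a phase, the ambiguity
  function at the difference of the two phase-space points. The maximum with 1 only serves to make
  the constant positive.\<close>

lemma stft_tfs_decay:
  obtains C where "C > 0" "\<And>z w. cmod (stft \<phi> (tfs \<phi> z) w) \<le> C * (1 / wt (fst w - fst z) * (1 / wt (snd w - snd z)))"
proof -
  obtain C where C: "\<And>x \<xi>. wt x * (\<Prod>b\<in>Basis. 1 + (\<xi> \<bullet> b)\<^sup>2) * cmod (fourier (amb \<phi> [] [] x) \<xi>) \<le> C"
    using fourier_amb_decay[OF schwartz, of Basis "[]" "[]"] by auto
  show thesis
  proof (rule that)
    show "max C 1 > 0" by simp
    fix z w :: "'a \<times> 'a"
    define x where "x = fst w - fst z"
    define \<xi> where "\<xi> = snd w - snd z"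
    have "stft \<phi> (tfs \<phi> z) w = (\<integral>t. tfs \<phi> z t * cnj (\<phi> (t - fst w)) * cis (- 2 * pi * (snd w \<bullet> t)) \<partial>lborel)"
      unfolding stft_def by (simp add: integral_completion)
    also have "\<dots> = (\<integral>t. tfs \<phi> z (fst z + t) * cnj (\<phi> (fst z + t - fst w)) * cis (- 2 * pi * (snd w \<bullet> (fst z + t))) \<partial>lborel)"
      by (rule integral_lborel_translate[symmetric]) measurable
    also have "\<dots> = (\<integral>t. cis (- 2 * pi * (\<xi> \<bullet> fst z)) * (amb \<phi> [] [] x t * cis (- 2 * pi * (\<xi> \<bullet> t))) \<partial>lborel)"
    proof (intro Bochner_Integration.integral_cong refl)
      fix t
      have "cis (2 * pi * (snd z \<bullet> (fst z + t))) * cis (- 2 * pi * (snd w \<bullet> (fst z + t)))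
          = cis (- 2 * pi * (\<xi> \<bullet> fst z)) * cis (- 2 * pi * (\<xi> \<bullet> t))"
        by (simp add: cis_mult \<xi>_def inner_diff_left inner_add_right algebra_simps)
      moreover have "fst z + t - fst w = t - x" by (simp add: x_def)
      moreover have "(a * c1) * b * c2 = a * b * (c1 * c2)" for a b c1 c2 :: complex
        by (simp only: mult_ac)
      ultimately show "tfs \<phi> z (fst z + t) * cnj (\<phi> (fst z + t - fst w)) * cis (- 2 * pi * (snd w \<bullet> (fst z + t)))
          = cis (- 2 * pi * (\<xi> \<bullet> fst z)) * (amb \<phi> [] [] x t * cis (- 2 * pi * (\<xi> \<bullet> t)))"
        by (simp only: tfs_def amb_def pderivs.simps add_diff_cancel_left' mult_ac)
    qed
    also have "\<dots> = cis (- 2 * pi * (\<xi> \<bullet> fst z)) * fourier (amb \<phi> [] [] x) \<xi>"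
      unfolding fourier_def by (rule integral_mult_right_zero)
    finally have "cmod (stft \<phi> (tfs \<phi> z) w) = cmod (fourier (amb \<phi> [] [] x) \<xi>)"
      by (simp add: norm_mult)
    also have "wt x * wt \<xi> * \<dots> \<le> max C 1"
      using C[of x \<xi>] by (simp add: wt_def[of \<xi>])
    finally show "cmod (stft \<phi> (tfs \<phi> z) w) \<le> max C 1 * (1 / wt (fst w - fst z) * (1 / wt (snd w - snd z)))"
      unfolding x_def[symmetric] \<xi>_def[symmetric] by (simp add: pos_le_divide_eq mult_ac)
  qed
qed

section \<open>Localization operators: integrability and weak form\<close>

lemma loc_op_eq:
  assumes "L2 f" "S \<in> sets lebesgue" "C \<in> sets borel" "AE z in lebesgue. indicator S z = (indicator C z :: real)"
  shows "loc_op \<phi> S f t = (\<integral>z. indicator C z *\<^sub>R (stft \<phi> f z * tfs \<phi> z t) \<partial>lborel)"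
proof -
  note [measurable] = stft_measurable[OF assms(1)]
  have "(\<lambda>z. stft \<phi> f z * tfs \<phi> z t) \<in> borel_measurable borel" unfolding tfs_def by measurable
  from set_integral_borel_representative[OF this assms(3,2,4)]
  show ?thesis by (simp add: loc_op_def tfs_def mult.assoc)
qed

text \<open>On a bounded set of shifts, moderateness of \<open>wt\<close> bounds all shifted windows
  by one multiple of the reciprocal weight. Integrating over a set of finite measure preserves this
  pointwise decay, which implies square integrability.\<close>

lemma loc_op_L2:
  assumes f: "L2 f" and S: "S \<in> sets lebesgue" "bounded S"
  shows loc_op_measurable: "loc_op \<phi> S f \<in> borel_measurable borel" and L2_loc_op: "L2 (loc_op \<phi> S f)"
proof -
  obtain C where C [measurable]: "C \<in> sets borel" and "C \<subseteq> S" and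
    ae: "AE z in lebesgue. indicator S z = (indicator C z :: real)"
    using lebesgue_set_borel_representative[OF S(1)] by blast
  have bC: "bounded C" using S(2) \<open>C \<subseteq> S\<close> bounded_subset by blast
  have iC: "integrable lborel (indicator C :: _ \<Rightarrow> real)"
    using emeasure_bounded_finite[OF bC] by (intro integrable_real_indicator) auto
  note [measurable] = stft_measurable[OF f]
  have eq: "loc_op \<phi> S f = (\<lambda>t. \<integral>z. indicator C z *\<^sub>R (stft \<phi> f z * tfs \<phi> z t) \<partial>lborel)"
    using loc_op_eq[OF f S(1) C ae] by auto
  show m: "loc_op \<phi> S f \<in> borel_measurable borel" unfolding eq tfs_def by measurable
  obtain K where K: "K \<ge> 0" "\<And>t. cmod (\<phi> t) \<le> K / wt t" using window_bound by blast
  obtain \<rho> where \<rho>: "\<And>z. z \<in> C \<Longrightarrow> norm z \<le> \<rho>" using bC unfolding bounded_iff by auto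
  define D where "D = L2_norm f * (K * 2 ^ DIM('a) * (1 + \<rho>\<^sup>2) ^ DIM('a))"
  have D: "D \<ge> 0" unfolding D_def using K by (intro mult_nonneg_nonneg) auto
  show "L2 (loc_op \<phi> S f)"
  proof (rule L2_wt_bound[OF m])
    fix t
    have le: "cmod (indicator C z *\<^sub>R (stft \<phi> f z * tfs \<phi> z t)) \<le> D / wt t * indicator C z" for z
    proof (cases "z \<in> C")
      case True
      have "norm (fst z) \<le> \<rho>" using \<rho>[OF True] norm_fst_le[of "fst z" "snd z"] by simp
      then have "(1 + (norm (fst z))\<^sup>2) ^ DIM('a) \<le> (1 + \<rho>\<^sup>2) ^ DIM('a)" by (intro power_mono add_left_mono) auto
      then have w: "wt (fst z) \<le> (1 + \<rho>\<^sup>2) ^ DIM('a)" using wt_le order_trans by blast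
      have "wt t = wt ((t - fst z) + fst z)" by simp
      also have "\<dots> \<le> 2 ^ DIM('a) * wt (t - fst z) * wt (fst z)" by (rule wt_add_le)
      also have "\<dots> \<le> 2 ^ DIM('a) * wt (t - fst z) * (1 + \<rho>\<^sup>2) ^ DIM('a)"
        by (intro mult_left_mono w) auto
      finally have "wt t * K \<le> (2 ^ DIM('a) * wt (t - fst z) * (1 + \<rho>\<^sup>2) ^ DIM('a)) * K"
        using K(1) by (rule mult_right_mono)
      then have "K / wt (t - fst z) \<le> K * 2 ^ DIM('a) * (1 + \<rho>\<^sup>2) ^ DIM('a) / wt t"
        by (simp add: divide_le_eq pos_le_divide_eq mult_ac)
      then have "cmod (tfs \<phi> z t) \<le> K * 2 ^ DIM('a) * (1 + \<rho>\<^sup>2) ^ DIM('a) / wt t"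
        using K(2)[of "t - fst z"] by (simp add: tfs_def norm_mult)
      then have "cmod (stft \<phi> f z) * cmod (tfs \<phi> z t) \<le> L2_norm f * (K * 2 ^ DIM('a) * (1 + \<rho>\<^sup>2) ^ DIM('a) / wt t)"
        by (intro mult_mono stft_le_norm f) auto
      then show ?thesis using True by (simp add: norm_mult D_def)
    qed (use D in auto)
    have i: "integrable lborel (\<lambda>z. D / wt t * indicator C z)" using iC by (rule integrable_mult_right)
    have i2: "integrable lborel (\<lambda>z. indicator C z *\<^sub>R (stft \<phi> f z * tfs \<phi> z t))"
    proof (rule Bochner_Integration.integrable_bound[OF i])
      show "AE z in lborel. norm (indicator C z *\<^sub>R (stft \<phi> f z * tfs \<phi> z t)) \<le> norm (D / wt t * indicator C z)"
        using le by (intro AE_I2) (metis abs_ge_self order_trans real_norm_def)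
    qed (unfold tfs_def, measurable)
    have "cmod (loc_op \<phi> S f t) \<le> (\<integral>z. cmod (indicator C z *\<^sub>R (stft \<phi> f z * tfs \<phi> z t)) \<partial>lborel)"
      unfolding eq by (rule Bochner_Integration.integral_norm_bound)
    also have "\<dots> \<le> (\<integral>z. D / wt t * indicator C z \<partial>lborel)"
      using le by (intro Bochner_Integration.integral_mono integrable_norm i i2)
    also have "\<dots> = (D * measure lborel C) / wt t" by simp
    finally show "cmod (loc_op \<phi> S f t) \<le> (D * measure lborel C) / wt t" .
  qed
qed

text \<open>The weak form of the operator, through which the later estimates handle it. Exchanging
  the integrals is justified by Cauchy-Schwarz for each single shift, uniformly, and by the finite
  measure of the bounded set.\<close>

lemma loc_op_inner:
  assumes f: "L2 f" and g: "L2 g" and S: "S \<in> sets lebesgue" "bounded S"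
  shows "L2_inner (loc_op \<phi> S f) g = (LINT z:S|lebesgue. stft \<phi> f z * cnj (stft \<phi> g z))"
proof -
  obtain C where C [measurable]: "C \<in> sets borel" and "C \<subseteq> S" and
    ae: "AE z in lebesgue. indicator S z = (indicator C z :: real)"
    using lebesgue_set_borel_representative[OF S(1)] by blast
  have bC: "bounded C" using S(2) \<open>C \<subseteq> S\<close> bounded_subset by blast
  have iC: "integrable lborel (indicator C :: _ \<Rightarrow> real)"
    using emeasure_bounded_finite[OF bC] by (intro integrable_real_indicator) auto
  obtain g' where g' [measurable]: "g' \<in> borel_measurable borel" and g2: "L2 g'"
    and g3: "AE x in lebesgue. g x = g' x"
    using L2_borel_representative[OF g] by blast
  note [measurable] = stft_measurable[OF f] stft_measurable[OF g]
  have ig: "integrable lborel (\<lambda>t. tfs \<phi> z t * cnj (g' t))" for z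
    using integrable_L2_mult[OF L2_tfs(1) g2] by (subst (asm) integrable_completion) auto
  define Q where "Q z t = (indicator C z *\<^sub>R stft \<phi> f z) * (tfs \<phi> z t * cnj (g' t))" for z t
  have [measurable]: "case_prod Q \<in> borel_measurable (lborel \<Otimes>\<^sub>M lborel)"
    unfolding Q_def tfs_def by measurable
  have iQ: "integrable (lborel \<Otimes>\<^sub>M lborel) (case_prod Q)"
  proof (rule lborel_pair.Fubini_integrable)
    show "AE z in lborel. integrable lborel (\<lambda>t. case_prod Q (z, t))"
      using ig by (intro AE_I2) (simp add: Q_def)
    show "integrable lborel (\<lambda>z. \<integral>t. norm (case_prod Q (z, t)) \<partial>lborel)"
    proof (rule Bochner_Integration.integrable_bound)
      show "integrable lborel (\<lambda>z. L2_norm f * L2_norm g' * indicator C z)" using iC by (rule integrable_mult_right)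
      have "(\<integral>t. norm (case_prod Q (z, t)) \<partial>lborel) \<le> L2_norm f * L2_norm g' * indicator C z" for z
      proof -
        have "(\<integral>t. norm (case_prod Q (z, t)) \<partial>lborel) = indicator C z * cmod (stft \<phi> f z) * (\<integral>t. cmod (tfs \<phi> z t) * cmod (g' t) \<partial>lborel)"
          by (simp add: Q_def norm_mult)
        also have "(\<integral>t. cmod (tfs \<phi> z t) * cmod (g' t) \<partial>lborel) = (\<integral>t. cmod (tfs \<phi> z t) * cmod (g' t) \<partial>lebesgue)"
          by (rule integral_completion[symmetric]) measurable
        also have "indicator C z * cmod (stft \<phi> f z) * \<dots> \<le> indicator C z * L2_norm f * (1 * L2_norm g')"
          using L2_abs_Cauchy_Schwarz[OF L2_tfs(1) g2, of z]
          by (intro mult_mono mult_left_mono stft_le_norm f) (auto simp: L2_tfs(2))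
        finally show ?thesis by (simp add: mult_ac)
      qed
      then show "AE z in lborel. norm (\<integral>t. norm (case_prod Q (z, t)) \<partial>lborel) \<le> norm (L2_norm f * L2_norm g' * indicator C z)"
        by (intro AE_I2) (simp add: abs_of_nonneg)
    qed measurable
  qed measurable
  have "L2_inner (loc_op \<phi> S f) g = L2_inner (loc_op \<phi> S f) g'"
    using L2_inner_cong_AE_left[OF L2_measurable[OF g] L2_measurable[OF g2] g3 L2_measurable[OF L2_loc_op[OF f S]]]
    by (simp only: L2_inner_commute[of "loc_op \<phi> S f"])
  also have "\<dots> = (\<integral>t. loc_op \<phi> S f t * cnj (g' t) \<partial>lborel)"
    by (rule L2_inner_borel[OF loc_op_measurable[OF f S] g'])
  also have "\<dots> = (\<integral>t. (\<integral>z. Q z t \<partial>lborel) \<partial>lborel)"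
    by (simp add: loc_op_eq[OF f S(1) C ae] Q_def integral_mult_left_zero[symmetric] mult.assoc del: integral_mult_left_zero)
  also have "\<dots> = (\<integral>z. (\<integral>t. Q z t \<partial>lborel) \<partial>lborel)"
    by (rule lborel_pair.Fubini_integral[OF iQ])
  also have "\<dots> = (\<integral>z. indicator C z *\<^sub>R (stft \<phi> f z * cnj (stft \<phi> g z)) \<partial>lborel)"
  proof (intro Bochner_Integration.integral_cong refl)
    fix z
    have "(\<integral>t. Q z t \<partial>lborel) = (indicator C z *\<^sub>R stft \<phi> f z) * L2_inner (tfs \<phi> z) g'"
      unfolding Q_def by (simp add: L2_inner_borel)
    also have "L2_inner (tfs \<phi> z) g' = cnj (stft \<phi> g z)"
      by (simp only: stft_cong_AE[OF g g2 g3] stft_eq_inner L2_inner_commute[of g' "tfs \<phi> z"] complex_cnj_cnj)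
    finally show "(\<integral>t. Q z t \<partial>lborel) = indicator C z *\<^sub>R (stft \<phi> f z * cnj (stft \<phi> g z))" by simp
  qed
  also have "\<dots> = (LINT z:S|lebesgue. stft \<phi> f z * cnj (stft \<phi> g z))"
    by (rule set_integral_borel_representative[symmetric, OF _ C S(1) ae]) measurable
  finally show ?thesis .
qed

end

subsection \<open>Local energies and the spectral decomposition\<close>

text \<open>Bounded overlap, stated for a general density because it is applied both to the squared
  modulus of the transform and to the integrand of the Schur estimate.\<close>

lemma sum_set_integral_le:
  fixes g :: "'b \<Rightarrow> real"
  assumes "finite F" and S: "\<And>i. i \<in> F \<Longrightarrow> S i \<in> sets M"
    and g: "integrable M g" "\<And>z. 0 \<le> g z"
    and card: "\<And>z. card {i \<in> F. z \<in> S i} \<le> m"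
  shows "(\<Sum>i\<in>F. LINT z:S i|M. g z) \<le> real m * (\<integral>z. g z \<partial>M)"
proof -
  have i: "integrable M (\<lambda>z. indicator (S i) z *\<^sub>R g z)" if "i \<in> F" for i
    using S[OF that] g(1) by (rule integrable_mult_indicator)
  have "(\<Sum>i\<in>F. LINT z:S i|M. g z) = (\<integral>z. (\<Sum>i\<in>F. indicator (S i) z *\<^sub>R g z) \<partial>M)"
    unfolding set_lebesgue_integral_def using i by (simp add: Bochner_Integration.integral_sum)
  also have "\<dots> \<le> (\<integral>z. real m * g z \<partial>M)"
  proof (rule Bochner_Integration.integral_mono)
    show "integrable M (\<lambda>z. \<Sum>i\<in>F. indicator (S i) z *\<^sub>R g z)" using i by simp
    show "integrable M (\<lambda>z. real m * g z)" using g by simp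
    fix z
    have "(\<Sum>i\<in>F. indicator (S i) z *\<^sub>R g z) = (\<Sum>i\<in>F. indicator (S i) z) * g z"
      by (simp add: sum_distrib_right)
    also have "(\<Sum>i\<in>F. indicator (S i) z) = real (card {i \<in> F. z \<in> S i})"
      using assms(1) by (simp add: indicator_def sum.If_cases Int_def)
    also have "\<dots> * g z \<le> real m * g z"
      using card g(2) by (intro mult_right_mono) auto
    finally show "(\<Sum>i\<in>F. indicator (S i) z *\<^sub>R g z) \<le> real m * g z" .
  qed
  finally show ?thesis by simp
qed

text \<open>Total boundedness covers the ball around 0 by finitely many unit balls; translating the
  cover makes their number independent of the centre. The added 1 keeps the bound positive, as it
  will be a denominator.\<close>

lemma uniformly_discrete_card_ball:
  fixes \<Gamma> :: "'b::euclidean_space set"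
  assumes "\<And>z. finite (\<Gamma> \<inter> ball z 1) \<and> card (\<Gamma> \<inter> ball z 1) \<le> m"
  obtains M where "M \<ge> 1" "\<And>z. finite (\<Gamma> \<inter> ball z \<rho>)" "\<And>z. card (\<Gamma> \<inter> ball z \<rho>) \<le> M"
proof -
  have "\<exists>k. finite k \<and> cball 0 \<rho> \<subseteq> (\<Union>x\<in>k. ball (x::'b) 1)"
    using compact_eq_totally_bounded[of "cball (0::'b) \<rho>"] by auto
  then obtain k where k: "finite k" "cball 0 \<rho> \<subseteq> (\<Union>x\<in>k. ball (x::'b) 1)" by blast
  have sub: "\<Gamma> \<inter> ball z \<rho> \<subseteq> (\<Union>c\<in>k. \<Gamma> \<inter> ball (z + c) 1)" for z
  proof
    fix y assume y: "y \<in> \<Gamma> \<inter> ball z \<rho>"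
    then have "y - z \<in> cball 0 \<rho>" by (auto simp: dist_norm norm_minus_commute)
    then obtain c where "c \<in> k" "y - z \<in> ball c 1" using k(2) by auto
    then show "y \<in> (\<Union>c\<in>k. \<Gamma> \<inter> ball (z + c) 1)"
      using y by (auto intro!: bexI[of _ c] simp: dist_norm algebra_simps)
  qed
  have fin: "finite (\<Union>c\<in>k. \<Gamma> \<inter> ball (z + c) 1)" for z
    using k(1) assms by (intro finite_UN_I) auto
  show thesis
  proof (rule that)
    show "card k * m + 1 \<ge> 1" by simp
    show "finite (\<Gamma> \<inter> ball z \<rho>)" for z
      using sub fin finite_subset by blast
    show "card (\<Gamma> \<inter> ball z \<rho>) \<le> card k * m + 1" for z
    proof -
      have "card (\<Gamma> \<inter> ball z \<rho>) \<le> card (\<Union>c\<in>k. \<Gamma> \<inter> ball (z + c) 1)"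
        by (rule card_mono[OF fin sub])
      also have "\<dots> \<le> (\<Sum>c\<in>k. card (\<Gamma> \<inter> ball (z + c) 1))" by (rule card_UN_le[OF k(1)])
      also have "\<dots> \<le> card k * m" using sum_bounded_above[of k "\<lambda>c. card (\<Gamma> \<inter> ball (z + c) 1)" m] assms by simp
      finally show ?thesis by simp
    qed
  qed
qed

context schwartz_window
begin

definition energy :: "('a \<Rightarrow> complex) \<Rightarrow> ('a \<times> 'a) set \<Rightarrow> real" where
  "energy f S = (LINT z:S|lebesgue. (cmod (stft \<phi> f z))\<^sup>2)"

lemma integrable_stft_sq: "L2 f \<Longrightarrow> integrable lebesgue (\<lambda>z. (cmod (stft \<phi> f z))\<^sup>2)"
  using L2_stft by (simp add: L2_def)

lemma integral_stft_sq: "L2 f \<Longrightarrow> (\<integral>z. (cmod (stft \<phi> f z))\<^sup>2 \<partial>lebesgue) = (L2_norm f)\<^sup>2"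
  using L2_norm_stft by (simp add: L2_norm_sq[symmetric])

lemma energy_nonneg: "0 \<le> energy f S"
  unfolding energy_def set_lebesgue_integral_def by simp

lemma sum_energy_le:
  assumes "L2 f" "finite F" "\<And>i. i \<in> F \<Longrightarrow> S i \<in> sets lebesgue" "\<And>z. card {i \<in> F. z \<in> S i} \<le> m"
  shows "(\<Sum>i\<in>F. energy f (S i)) \<le> real m * (L2_norm f)\<^sup>2"
  unfolding energy_def integral_stft_sq[OF assms(1), symmetric]
  using assms by (intro sum_set_integral_le integrable_stft_sq) auto

lemma energy_le_sum:
  assumes f: "L2 f" and F: "finite F" "\<And>i. i \<in> F \<Longrightarrow> S i \<in> sets lebesgue"
    and B: "B \<in> sets lebesgue" "B \<subseteq> (\<Union>i\<in>F. S i)"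
  shows "energy f B \<le> (\<Sum>i\<in>F. energy f (S i))"
proof -
  have i: "integrable lebesgue (\<lambda>z. indicator A z *\<^sub>R (cmod (stft \<phi> f z))\<^sup>2)" if "A \<in> sets lebesgue" for A
    using that integrable_stft_sq[OF f] by (rule integrable_mult_indicator)
  have "energy f B \<le> (\<integral>z. (\<Sum>i\<in>F. indicator (S i) z *\<^sub>R (cmod (stft \<phi> f z))\<^sup>2) \<partial>lebesgue)"
    unfolding energy_def set_lebesgue_integral_def
  proof (rule Bochner_Integration.integral_mono[OF i[OF B(1)]])
    show "integrable lebesgue (\<lambda>z. \<Sum>i\<in>F. indicator (S i) z *\<^sub>R (cmod (stft \<phi> f z))\<^sup>2)"
      using i F(2) by simp
    fix z
    show "indicator B z *\<^sub>R (cmod (stft \<phi> f z))\<^sup>2 \<le> (\<Sum>i\<in>F. indicator (S i) z *\<^sub>R (cmod (stft \<phi> f z))\<^sup>2)"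
    proof (cases "z \<in> B")
      case True
      then obtain j where j: "j \<in> F" "z \<in> S j" using B(2) by auto
      have "indicator (S j) z *\<^sub>R (cmod (stft \<phi> f z))\<^sup>2 \<le> (\<Sum>i\<in>F. indicator (S i) z *\<^sub>R (cmod (stft \<phi> f z))\<^sup>2)"
        using F(1) j(1) by (intro member_le_sum) auto
      then show ?thesis using True j by simp
    qed (auto intro: sum_nonneg)
  qed
  also have "\<dots> = (\<Sum>i\<in>F. energy f (S i))"
    unfolding energy_def set_lebesgue_integral_def using i F(2) by (simp add: Bochner_Integration.integral_sum)
  finally show ?thesis .
qed

text \<open>Exhaustion by balls turns the lower estimate into one about finite families of cells,
  since only finitely many cells meet a given ball.\<close>

lemma energy_balls_tendsto:
  assumes f: "L2 f"
  shows "(\<lambda>n. energy f (ball 0 (real n))) \<longlonglongrightarrow> (L2_norm f)\<^sup>2"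
  unfolding energy_def set_lebesgue_integral_def integral_stft_sq[OF f, symmetric]
proof (rule integral_dominated_convergence[OF _ _ integrable_stft_sq[OF f]])
  have [measurable]: "stft \<phi> f \<in> borel_measurable lebesgue"
    using L2_measurable[OF L2_stft[OF f]] .
  show "(\<lambda>z. (cmod (stft \<phi> f z))\<^sup>2) \<in> borel_measurable lebesgue" by measurable
  show "(\<lambda>z. indicator (ball 0 (real n)) z *\<^sub>R (cmod (stft \<phi> f z))\<^sup>2) \<in> borel_measurable lebesgue" for n
    using integrable_mult_indicator[OF _ integrable_stft_sq[OF f], of "ball 0 (real n)"] by auto
  show "AE z in lebesgue. norm (indicator (ball 0 (real n)) z *\<^sub>R (cmod (stft \<phi> f z))\<^sup>2) \<le> (cmod (stft \<phi> f z))\<^sup>2" for n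
    by (auto split: split_indicator)
  show "AE z in lebesgue. (\<lambda>n. indicator (ball 0 (real n)) z *\<^sub>R (cmod (stft \<phi> f z))\<^sup>2) \<longlonglongrightarrow> (cmod (stft \<phi> f z))\<^sup>2"
  proof (intro AE_I2)
    fix z :: "'a \<times> 'a"
    obtain N :: nat where N: "norm z < real N" using reals_Archimedean2 by blast
    have "eventually (\<lambda>n. indicator (ball 0 (real n)) z *\<^sub>R (cmod (stft \<phi> f z))\<^sup>2 = (cmod (stft \<phi> f z))\<^sup>2) sequentially"
      using eventually_ge_at_top[of N] by eventually_elim (use N in \<open>auto simp: indicator_def\<close>)
    then show "(\<lambda>n. indicator (ball 0 (real n)) z *\<^sub>R (cmod (stft \<phi> f z))\<^sup>2) \<longlonglongrightarrow> (cmod (stft \<phi> f z))\<^sup>2"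
      by (rule tendsto_eventually)
  qed
qed

section \<open>The operator of one cell: quadratic form, norm and spectrum\<close>

lemma loc_op_inner_self:
  assumes "L2 f" "S \<in> sets lebesgue" "bounded S"
  shows "L2_inner (loc_op \<phi> S f) f = complex_of_real (energy f S)"
proof -
  have "L2_inner (loc_op \<phi> S f) f = (\<integral>z. complex_of_real (indicator S z *\<^sub>R (cmod (stft \<phi> f z))\<^sup>2) \<partial>lebesgue)"
    unfolding loc_op_inner[OF assms(1,1,2,3)] set_lebesgue_integral_def
    by (intro Bochner_Integration.integral_cong) (auto simp: indicator_def complex_norm_square simp del: of_real_power)
  then show ?thesis
    by (simp only: integral_complex_of_real energy_def set_lebesgue_integral_def)
qed

text \<open>In operator terms, the square of H is at most H. With \<open>U\<close> the transform
  restricted to the cell, the squared norm of h = H f is the inner product of \<open>U\<close> with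
  the transform of \<open>h\<close>; Cauchy-Schwarz and the isometry cancel one norm of
  \<open>h\<close>.\<close>

lemma loc_op_norm_le:
  assumes f: "L2 f" and S: "S \<in> sets lebesgue" "bounded S"
  shows "(L2_norm (loc_op \<phi> S f))\<^sup>2 \<le> energy f S"
proof -
  define h where "h = loc_op \<phi> S f"
  have h: "L2 h" unfolding h_def by (rule L2_loc_op[OF f S])
  define U where "U z = complex_of_real (indicator S z) * stft \<phi> f z" for z
  have [measurable]: "stft \<phi> f \<in> borel_measurable lebesgue" "S \<in> sets lebesgue"
    using L2_measurable[OF L2_stft[OF f]] S by auto
  have sq: "(cmod (U z))\<^sup>2 = indicator S z *\<^sub>R (cmod (stft \<phi> f z))\<^sup>2" for z
    by (auto simp: U_def indicator_def)
  have U: "L2 U"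
    unfolding L2_def sq
  proof
    show "U \<in> borel_measurable lebesgue" unfolding U_def by measurable
  qed (rule integrable_mult_indicator[OF S(1) integrable_stft_sq[OF f]])
  have nU: "(L2_norm U)\<^sup>2 = energy f S"
    unfolding L2_norm_sq sq energy_def set_lebesgue_integral_def ..
  have "complex_of_real ((L2_norm h)\<^sup>2) = L2_inner U (stft \<phi> h)"
    unfolding L2_inner_self[symmetric] using loc_op_inner[OF f h S]
    by (simp add: h_def[symmetric] set_lebesgue_integral_def L2_inner_def U_def scaleR_conv_of_real mult.assoc)
  then have "(L2_norm h)\<^sup>2 \<le> L2_norm U * L2_norm h"
    using L2_Cauchy_Schwarz[OF U L2_stft[OF h]] L2_norm_stft[OF h]
    by (metis abs_of_nonneg norm_of_real zero_le_power2)
  then have "L2_norm h \<le> L2_norm U"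
    by (cases "L2_norm h = 0") (auto simp: power2_eq_square dest!: mult_right_le_imp_le intro: less_le[THEN iffD2])
  then have "(L2_norm h)\<^sup>2 \<le> (L2_norm U)\<^sup>2" by (intro power_mono) auto
  then show ?thesis by (simp add: nU h_def)
qed

text \<open>Apply the expansion to \<open>e k\<close> itself: by orthonormality the partial sums are
  constant from n = k on, so the vanishing limit means that H maps \<open>e k\<close> to
  \<open>lam k\<close> times \<open>e k\<close> in L2. Pairing with \<open>e k\<close> identifies
  the eigenvalue.\<close>

lemma spectral_decomp_eigen:
  assumes sd: "spectral_decomp \<phi> S lam e" and S: "S \<in> sets lebesgue" "bounded S" and k: "k \<ge> 1"
  shows "lam k = energy (e k) S"
proof -
  have ek: "L2 (e k)" and orth: "\<And>j. j \<ge> 1 \<Longrightarrow> L2_inner (e k) (e j) = (if k = j then 1 else 0)"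
    using sd k unfolding spectral_decomp_def by auto
  have n1: "L2_norm (e k) = 1"
    using orth[OF k] by (simp add: L2_inner_self) (metis L2_norm_nonneg of_real_eq_1_iff of_real_power power2_eq_1_iff
        not_one_le_zero le_minus_one_simps(3))
  let ?d = "\<lambda>t. loc_op \<phi> S (e k) t - complex_of_real (lam k) * e k t"
  have "(\<lambda>n. L2_norm (\<lambda>t. loc_op \<phi> S (e k) t
       - (\<Sum>j=1..n. complex_of_real (lam j) * L2_inner (e k) (e j) * e j t))) \<longlonglongrightarrow> 0"
    using sd ek unfolding spectral_decomp_def by blast
  moreover have "eventually (\<lambda>n. L2_norm (\<lambda>t. loc_op \<phi> S (e k) t
       - (\<Sum>j=1..n. complex_of_real (lam j) * L2_inner (e k) (e j) * e j t)) = L2_norm ?d) sequentially"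
    using eventually_ge_at_top[of k]
  proof eventually_elim
    case (elim n)
    have "(\<Sum>j=1..n. complex_of_real (lam j) * L2_inner (e k) (e j) * e j t) = complex_of_real (lam k) * e k t" for t
    proof -
      have "(\<Sum>j=1..n. complex_of_real (lam j) * L2_inner (e k) (e j) * e j t)
        = (\<Sum>j=1..n. if k = j then complex_of_real (lam j) * e j t else 0)"
        by (intro sum.cong) (auto simp: orth)
      then show ?thesis using elim k by simp
    qed
    then show ?case by simp
  qed
  ultimately have "(\<lambda>n. L2_norm ?d) \<longlonglongrightarrow> 0"
    by (rule Lim_transform_eventually)
  then have d0: "L2_norm ?d = 0" by (simp add: LIMSEQ_const_iff)
  have "L2_inner ?d (e k) = complex_of_real (energy (e k) S - lam k)"
    using orth[OF k]
    by (simp add: L2_inner_diff_left L2_loc_op[OF ek S] L2_cmult ek L2_inner_cmult_left loc_op_inner_self[OF ek S])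
  moreover have "cmod (L2_inner ?d (e k)) \<le> 0"
    using L2_Cauchy_Schwarz[OF L2_diff[OF L2_loc_op[OF ek S] L2_cmult[OF ek]] ek, of "complex_of_real (lam k)"] d0 by simp
  ultimately show ?thesis by (simp del: of_real_diff)
qed

text \<open>Bessel's inequality, applied to the time-frequency shifts of the window, bounds the pointwise sum
  of the energy densities of the eigenfunctions by 1; this replaces the trace formula.\<close>

lemma spectral_decomp_eigenvalue_le:
  assumes sd: "spectral_decomp \<phi> S lam e" and S: "S \<in> sets lebesgue" "bounded S"
  shows "real n * lam n \<le> measure lebesgue S"
proof (cases "n = 0")
  case False
  have L: "L2 (e k)" if "k \<ge> 1" for k using sd that unfolding spectral_decomp_def by auto
  have mono: "lam n \<le> lam k" if "1 \<le> k" "k \<le> n" for k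
    using that(2) by (induction n rule: dec_induct) (use sd that(1) in \<open>auto simp: spectral_decomp_def intro: order_trans\<close>)
  have fin: "S \<in> fmeasurable lebesgue" using S bounded_set_imp_lmeasurable by blast
  have i: "integrable lebesgue (\<lambda>z. indicator S z *\<^sub>R (cmod (stft \<phi> (e k) z))\<^sup>2)" if "k \<ge> 1" for k
    using S(1) integrable_stft_sq[OF L[OF that]] by (rule integrable_mult_indicator)
  \<comment> \<open>Monotonicity replaces n copies of the smallest eigenvalue by the first n
    eigenvalues, whose sum is a partial trace.\<close>
  have "real n * lam n = (\<Sum>k=1..n. lam n)" by simp
  also have "\<dots> \<le> (\<Sum>k=1..n. lam k)" by (intro sum_mono mono) auto
  also have "\<dots> = (\<Sum>k=1..n. energy (e k) S)" using spectral_decomp_eigen[OF sd S] by (intro sum.cong) auto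
  also have "\<dots> = (\<integral>z. (\<Sum>k=1..n. indicator S z *\<^sub>R (cmod (stft \<phi> (e k) z))\<^sup>2) \<partial>lebesgue)"
    unfolding energy_def set_lebesgue_integral_def
    by (intro Bochner_Integration.integral_sum[symmetric] i) simp
  also have "\<dots> \<le> (\<integral>z. indicator S z \<partial>lebesgue)"
  proof (rule Bochner_Integration.integral_mono)
    show "integrable lebesgue (\<lambda>z. \<Sum>k=1..n. indicator S z *\<^sub>R (cmod (stft \<phi> (e k) z))\<^sup>2)"
      by (intro Bochner_Integration.integrable_sum i) simp
    show "integrable lebesgue (indicator S :: _ \<Rightarrow> real)"
      using fin unfolding fmeasurable_def by (intro integrable_real_indicator) auto
    fix z
    have "(\<Sum>k=1..n. (cmod (stft \<phi> (e k) z))\<^sup>2) = (\<Sum>k=1..n. (cmod (L2_inner (tfs \<phi> z) (e k)))\<^sup>2)"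
      unfolding stft_eq_inner by (subst L2_inner_commute) simp
    also have "\<dots> \<le> (L2_norm (tfs \<phi> z))\<^sup>2"
      using sd by (intro L2_Bessel L2_tfs) (auto simp: spectral_decomp_def)
    finally have "(\<Sum>k=1..n. (cmod (stft \<phi> (e k) z))\<^sup>2) \<le> 1" by (simp add: L2_tfs)
    then show "(\<Sum>k=1..n. indicator S z *\<^sub>R (cmod (stft \<phi> (e k) z))\<^sup>2) \<le> indicator S z"
      by (simp add: indicator_def)
  qed
  also have "\<dots> = measure lebesgue S" by simp
  finally show ?thesis .
qed simp

text \<open>The same coefficients summed with the first and with the second power of the
  eigenvalues: pairing the L2 convergent expansion with \<open>f\<close> gives the energy, taking
  norms gives the squared norm of H f. Truncation compares these two series.\<close>

lemma spectral_decomp_series: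
  assumes sd: "spectral_decomp \<phi> S lam e" and S: "S \<in> sets lebesgue" "bounded S" and f: "L2 f"
  shows "(\<lambda>n. \<Sum>k=1..n. lam k * (cmod (L2_inner f (e k)))\<^sup>2) \<longlonglongrightarrow> energy f S"
    and "(\<lambda>n. \<Sum>k=1..n. (lam k)\<^sup>2 * (cmod (L2_inner f (e k)))\<^sup>2) \<longlonglongrightarrow> (L2_norm (loc_op \<phi> S f))\<^sup>2"
proof -
  define s where "s n t = (\<Sum>k=1..n. (complex_of_real (lam k) * L2_inner f (e k)) * e k t)" for n t
  have L: "L2 (e k)" if "k \<in> {1..n}" for k n using sd that unfolding spectral_decomp_def by auto
  have orth: "L2_inner (e j) (e k) = (if j = k then 1 else 0)" if "j \<in> {1..n}" "k \<in> {1..n}" for j k n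
    using sd that unfolding spectral_decomp_def by auto
  have H: "L2 (loc_op \<phi> S f)" by (rule L2_loc_op[OF f S])
  have Ls: "L2 (s n)" for n unfolding s_def using L by (intro L2_sum L2_cmult) blast
  have lim: "(\<lambda>n. L2_norm (\<lambda>t. loc_op \<phi> S f t - s n t)) \<longlonglongrightarrow> 0"
    using sd f unfolding spectral_decomp_def s_def by blast
  have inn: "L2_inner (s n) f = complex_of_real (\<Sum>k=1..n. lam k * (cmod (L2_inner f (e k)))\<^sup>2)" for n
  proof -
    have "L2_inner (s n) f = (\<Sum>k=1..n. complex_of_real (lam k) * L2_inner f (e k) * L2_inner (e k) f)"
      unfolding s_def using L f by (subst L2_inner_sum_left) (auto intro!: L2_cmult simp: L2_inner_cmult_left)
    also have "\<dots> = (\<Sum>k=1..n. complex_of_real (lam k * (cmod (L2_inner f (e k)))\<^sup>2))"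
      by (intro sum.cong refl)
         (simp add: L2_inner_commute[of "e _" f] complex_norm_square mult.assoc del: of_real_power)
    finally show ?thesis by simp
  qed
  have "(\<lambda>n. L2_norm (\<lambda>t. loc_op \<phi> S f t - s n t) * L2_norm f) \<longlonglongrightarrow> 0"
    using lim by (auto intro!: tendsto_eq_intros)
  moreover have "norm (energy f S - (\<Sum>k=1..n. lam k * (cmod (L2_inner f (e k)))\<^sup>2)) \<le> L2_norm (\<lambda>t. loc_op \<phi> S f t - s n t) * L2_norm f" for n
  proof -
    have "L2_inner (\<lambda>t. loc_op \<phi> S f t - s n t) f = complex_of_real (energy f S - (\<Sum>k=1..n. lam k * (cmod (L2_inner f (e k)))\<^sup>2))"
      by (simp only: L2_inner_diff_left[OF H Ls f] inn loc_op_inner_self[OF f S] of_real_diff)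
    then show ?thesis
      using L2_Cauchy_Schwarz[OF L2_diff[OF H Ls] f, of n] by (simp only: norm_of_real real_norm_def)
  qed
  ultimately have "(\<lambda>n. energy f S - (\<Sum>k=1..n. lam k * (cmod (L2_inner f (e k)))\<^sup>2)) \<longlonglongrightarrow> 0"
    by (intro Lim_null_comparison[where f="\<lambda>n. energy f S - _ n"]) auto
  then have "(\<lambda>n. energy f S - (energy f S - (\<Sum>k=1..n. lam k * (cmod (L2_inner f (e k)))\<^sup>2))) \<longlonglongrightarrow> energy f S - 0"
    by (intro tendsto_diff tendsto_const)
  then show "(\<lambda>n. \<Sum>k=1..n. lam k * (cmod (L2_inner f (e k)))\<^sup>2) \<longlonglongrightarrow> energy f S" by simp
  have ns: "(L2_norm (s n))\<^sup>2 = (\<Sum>k=1..n. (lam k)\<^sup>2 * (cmod (L2_inner f (e k)))\<^sup>2)" for n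
    unfolding s_def by (subst L2_Parseval_finite) (use L orth in \<open>auto simp: norm_mult power_mult_distrib\<close>)
  have "(\<lambda>n. L2_norm (s n) - L2_norm (loc_op \<phi> S f)) \<longlonglongrightarrow> 0"
    using L2_norm_triangle_abs[OF H Ls] by (intro Lim_null_comparison[OF _ lim]) (simp add: abs_minus_commute)
  then have "(\<lambda>n. L2_norm (s n)) \<longlonglongrightarrow> L2_norm (loc_op \<phi> S f)" by (simp add: LIM_zero_iff)
  then have "(\<lambda>n. (L2_norm (s n))\<^sup>2) \<longlonglongrightarrow> (L2_norm (loc_op \<phi> S f))\<^sup>2" by (rule tendsto_power)
  then show "(\<lambda>n. \<Sum>k=1..n. (lam k)\<^sup>2 * (cmod (L2_inner f (e k)))\<^sup>2) \<longlonglongrightarrow> (L2_norm (loc_op \<phi> S f))\<^sup>2"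
    by (simp add: ns)
qed

lemma spectral_decomp_partial_le:
  assumes sd: "spectral_decomp \<phi> S lam e" and S: "S \<in> sets lebesgue" "bounded S" and f: "L2 f"
  shows "(\<Sum>k=1..N. (lam k)\<^sup>2 * (cmod (L2_inner f (e k)))\<^sup>2) \<le> (L2_norm (loc_op \<phi> S f))\<^sup>2"
  by (rule incseq_le[OF _ spectral_decomp_series(2)[OF assms]]) (auto intro!: incseq_SucI)

text \<open>The comparison is made between partial sums with n \<ge> N and then passed to the limit.
  Beyond \<open>N\<close> one factor of the squared eigenvalue is replaced by 1 / \<alpha>; what
  remains is part of the energy series, whose terms are nonnegative.\<close>

lemma spectral_decomp_truncation:
  assumes sd: "spectral_decomp \<phi> S lam e" and S: "S \<in> sets lebesgue" "bounded S" and f: "L2 f"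
    and \<alpha>: "\<alpha> > 0" "\<alpha> * measure lebesgue S \<le> real N"
  shows "(L2_norm (loc_op \<phi> S f))\<^sup>2 \<le> (\<Sum>k=1..N. (lam k)\<^sup>2 * (cmod (L2_inner f (e k)))\<^sup>2) + energy f S / \<alpha>"
proof (rule LIMSEQ_le[OF spectral_decomp_series(2)[OF assms(1-4)]])
  let ?c = "\<lambda>k. (cmod (L2_inner f (e k)))\<^sup>2"
  show "(\<lambda>n. (\<Sum>k=1..N. (lam k)\<^sup>2 * ?c k) + (\<Sum>k=1..n. lam k * ?c k) / \<alpha>)
      \<longlonglongrightarrow> (\<Sum>k=1..N. (lam k)\<^sup>2 * ?c k) + energy f S / \<alpha>"
    using \<alpha>(1) by (intro tendsto_add tendsto_const tendsto_divide spectral_decomp_series(1)[OF assms(1-4)]) auto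
  show "\<exists>M. \<forall>n\<ge>M. (\<Sum>k=1..n. (lam k)\<^sup>2 * ?c k) \<le> (\<Sum>k=1..N. (lam k)\<^sup>2 * ?c k) + (\<Sum>k=1..n. lam k * ?c k) / \<alpha>"
  proof (intro exI allI impI)
    fix n assume n: "N \<le> n"
    have nn: "0 \<le> lam k" if "k \<ge> 1" for k using sd that unfolding spectral_decomp_def by auto
    \<comment> \<open>For k > N one has k lam k \<le> |S| \<le> N / \<alpha> < k / \<alpha>, and k
      is positive, so it cancels.\<close>
    have small: "lam k \<le> 1 / \<alpha>" if "k > N" for k
    proof -
      have "real k * (\<alpha> * lam k) = \<alpha> * (real k * lam k)" by simp
      also have "\<dots> \<le> \<alpha> * measure lebesgue S"
        using spectral_decomp_eigenvalue_le[OF sd S, of k] \<alpha>(1) by (intro mult_left_mono) auto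
      also have "\<dots> \<le> real k * 1" using \<alpha>(2) that by simp
      finally have "\<alpha> * lam k \<le> 1" using that by (simp add: mult_le_cancel_left)
      then show ?thesis using \<alpha>(1) by (simp add: pos_le_divide_eq mult.commute)
    qed
    have split: "(\<Sum>k=1..n. h k) = (\<Sum>k=1..N. h k) + (\<Sum>k=Suc N..n. h k)" for h :: "nat \<Rightarrow> real"
      by (subst sum.union_disjoint[symmetric]) (use n in \<open>auto intro!: sum.cong\<close>)
    have "(\<Sum>k=Suc N..n. (lam k)\<^sup>2 * ?c k) \<le> (\<Sum>k=Suc N..n. lam k * ?c k / \<alpha>)"
    proof (intro sum_mono)
      fix k assume "k \<in> {Suc N..n}"
      then have "lam k * lam k \<le> lam k * (1 / \<alpha>)" using small nn by (intro mult_left_mono) auto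
      then show "(lam k)\<^sup>2 * ?c k \<le> lam k * ?c k / \<alpha>"
        using mult_right_mono[of "lam k * lam k" "lam k * (1 / \<alpha>)" "?c k"] by (simp add: power2_eq_square)
    qed
    also have "\<dots> = (\<Sum>k=Suc N..n. lam k * ?c k) / \<alpha>" by (simp add: sum_divide_distrib)
    also have "\<dots> \<le> (\<Sum>k=1..n. lam k * ?c k) / \<alpha>"
      using \<alpha>(1) nn by (intro divide_right_mono sum_mono2) auto
    finally show "(\<Sum>k=1..n. (lam k)\<^sup>2 * ?c k) \<le> (\<Sum>k=1..N. (lam k)\<^sup>2 * ?c k) + (\<Sum>k=1..n. lam k * ?c k) / \<alpha>"
      unfolding split[of "\<lambda>k. (lam k)\<^sup>2 * ?c k"] by simp
  qed
qed

end

subsection \<open>Almost orthogonality\<close>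

text \<open>The majorant of the ambiguity function from \<open>stft_tfs_decay\<close>, cut off
  inside radius r. Since the uncut majorant is integrable, the mass of the cut one tends to 0 as r
  grows.\<close>

definition kern :: "real \<Rightarrow> 'a::euclidean_space \<times> 'a \<Rightarrow> real" where
  "kern r u = indicator {u. r \<le> norm u} u * (1 / wt (fst u) * (1 / wt (snd u)))"

lemma kern_measurable [measurable]: "kern r \<in> borel_measurable borel"
  unfolding kern_def by measurable

lemma kern_nonneg [simp]: "0 \<le> kern r u"
  by (simp add: kern_def)

lemma kern_minus: "kern r (- u) = kern r u"
  by (simp add: kern_def indicator_def)

lemma kern_commute: "kern r (w - z) = kern r (z - w)"
  using kern_minus[of r "z - w"] by simp

lemma integrable_wt_tensor:
  "integrable lborel (\<lambda>u::'a::euclidean_space \<times> 'a. 1 / wt (fst u) * (1 / wt (snd u)))"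
  using integrable_lborel_tensor[OF integrable_inverse_wt integrable_inverse_wt] by (simp add: lborel_prod)

lemma integrable_kern: "integrable lborel (kern r :: 'a::euclidean_space \<times> 'a \<Rightarrow> real)"
  by (rule Bochner_Integration.integrable_bound[OF integrable_wt_tensor]) (auto simp: kern_def indicator_def)

lemma kern_tendsto_0:
  "(\<lambda>n. \<integral>u. kern (real n) u \<partial>(lborel :: ('a::euclidean_space \<times> 'a) measure)) \<longlonglongrightarrow> 0"
proof -
  have "(\<lambda>n. \<integral>u. kern (real n) u \<partial>(lborel :: ('a \<times> 'a) measure)) \<longlonglongrightarrow> (\<integral>u. 0 \<partial>(lborel :: ('a \<times> 'a) measure))"
  proof (rule integral_dominated_convergence[OF _ _ integrable_wt_tensor])
    show "AE u in lborel. (\<lambda>n. kern (real n) (u :: 'a \<times> 'a)) \<longlonglongrightarrow> 0"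
    proof (intro AE_I2)
      fix u :: "'a \<times> 'a"
      obtain N :: nat where N: "norm u < real N" using reals_Archimedean2 by blast
      have "eventually (\<lambda>n. kern (real n) u = 0) sequentially"
        using eventually_ge_at_top[of N] by eventually_elim (use N in \<open>auto simp: kern_def indicator_def\<close>)
      then show "(\<lambda>n. kern (real n) u) \<longlonglongrightarrow> 0" by (rule tendsto_eventually)
    qed
  qed (auto simp: kern_def indicator_def)
  then show ?thesis by simp
qed

context schwartz_window
begin

definition conv_kern :: "real \<Rightarrow> ('a \<Rightarrow> complex) \<Rightarrow> 'a \<times> 'a \<Rightarrow> real" where
  "conv_kern r f z = (\<integral>w. cmod (stft \<phi> f w) * kern r (w - z) \<partial>lborel)"

lemma integrable_conv_kern:
  assumes "L2 f"
  shows "integrable lborel (\<lambda>w. cmod (stft \<phi> f w) * kern r (w - z))"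
proof (rule Bochner_Integration.integrable_bound)
  note [measurable] = stft_measurable[OF assms]
  have "integrable lborel (\<lambda>w. kern r (- z + w))"
    by (rule integrable_lborel_translate[OF integrable_kern])
  then show "integrable lborel (\<lambda>w. L2_norm f * kern r (w - z))" by simp
  show "AE w in lborel. norm (cmod (stft \<phi> f w) * kern r (w - z)) \<le> norm (L2_norm f * kern r (w - z))"
    using stft_le_norm[OF assms] by (intro AE_I2) (auto simp: abs_mult intro!: mult_right_mono)
  show "(\<lambda>w. cmod (stft \<phi> f w) * kern r (w - z)) \<in> borel_measurable lborel" by measurable
qed

lemma conv_kern_nonneg: "0 \<le> conv_kern r f z"
  unfolding conv_kern_def by simp

text \<open>Schur's test for a symmetric kernel: the product of the two values of the transform is
  at most half the sum of their squares, and by symmetry each half contributes half the mass of the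
  kernel times the squared norm. Nonnegative integrals deliver integrability and the bound
  together.\<close>

lemma conv_kern_Schur:
  assumes f: "L2 f"
  shows "integrable lebesgue (\<lambda>z. cmod (stft \<phi> f z) * conv_kern r f z)"
    and "(\<integral>z. cmod (stft \<phi> f z) * conv_kern r f z \<partial>lebesgue)
      \<le> (\<integral>u. kern r u \<partial>(lborel :: ('a \<times> 'a) measure)) * (L2_norm f)\<^sup>2"
proof -
  note [measurable] = stft_measurable[OF f]
  define U where "U z = cmod (stft \<phi> f z)" for z
  have [measurable]: "U \<in> borel_measurable borel" unfolding U_def by measurable
  define K where "K = (\<integral>u. kern r u \<partial>(lborel :: ('a \<times> 'a) measure))"
  have K0: "K \<ge> 0" unfolding K_def by simp
  have [measurable]: "conv_kern r f \<in> borel_measurable borel" unfolding conv_kern_def by measurable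
  have nk: "(\<integral>\<^sup>+w. ennreal (kern r (w - z)) \<partial>lborel) = ennreal K" for z :: "'a \<times> 'a"
  proof -
    have "(\<integral>\<^sup>+w. ennreal (kern r (- z + w)) \<partial>lborel) = (\<integral>\<^sup>+w. ennreal (kern r w) \<partial>(lborel :: ('a \<times> 'a) measure))"
      by (rule nn_integral_lborel_translate) measurable
    also have "\<dots> = ennreal K" unfolding K_def by (rule nn_integral_eq_integral[OF integrable_kern]) simp
    finally show ?thesis by simp
  qed
  have nU: "(\<integral>\<^sup>+z. ennreal ((U z)\<^sup>2) \<partial>lborel) = ennreal ((L2_norm f)\<^sup>2)"
    unfolding U_def by (rule nn_integral_stft[OF f])
  have half: "(\<integral>\<^sup>+z. \<integral>\<^sup>+w. ennreal ((U z)\<^sup>2 / 2) * ennreal (kern r (w - z)) \<partial>lborel \<partial>lborel) = ennreal ((L2_norm f)\<^sup>2 * K / 2)"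
  proof -
    have "(\<integral>\<^sup>+z. \<integral>\<^sup>+w. ennreal ((U z)\<^sup>2 / 2) * ennreal (kern r (w - z)) \<partial>lborel \<partial>lborel)
        = (\<integral>\<^sup>+z. ennreal ((U z)\<^sup>2 / 2) * ennreal K \<partial>lborel)"
      by (simp add: nn_integral_cmult nk)
    also have "\<dots> = (\<integral>\<^sup>+z. ennreal (K / 2) * ennreal ((U z)\<^sup>2) \<partial>lborel)"
      by (intro nn_integral_cong) (simp add: K0 ennreal_mult[symmetric] mult_ac)
    also have "\<dots> = ennreal (K / 2) * ennreal ((L2_norm f)\<^sup>2)"
      by (simp add: nn_integral_cmult nU)
    finally show ?thesis using K0 by (simp add: ennreal_mult[symmetric] mult_ac)
  qed
  have "(\<integral>\<^sup>+z. ennreal (U z * conv_kern r f z) \<partial>lborel)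
      = (\<integral>\<^sup>+z. \<integral>\<^sup>+w. ennreal (U z * (U w * kern r (w - z))) \<partial>lborel \<partial>lborel)"
  proof (intro nn_integral_cong)
    fix z :: "'a \<times> 'a"
    have "integrable lborel (\<lambda>w. U z * (U w * kern r (w - z)))"
      using integrable_conv_kern[OF f, of r z] unfolding U_def by (rule integrable_mult_right)
    from nn_integral_eq_integral[OF this] show "ennreal (U z * conv_kern r f z) = (\<integral>\<^sup>+w. ennreal (U z * (U w * kern r (w - z))) \<partial>lborel)"
      by (simp add: conv_kern_def U_def)
  qed
  also have "\<dots> \<le> (\<integral>\<^sup>+z. \<integral>\<^sup>+w. ennreal ((U z)\<^sup>2 / 2) * ennreal (kern r (w - z)) + ennreal ((U w)\<^sup>2 / 2) * ennreal (kern r (z - w)) \<partial>lborel \<partial>lborel)"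
  proof (intro nn_integral_mono)
    fix z w :: "'a \<times> 'a"
    have "U z * U w \<le> (U z)\<^sup>2 / 2 + (U w)\<^sup>2 / 2"
      using sum_squares_bound[of "U z" "U w"] by simp
    then have "U z * (U w * kern r (w - z)) \<le> (U z)\<^sup>2 / 2 * kern r (w - z) + (U w)\<^sup>2 / 2 * kern r (z - w)"
      using mult_right_mono[of "U z * U w" "(U z)\<^sup>2 / 2 + (U w)\<^sup>2 / 2" "kern r (w - z)"] kern_commute[of r w z]
      by (simp add: distrib_right mult.assoc)
    then have "ennreal (U z * (U w * kern r (w - z))) \<le> ennreal ((U z)\<^sup>2 / 2 * kern r (w - z) + (U w)\<^sup>2 / 2 * kern r (z - w))"
      by (rule ennreal_leI)
    then show "ennreal (U z * (U w * kern r (w - z))) \<le> ennreal ((U z)\<^sup>2 / 2) * ennreal (kern r (w - z)) + ennreal ((U w)\<^sup>2 / 2) * ennreal (kern r (z - w))"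
      by (simp add: ennreal_mult[symmetric])
  qed
  also have "\<dots> = (\<integral>\<^sup>+z. \<integral>\<^sup>+w. ennreal ((U z)\<^sup>2 / 2) * ennreal (kern r (w - z)) \<partial>lborel \<partial>lborel)
      + (\<integral>\<^sup>+z. \<integral>\<^sup>+w. ennreal ((U w)\<^sup>2 / 2) * ennreal (kern r (z - w)) \<partial>lborel \<partial>lborel)"
    by (simp add: nn_integral_add)
  also have "(\<integral>\<^sup>+z. \<integral>\<^sup>+w. ennreal ((U w)\<^sup>2 / 2) * ennreal (kern r (z - w)) \<partial>lborel \<partial>lborel)
      = (\<integral>\<^sup>+w. \<integral>\<^sup>+z. ennreal ((U w)\<^sup>2 / 2) * ennreal (kern r (z - w)) \<partial>lborel \<partial>lborel)"
    by (rule lborel_pair.Fubini') measurable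
  finally have le: "(\<integral>\<^sup>+z. ennreal (U z * conv_kern r f z) \<partial>lborel) \<le> ennreal (K * (L2_norm f)\<^sup>2)"
    unfolding half using K0 by (simp add: ennreal_plus[symmetric] mult.commute del: ennreal_plus)
  have nn: "0 \<le> U z * conv_kern r f z" for z by (simp add: U_def conv_kern_nonneg)
  have i: "integrable lborel (\<lambda>z. U z * conv_kern r f z)"
    using le nn by (intro integrableI_bounded) (auto simp: le_less_trans[OF _ ennreal_less_top])
  then show "integrable lebesgue (\<lambda>z. cmod (stft \<phi> f z) * conv_kern r f z)"
    unfolding U_def by (subst integrable_completion) auto
  have "ennreal (\<integral>z. U z * conv_kern r f z \<partial>lborel) \<le> ennreal (K * (L2_norm f)\<^sup>2)"
    using le nn_integral_eq_integral[OF i] nn by simp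
  then have "(\<integral>z. U z * conv_kern r f z \<partial>lborel) \<le> K * (L2_norm f)\<^sup>2"
    using K0 by (subst (asm) ennreal_le_iff) auto
  then show "(\<integral>z. cmod (stft \<phi> f z) * conv_kern r f z \<partial>lebesgue) \<le> (\<integral>u. kern r u \<partial>(lborel :: ('a \<times> 'a) measure)) * (L2_norm f)\<^sup>2"
    unfolding U_def K_def by (subst integral_completion) auto
qed

text \<open>By the reproducing formula, the transform of f minus its localization to a ball is an integral
  over the complement of the ball.\<close>

lemma stft_loc_op_remainder:
  obtains C where "C > 0"
    "\<And>f \<gamma> R r z. L2 f \<Longrightarrow> z \<in> ball \<gamma> R \<Longrightarrow>
      cmod (stft \<phi> (\<lambda>t. f t - loc_op \<phi> (ball \<gamma> (R + r)) f t) z) \<le> C * conv_kern r f z"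
proof -
  obtain C where C: "C > 0" "\<And>z w. cmod (stft \<phi> (tfs \<phi> z) w) \<le> C * (1 / wt (fst w - fst z) * (1 / wt (snd w - snd z)))"
    using stft_tfs_decay by blast
  show thesis
  proof (rule that[OF C(1)])
    fix f :: "'a \<Rightarrow> complex" and \<gamma> z :: "'a \<times> 'a" and R r :: real
    assume f: "L2 f" and z: "z \<in> ball \<gamma> R"
    define B where "B = ball \<gamma> (R + r)"
    have B: "B \<in> sets lebesgue" "bounded B" by (auto simp: B_def)
    have [measurable]: "B \<in> sets borel" by (simp add: B_def)
    note [measurable] = stft_measurable[OF f] stft_measurable[OF L2_tfs(1)]
    define q where "q w = stft \<phi> f w * cnj (stft \<phi> (tfs \<phi> z) w)" for w
    have [measurable]: "q \<in> borel_measurable borel" unfolding q_def by measurable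
    have iq: "integrable lebesgue q"
      unfolding q_def by (rule integrable_L2_mult[OF L2_stft[OF f] L2_stft[OF L2_tfs(1)]])
    have iqB: "integrable lebesgue (\<lambda>w. indicator B w *\<^sub>R q w)"
      using B(1) iq by (rule integrable_mult_indicator)
    have "stft \<phi> (\<lambda>t. f t - loc_op \<phi> B f t) z = L2_inner f (tfs \<phi> z) - L2_inner (loc_op \<phi> B f) (tfs \<phi> z)"
      unfolding stft_eq_inner by (rule L2_inner_diff_left[OF f L2_loc_op[OF f B] L2_tfs(1)])
    \<comment> \<open>The reproducing formula, as preservation of inner products by the isometry.
      The localized part has the same integrand \<open>q\<close>, restricted to \<open>B\<close>, so
      the difference sees only the complement.\<close>
    also have "L2_inner f (tfs \<phi> z) = (\<integral>w. q w \<partial>lebesgue)"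
      by (subst L2_inner_stft[OF f L2_tfs(1), symmetric]) (simp only: L2_inner_def q_def[abs_def])
    also have "L2_inner (loc_op \<phi> B f) (tfs \<phi> z) = (\<integral>w. indicator B w *\<^sub>R q w \<partial>lebesgue)"
      unfolding loc_op_inner[OF f L2_tfs(1) B] q_def set_lebesgue_integral_def ..
    also have "(\<integral>w. q w \<partial>lebesgue) - (\<integral>w. indicator B w *\<^sub>R q w \<partial>lebesgue) = (\<integral>w. q w - indicator B w *\<^sub>R q w \<partial>lebesgue)"
      using iq iqB by simp
    also have "\<dots> = (\<integral>w. q w - indicator B w *\<^sub>R q w \<partial>lborel)"
      by (rule integral_completion) measurable
    finally have eq: "stft \<phi> (\<lambda>t. f t - loc_op \<phi> B f t) z = (\<integral>w. q w - indicator B w *\<^sub>R q w \<partial>lborel)" .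
    have i: "integrable lborel (\<lambda>w. q w - indicator B w *\<^sub>R q w)"
      using Bochner_Integration.integrable_diff[OF iq iqB] by (subst (asm) integrable_completion) auto
    have "cmod (stft \<phi> (\<lambda>t. f t - loc_op \<phi> B f t) z) \<le> (\<integral>w. cmod (q w - indicator B w *\<^sub>R q w) \<partial>lborel)"
      unfolding eq by (rule Bochner_Integration.integral_norm_bound)
    also have "\<dots> \<le> (\<integral>w. C * (cmod (stft \<phi> f w) * kern r (w - z)) \<partial>lborel)"
    proof (rule Bochner_Integration.integral_mono)
      show "integrable lborel (\<lambda>w. cmod (q w - indicator B w *\<^sub>R q w))" using i by (rule integrable_norm)
      show "integrable lborel (\<lambda>w. C * (cmod (stft \<phi> f w) * kern r (w - z)))"
        using integrable_conv_kern[OF f] by (rule integrable_mult_right)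
      fix w :: "'a \<times> 'a"
      show "cmod (q w - indicator B w *\<^sub>R q w) \<le> C * (cmod (stft \<phi> f w) * kern r (w - z))"
      proof (cases "w \<in> B")
        case True then show ?thesis using C(1) by simp
      next
        case False
        have "R + r \<le> dist \<gamma> w" using False by (simp add: B_def)
        also have "\<dots> \<le> dist \<gamma> z + dist z w" by (rule dist_triangle)
        finally have "r \<le> norm (w - z)" using z by (simp add: dist_norm norm_minus_commute)
        then have "kern r (w - z) = 1 / wt (fst w - fst z) * (1 / wt (snd w - snd z))"
          by (simp add: kern_def)
        then have "cmod (stft \<phi> f w) * cmod (stft \<phi> (tfs \<phi> z) w) \<le> cmod (stft \<phi> f w) * (C * kern r (w - z))"
          using C(2)[of z w] by (intro mult_left_mono) auto
        then show ?thesis using False by (simp add: q_def norm_mult mult_ac)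
      qed
    qed
    also have "\<dots> = C * conv_kern r f z" unfolding conv_kern_def by (rule integral_mult_right_zero)
    finally show "cmod (stft \<phi> (\<lambda>t. f t - loc_op \<phi> (ball \<gamma> (R + r)) f t) z) \<le> C * conv_kern r f z"
      by (simp add: B_def)
  qed
qed

text \<open>\<open>M\<close> is fixed before \<open>f\<close> and \<open>F\<close>, so the
  inequality survives the exhaustion of \<Gamma> by finite sets. The term with half the squared norm
  is left on the right: it can be absorbed only once the energies on the left exhaust the squared
  norm of f.\<close>

lemma loc_ops_lower_bound:
  fixes \<Gamma> :: "('a \<times> 'a) set"
  assumes disc: "\<And>z. finite (\<Gamma> \<inter> ball z 1) \<and> card (\<Gamma> \<inter> ball z 1) \<le> m"
    and \<Omega>: "\<And>\<gamma>. \<gamma> \<in> \<Gamma> \<Longrightarrow> \<Omega> \<gamma> \<in> sets lebesgue" "\<And>\<gamma>. \<gamma> \<in> \<Gamma> \<Longrightarrow> \<Omega> \<gamma> \<subseteq> ball \<gamma> R"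
  obtains M :: nat where "M \<ge> 1"
    "\<And>f F. L2 f \<Longrightarrow> finite F \<Longrightarrow> F \<subseteq> \<Gamma> \<Longrightarrow>
      (\<Sum>\<gamma>\<in>F. energy f (\<Omega> \<gamma>)) \<le>
        sqrt (real M * (\<Sum>\<gamma>\<in>F. (L2_norm (loc_op \<phi> (\<Omega> \<gamma>) f))\<^sup>2)) * L2_norm f + (L2_norm f)\<^sup>2 / 2"
proof -
  obtain C where C: "C > 0" and rem: "\<And>f \<gamma> R r z. L2 f \<Longrightarrow> z \<in> ball \<gamma> R \<Longrightarrow>
      cmod (stft \<phi> (\<lambda>t. f t - loc_op \<phi> (ball \<gamma> (R + r)) f t) z) \<le> C * conv_kern r f z"
    using stft_loc_op_remainder by blast
  obtain M0 where M0: "M0 \<ge> 1" "\<And>z. finite (\<Gamma> \<inter> ball z R)" "\<And>z. card (\<Gamma> \<inter> ball z R) \<le> M0"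
    using uniformly_discrete_card_ball[OF disc] by blast
  \<comment> \<open>The tail of the kernel has to beat the overlap \<open>M0\<close> of the cells,
    which is counted at radius \<open>R\<close> and does not depend on r. The overlap
    \<open>M\<close> at radius R + r enters only under the square root, so it may be fixed
    afterwards.\<close>
  have "(\<lambda>n. C * real M0 * (\<integral>u. kern (real n) u \<partial>(lborel :: ('a \<times> 'a) measure))) \<longlonglongrightarrow> 0"
    using tendsto_mult_right_zero[OF kern_tendsto_0] .
  then have "eventually (\<lambda>n. C * real M0 * (\<integral>u. kern (real n) u \<partial>(lborel :: ('a \<times> 'a) measure)) < 1 / 2) sequentially"
    by (rule order_tendstoD) simp
  then obtain n where n: "C * real M0 * (\<integral>u. kern (real n) u \<partial>(lborel :: ('a \<times> 'a) measure)) < 1 / 2"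
    using eventually_happens by fastforce
  define r where "r = real n"
  obtain M where M: "M \<ge> 1" "\<And>z. finite (\<Gamma> \<inter> ball z (R + r))" "\<And>z. card (\<Gamma> \<inter> ball z (R + r)) \<le> M"
    using uniformly_discrete_card_ball[OF disc] by blast
  show thesis
  proof (rule that[OF M(1)])
    fix f :: "'a \<Rightarrow> complex" and F :: "('a \<times> 'a) set"
    assume f: "L2 f" and F: "finite F" "F \<subseteq> \<Gamma>"
    define a where "a \<gamma> = L2_norm (loc_op \<phi> (\<Omega> \<gamma>) f)" for \<gamma>
    define b where "b \<gamma> = L2_norm (loc_op \<phi> (ball \<gamma> (R + r)) f)" for \<gamma>
    define W where "W z = cmod (stft \<phi> f z) * conv_kern r f z" for z
    have iW: "integrable lebesgue W" unfolding W_def by (rule conv_kern_Schur(1)[OF f])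
    have W0: "0 \<le> W z" for z by (simp add: W_def conv_kern_nonneg)
    have each: "energy f (\<Omega> \<gamma>) \<le> a \<gamma> * b \<gamma> + C * (LINT z:\<Omega> \<gamma>|lebesgue. W z)" if "\<gamma> \<in> F" for \<gamma>
    proof -
      have S: "\<Omega> \<gamma> \<in> sets lebesgue" "\<Omega> \<gamma> \<subseteq> ball \<gamma> R" "bounded (\<Omega> \<gamma>)"
        using \<Omega> F(2) that bounded_subset[OF bounded_ball] by blast+
      let ?H = "loc_op \<phi> (\<Omega> \<gamma>) f"
      let ?h = "loc_op \<phi> (ball \<gamma> (R + r)) f"
      let ?g = "\<lambda>t. f t - ?h t"
      have h: "L2 ?h" by (rule L2_loc_op[OF f]) auto
      have H: "L2 ?H" by (rule L2_loc_op[OF f S(1,3)])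
      have g: "L2 ?g" by (rule L2_diff[OF f h])
      have "complex_of_real (energy f (\<Omega> \<gamma>)) = L2_inner ?H ?h + L2_inner ?H ?g"
        unfolding loc_op_inner_self[OF f S(1,3), symmetric] by (simp add: L2_inner_diff_right[OF f h H])
      then have "energy f (\<Omega> \<gamma>) \<le> cmod (L2_inner ?H ?h) + cmod (L2_inner ?H ?g)"
        by (metis abs_of_nonneg energy_nonneg norm_of_real norm_triangle_ineq)
      also have "cmod (L2_inner ?H ?h) \<le> a \<gamma> * b \<gamma>"
        unfolding a_def b_def by (rule L2_Cauchy_Schwarz[OF H h])
      also have "cmod (L2_inner ?H ?g) \<le> C * (LINT z:\<Omega> \<gamma>|lebesgue. W z)"
      proof -
        have i1: "integrable lebesgue (\<lambda>z. indicator (\<Omega> \<gamma>) z *\<^sub>R (stft \<phi> f z * cnj (stft \<phi> ?g z)))"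
          by (rule integrable_mult_indicator[OF S(1) integrable_L2_mult[OF L2_stft[OF f] L2_stft[OF g]]])
        have i2: "integrable lebesgue (\<lambda>z. C * (indicator (\<Omega> \<gamma>) z *\<^sub>R W z))"
          by (intro integrable_mult_right integrable_mult_indicator S(1) iW)
        have "cmod (L2_inner ?H ?g) \<le> (\<integral>z. cmod (indicator (\<Omega> \<gamma>) z *\<^sub>R (stft \<phi> f z * cnj (stft \<phi> ?g z))) \<partial>lebesgue)"
          unfolding loc_op_inner[OF f g S(1,3)] set_lebesgue_integral_def by (rule Bochner_Integration.integral_norm_bound)
        also have "\<dots> \<le> (\<integral>z. C * (indicator (\<Omega> \<gamma>) z *\<^sub>R W z) \<partial>lebesgue)"
        proof (rule Bochner_Integration.integral_mono[OF integrable_norm[OF i1] i2])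
          fix z
          show "cmod (indicator (\<Omega> \<gamma>) z *\<^sub>R (stft \<phi> f z * cnj (stft \<phi> ?g z))) \<le> C * (indicator (\<Omega> \<gamma>) z *\<^sub>R W z)"
          proof (cases "z \<in> \<Omega> \<gamma>")
            case True
            then have "cmod (stft \<phi> ?g z) \<le> C * conv_kern r f z" using S(2) by (intro rem[OF f]) auto
            then have "cmod (stft \<phi> f z) * cmod (stft \<phi> ?g z) \<le> cmod (stft \<phi> f z) * (C * conv_kern r f z)"
              by (intro mult_left_mono) auto
            then show ?thesis using True by (simp add: W_def norm_mult mult_ac)
          qed simp
        qed
        also have "\<dots> = C * (LINT z:\<Omega> \<gamma>|lebesgue. W z)"
          unfolding set_lebesgue_integral_def by (rule integral_mult_right_zero)
        finally show ?thesis .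
      qed
      finally show ?thesis by simp
    qed
    have sub0: "{\<gamma> \<in> F. z \<in> \<Omega> \<gamma>} \<subseteq> \<Gamma> \<inter> ball z R" for z
    proof
      fix \<gamma> assume "\<gamma> \<in> {\<gamma> \<in> F. z \<in> \<Omega> \<gamma>}"
      then have \<gamma>: "\<gamma> \<in> \<Gamma>" "z \<in> \<Omega> \<gamma>" using F(2) by auto
      then have "z \<in> ball \<gamma> R" using \<Omega>(2) by blast
      then show "\<gamma> \<in> \<Gamma> \<inter> ball z R" using \<gamma>(1) by (simp add: dist_commute)
    qed
    have card0: "card {\<gamma> \<in> F. z \<in> \<Omega> \<gamma>} \<le> M0" for z
      using card_mono[OF M0(2) sub0] M0(3) order_trans by blast
    have sub1: "{\<gamma> \<in> F. z \<in> ball \<gamma> (R + r)} \<subseteq> \<Gamma> \<inter> ball z (R + r)" for z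
      using F(2) by (auto simp: dist_commute)
    have card1: "card {\<gamma> \<in> F. z \<in> ball \<gamma> (R + r)} \<le> M" for z
      using card_mono[OF M(2) sub1] M(3) order_trans by blast
    have "(\<Sum>\<gamma>\<in>F. (b \<gamma>)\<^sup>2) \<le> (\<Sum>\<gamma>\<in>F. energy f (ball \<gamma> (R + r)))"
      unfolding b_def by (intro sum_mono loc_op_norm_le[OF f]) auto
    also have "\<dots> \<le> real M * (L2_norm f)\<^sup>2"
      by (rule sum_energy_le[OF f F(1) _ card1]) auto
    finally have bsum: "(\<Sum>\<gamma>\<in>F. (b \<gamma>)\<^sup>2) \<le> real M * (L2_norm f)\<^sup>2" .
    have "(\<Sum>\<gamma>\<in>F. a \<gamma> * b \<gamma>) \<le> sqrt (\<Sum>\<gamma>\<in>F. (a \<gamma>)\<^sup>2) * sqrt (\<Sum>\<gamma>\<in>F. (b \<gamma>)\<^sup>2)"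
    proof (rule power2_le_imp_le)
      show "(\<Sum>\<gamma>\<in>F. a \<gamma> * b \<gamma>)\<^sup>2 \<le> (sqrt (\<Sum>\<gamma>\<in>F. (a \<gamma>)\<^sup>2) * sqrt (\<Sum>\<gamma>\<in>F. (b \<gamma>)\<^sup>2))\<^sup>2"
        using Cauchy_Schwarz_ineq_sum[of a b F] by (simp add: power_mult_distrib sum_nonneg)
    qed (simp add: sum_nonneg)
    also have "\<dots> \<le> sqrt (\<Sum>\<gamma>\<in>F. (a \<gamma>)\<^sup>2) * sqrt (real M * (L2_norm f)\<^sup>2)"
      using bsum by (intro mult_left_mono real_sqrt_le_mono) (auto simp: sum_nonneg)
    also have "\<dots> = sqrt (real M * (\<Sum>\<gamma>\<in>F. (a \<gamma>)\<^sup>2)) * L2_norm f"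
      by (simp add: real_sqrt_mult)
    finally have ab: "(\<Sum>\<gamma>\<in>F. a \<gamma> * b \<gamma>) \<le> sqrt (real M * (\<Sum>\<gamma>\<in>F. (a \<gamma>)\<^sup>2)) * L2_norm f" .
    have "(\<Sum>\<gamma>\<in>F. C * (LINT z:\<Omega> \<gamma>|lebesgue. W z)) = C * (\<Sum>\<gamma>\<in>F. LINT z:\<Omega> \<gamma>|lebesgue. W z)"
      by (simp add: sum_distrib_left)
    also have "\<dots> \<le> C * (real M0 * (\<integral>z. W z \<partial>lebesgue))"
      using C F(2) \<Omega>(1) by (intro mult_left_mono sum_set_integral_le[OF F(1) _ iW W0 card0]) auto
    also have "\<dots> \<le> C * (real M0 * ((\<integral>u. kern r u \<partial>(lborel :: ('a \<times> 'a) measure)) * (L2_norm f)\<^sup>2))"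
      using C unfolding W_def by (intro mult_left_mono conv_kern_Schur(2)[OF f]) auto
    also have "\<dots> = (C * real M0 * (\<integral>u. kern r u \<partial>(lborel :: ('a \<times> 'a) measure))) * (L2_norm f)\<^sup>2"
      by (simp only: mult.assoc)
    also have "\<dots> \<le> (1 / 2) * (L2_norm f)\<^sup>2"
      unfolding r_def by (rule mult_right_mono[OF less_imp_le[OF n]]) simp
    finally have W: "(\<Sum>\<gamma>\<in>F. C * (LINT z:\<Omega> \<gamma>|lebesgue. W z)) \<le> (L2_norm f)\<^sup>2 / 2" by simp
    have "(\<Sum>\<gamma>\<in>F. energy f (\<Omega> \<gamma>)) \<le> (\<Sum>\<gamma>\<in>F. a \<gamma> * b \<gamma> + C * (LINT z:\<Omega> \<gamma>|lebesgue. W z))"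
      by (intro sum_mono each)
    also have "\<dots> \<le> sqrt (real M * (\<Sum>\<gamma>\<in>F. (a \<gamma>)\<^sup>2)) * L2_norm f + (L2_norm f)\<^sup>2 / 2"
      unfolding sum.distrib by (intro add_mono ab W)
    finally show "(\<Sum>\<gamma>\<in>F. energy f (\<Omega> \<gamma>)) \<le>
        sqrt (real M * (\<Sum>\<gamma>\<in>F. (L2_norm (loc_op \<phi> (\<Omega> \<gamma>) f))\<^sup>2)) * L2_norm f + (L2_norm f)\<^sup>2 / 2"
      by (simp only: a_def)
  qed
qed

end

subsection \<open>The frame property\<close>

theorem theorem1p1:
  fixes \<phi> :: "'a::euclidean_space \<Rightarrow> complex"
    and \<Gamma> :: "('a \<times> 'a) set"
    and \<Omega> :: "'a \<times> 'a \<Rightarrow> ('a \<times> 'a) set"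
    and lam :: "'a \<times> 'a \<Rightarrow> nat \<Rightarrow> real"
    and e :: "'a \<times> 'a \<Rightarrow> nat \<Rightarrow> 'a \<Rightarrow> complex"
  assumes "schwartz \<phi>"
    and "L2_norm \<phi> = 1"
    and "admissible_cover \<Gamma> \<Omega>"
    and "\<forall>\<gamma>\<in>\<Gamma>. spectral_decomp \<phi> (\<Omega> \<gamma>) (lam \<gamma>) (e \<gamma>)"
  shows "\<exists>\<alpha>>0. \<forall>N :: 'a \<times> 'a \<Rightarrow> nat.
           (\<forall>\<gamma>\<in>\<Gamma>. \<alpha> * measure lebesgue (\<Omega> \<gamma>) \<le> real (N \<gamma>)) \<and> (\<exists>M. \<forall>\<gamma>\<in>\<Gamma>. N \<gamma> \<le> M) \<longrightarrow>
           is_frame {(\<gamma>, k). \<gamma> \<in> \<Gamma> \<and> k \<in> {1..N \<gamma>}}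
                    (\<lambda>(\<gamma>, k) t. complex_of_real (lam \<gamma> k) * e \<gamma> k t)"
proof -
  interpret schwartz_window \<phi> using assms(1,2) by unfold_locales
  obtain m :: nat where disc: "\<And>z. finite (\<Gamma> \<inter> ball z 1) \<and> card (\<Gamma> \<inter> ball z 1) \<le> m"
    using assms(3) unfolding admissible_cover_def by blast
  obtain R where R: "\<And>\<gamma>. \<gamma> \<in> \<Gamma> \<Longrightarrow> \<Omega> \<gamma> \<subseteq> ball \<gamma> R"
    using assms(3) unfolding admissible_cover_def by blast
  have meas: "\<Omega> \<gamma> \<in> sets lebesgue" if "\<gamma> \<in> \<Gamma>" for \<gamma>
    using assms(3) that unfolding admissible_cover_def by blast
  have cover: "(\<Union>\<gamma>\<in>\<Gamma>. \<Omega> \<gamma>) = UNIV"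
    using assms(3) unfolding admissible_cover_def by blast
  have bdd: "bounded (\<Omega> \<gamma>)" if "\<gamma> \<in> \<Gamma>" for \<gamma>
    using R[OF that] bounded_ball bounded_subset by blast
  have sd: "spectral_decomp \<phi> (\<Omega> \<gamma>) (lam \<gamma>) (e \<gamma>)" if "\<gamma> \<in> \<Gamma>" for \<gamma>
    using assms(4) that by blast
  obtain M :: nat where M: "M \<ge> 1" and lower: "\<And>f F. L2 f \<Longrightarrow> finite F \<Longrightarrow> F \<subseteq> \<Gamma> \<Longrightarrow>
      (\<Sum>\<gamma>\<in>F. energy f (\<Omega> \<gamma>)) \<le>
        sqrt (real M * (\<Sum>\<gamma>\<in>F. (L2_norm (loc_op \<phi> (\<Omega> \<gamma>) f))\<^sup>2)) * L2_norm f + (L2_norm f)\<^sup>2 / 2"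
    using loc_ops_lower_bound[OF disc meas R] by blast
  obtain M0 where M0: "M0 \<ge> 1" "\<And>z. finite (\<Gamma> \<inter> ball z R)" "\<And>z. card (\<Gamma> \<inter> ball z R) \<le> M0"
    using uniformly_discrete_card_ball[OF disc] by blast
  have upper: "(\<Sum>\<gamma>\<in>F. energy f (\<Omega> \<gamma>)) \<le> real M0 * (L2_norm f)\<^sup>2"
    if "L2 f" "finite F" "F \<subseteq> \<Gamma>" for f F
  proof (rule sum_energy_le[OF that(1,2)])
    show "\<Omega> \<gamma> \<in> sets lebesgue" if "\<gamma> \<in> F" for \<gamma> using meas that \<open>F \<subseteq> \<Gamma>\<close> by blast
    have sub: "{\<gamma> \<in> F. z \<in> \<Omega> \<gamma>} \<subseteq> \<Gamma> \<inter> ball z R" for z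
    proof
      fix \<gamma> assume "\<gamma> \<in> {\<gamma> \<in> F. z \<in> \<Omega> \<gamma>}"
      then have \<gamma>: "\<gamma> \<in> \<Gamma>" "z \<in> \<Omega> \<gamma>" using that(3) by auto
      then have "z \<in> ball \<gamma> R" using R by blast
      then show "\<gamma> \<in> \<Gamma> \<inter> ball z R" using \<gamma>(1) by (simp add: dist_commute)
    qed
    show "card {\<gamma> \<in> F. z \<in> \<Omega> \<gamma>} \<le> M0" for z
      using card_mono[OF M0(2) sub, of z] M0(3)[of z] by linarith
  qed
  \<comment> \<open>\<alpha> is such that M0 / \<alpha> = A, so truncation loses at most A times the
    squared norm of f. The value of A makes 4 M A = 1/2, half of the squared norm, in the final
    estimate, and A reappears there as the lower frame bound.\<close>
  define A where "A = 1 / (8 * real M)"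
  define \<alpha> where "\<alpha> = 8 * real M * real M0"
  have A: "A > 0" "A \<le> 1" using M by (auto simp: A_def)
  have \<alpha>: "\<alpha> > 0" using M M0 by (simp add: \<alpha>_def)
  show ?thesis
  proof (rule exI[of _ \<alpha>], rule conjI[OF \<alpha>], intro allI impI)
    fix N :: "'a \<times> 'a \<Rightarrow> nat"
    assume "(\<forall>\<gamma>\<in>\<Gamma>. \<alpha> * measure lebesgue (\<Omega> \<gamma>) \<le> real (N \<gamma>)) \<and> (\<exists>M. \<forall>\<gamma>\<in>\<Gamma>. N \<gamma> \<le> M)"
    then have N: "\<forall>\<gamma>\<in>\<Gamma>. \<alpha> * measure lebesgue (\<Omega> \<gamma>) \<le> real (N \<gamma>)" by blast
    define I where "I = {(\<gamma>, k). \<gamma> \<in> \<Gamma> \<and> k \<in> {1..N \<gamma>}}"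
    let ?g = "\<lambda>(\<gamma>, k) t. complex_of_real (lam \<gamma> k) * e \<gamma> k t"
    show "is_frame {(\<gamma>, k). \<gamma> \<in> \<Gamma> \<and> k \<in> {1..N \<gamma>}} ?g"
      unfolding is_frame_def I_def[symmetric]
    proof (rule exI[of _ A], rule exI[of _ "real M0"], intro conjI allI impI A(1))
      show "A \<le> real M0" using A(2) M0(1) by linarith
      fix f :: "'a \<Rightarrow> complex" assume f: "L2 f"
      define c where "c i = (cmod (L2_inner f (?g i)))\<^sup>2" for i
      define s where "s \<gamma> = (\<Sum>k=1..N \<gamma>. (lam \<gamma> k)\<^sup>2 * (cmod (L2_inner f (e \<gamma> k)))\<^sup>2)" for \<gamma>
      have c_eq: "c (\<gamma>, k) = (lam \<gamma> k)\<^sup>2 * (cmod (L2_inner f (e \<gamma> k)))\<^sup>2" for \<gamma> k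
        by (simp add: c_def L2_inner_cmult_right norm_mult power_mult_distrib)
      have c0: "0 \<le> c i" for i by (simp add: c_def)
      have sub: "Sigma F (\<lambda>\<gamma>. {1..N \<gamma>}) \<subseteq> I" if "F \<subseteq> \<Gamma>" for F
        using that by (auto simp: I_def)
      have sum_sigma: "(\<Sum>i\<in>Sigma F (\<lambda>\<gamma>. {1..N \<gamma>}). c i) = (\<Sum>\<gamma>\<in>F. s \<gamma>)" if "finite F" for F
        using sum.Sigma[of F "\<lambda>\<gamma>. {1..N \<gamma>}" "\<lambda>\<gamma> k. c (\<gamma>, k)"] that by (simp add: s_def c_eq[symmetric])
      have s_le: "(\<Sum>\<gamma>\<in>F. s \<gamma>) \<le> real M0 * (L2_norm f)\<^sup>2" if "finite F" "F \<subseteq> \<Gamma>" for F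
      proof -
        have "s \<gamma> \<le> energy f (\<Omega> \<gamma>)" if "\<gamma> \<in> F" for \<gamma>
        proof -
          have \<gamma>: "\<gamma> \<in> \<Gamma>" using that \<open>F \<subseteq> \<Gamma>\<close> by blast
          show ?thesis
            unfolding s_def
            using spectral_decomp_partial_le[OF sd[OF \<gamma>] meas[OF \<gamma>] bdd[OF \<gamma>] f]
              loc_op_norm_le[OF f meas[OF \<gamma>] bdd[OF \<gamma>]] by (rule order_trans)
        qed
        then show ?thesis using upper[OF f that] sum_mono order_trans by meson
      qed
      have bound: "sum c J \<le> real M0 * (L2_norm f)\<^sup>2" if "finite J" "J \<subseteq> I" for J
      proof -
        \<comment> \<open>A finite index set is enlarged to the complete blocks over the cells it
          meets, whose sums are the truncated spectral sums \<open>s\<close>.\<close>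
        have "sum c J \<le> sum c (Sigma (fst ` J) (\<lambda>\<gamma>. {1..N \<gamma>}))"
          using that by (intro sum_mono2) (force simp: I_def c0)+
        also have "\<dots> \<le> real M0 * (L2_norm f)\<^sup>2"
          using that by (subst sum_sigma) (auto simp: I_def intro!: s_le)
        finally show ?thesis .
      qed
      have summ: "c summable_on I"
        using bound by (intro nonneg_bdd_above_summable_on) (auto simp: c0 intro!: bdd_aboveI)
      then show "(\<lambda>i. (cmod (L2_inner f (?g i)))\<^sup>2) summable_on I" by (simp add: c_def[abs_def])
      define T where "T = (\<Sum>\<^sub>\<infinity>i\<in>I. c i)"
      have T_eq: "(\<Sum>\<^sub>\<infinity>i\<in>I. (cmod (L2_inner f (?g i)))\<^sup>2) = T" by (simp add: T_def c_def)
      have T0: "T \<ge> 0" unfolding T_def by (rule infsum_nonneg) (simp add: c0)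
      show "(\<Sum>\<^sub>\<infinity>i\<in>I. (cmod (L2_inner f (?g i)))\<^sup>2) \<le> real M0 * (L2_norm f)\<^sup>2"
        unfolding T_eq T_def using bound by (intro infsum_le_finite_sums[OF summ])
      have s_T: "(\<Sum>\<gamma>\<in>F. s \<gamma>) \<le> T" if "finite F" "F \<subseteq> \<Gamma>" for F
        unfolding sum_sigma[OF that(1), symmetric] T_def
        using that sub by (intro finite_sum_le_infsum[OF summ]) (auto simp: c0)
      have H_T: "(\<Sum>\<gamma>\<in>F. (L2_norm (loc_op \<phi> (\<Omega> \<gamma>) f))\<^sup>2) \<le> T + A * (L2_norm f)\<^sup>2" if F: "finite F" "F \<subseteq> \<Gamma>" for F
      proof -
        have "(\<Sum>\<gamma>\<in>F. (L2_norm (loc_op \<phi> (\<Omega> \<gamma>) f))\<^sup>2) \<le> (\<Sum>\<gamma>\<in>F. s \<gamma> + energy f (\<Omega> \<gamma>) / \<alpha>)"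
        proof (intro sum_mono)
          fix \<gamma> assume "\<gamma> \<in> F"
          then have \<gamma>: "\<gamma> \<in> \<Gamma>" using F(2) by blast
          show "(L2_norm (loc_op \<phi> (\<Omega> \<gamma>) f))\<^sup>2 \<le> s \<gamma> + energy f (\<Omega> \<gamma>) / \<alpha>"
            unfolding s_def using N \<gamma>
            by (intro spectral_decomp_truncation[OF sd[OF \<gamma>] meas[OF \<gamma>] bdd[OF \<gamma>] f \<alpha>]) auto
        qed
        also have "\<dots> = (\<Sum>\<gamma>\<in>F. s \<gamma>) + (\<Sum>\<gamma>\<in>F. energy f (\<Omega> \<gamma>)) / \<alpha>"
          by (simp add: sum.distrib sum_divide_distrib)
        also have "\<dots> \<le> T + real M0 * (L2_norm f)\<^sup>2 / \<alpha>"
          using \<alpha> by (intro add_mono s_T F divide_right_mono upper f) auto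
        also have "real M0 * (L2_norm f)\<^sup>2 / \<alpha> = A * (L2_norm f)\<^sup>2"
          using M0(1) by (simp add: \<alpha>_def A_def)
        finally show ?thesis .
      qed
      \<comment> \<open>This bound does not depend on the finite family: \<open>H_T\<close> controls
        every finite sum of squared norms by the whole frame sum T and the truncation loss.\<close>
      define q where "q = sqrt (real M * (T + A * (L2_norm f)\<^sup>2))"
      have "energy f (ball 0 (real n)) \<le> q * L2_norm f + (L2_norm f)\<^sup>2 / 2" for n
      proof -
        \<comment> \<open>Cells lie within distance \<open>R\<close> of their centres, so every cell
          that meets the ball of radius n has its centre here; discreteness of \<Gamma> makes the
          family finite.\<close>
        define F where "F = \<Gamma> \<inter> ball 0 (real n + R)"
        have F: "finite F" "F \<subseteq> \<Gamma>"
        proof -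
          show "finite F"
            unfolding F_def by (rule uniformly_discrete_card_ball[OF disc, of "real n + R"]) assumption
        qed (simp add: F_def)
        have "ball 0 (real n) \<subseteq> (\<Union>\<gamma>\<in>F. \<Omega> \<gamma>)"
        proof
          fix z :: "'a \<times> 'a" assume z: "z \<in> ball 0 (real n)"
          obtain \<gamma> where \<gamma>: "\<gamma> \<in> \<Gamma>" "z \<in> \<Omega> \<gamma>" using cover by blast
          then have "z \<in> ball \<gamma> R" using R by blast
          then have "dist \<gamma> z < R" by simp
          then have "dist 0 \<gamma> < real n + R"
            using z dist_triangle[of 0 \<gamma> z] by (simp add: dist_commute)
          then show "z \<in> (\<Union>\<gamma>\<in>F. \<Omega> \<gamma>)" using \<gamma> by (auto simp: F_def)
        qed
        then have "energy f (ball 0 (real n)) \<le> (\<Sum>\<gamma>\<in>F. energy f (\<Omega> \<gamma>))"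
          using F meas by (intro energy_le_sum[OF f]) auto
        also have "\<dots> \<le> sqrt (real M * (\<Sum>\<gamma>\<in>F. (L2_norm (loc_op \<phi> (\<Omega> \<gamma>) f))\<^sup>2)) * L2_norm f + (L2_norm f)\<^sup>2 / 2"
          by (rule lower[OF f F])
        also have "\<dots> \<le> q * L2_norm f + (L2_norm f)\<^sup>2 / 2"
          unfolding q_def by (intro add_right_mono mult_right_mono real_sqrt_le_mono mult_left_mono H_T F) auto
        finally show ?thesis .
      qed
      then have "(L2_norm f)\<^sup>2 \<le> q * L2_norm f + (L2_norm f)\<^sup>2 / 2"
        by (intro LIMSEQ_le_const2[OF energy_balls_tendsto[OF f]]) auto
      then have "L2_norm f * L2_norm f \<le> 2 * q * L2_norm f" by (simp add: power2_eq_square)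
      moreover have q0: "0 \<le> q" unfolding q_def using T0 A by simp
      ultimately have "L2_norm f \<le> 2 * q"
        using L2_norm_nonneg[of f] by (cases "L2_norm f = 0") (auto simp: mult_le_cancel_right)
      then have "(L2_norm f)\<^sup>2 \<le> (2 * q)\<^sup>2" by (intro power_mono) auto
      \<comment> \<open>Since M A = 1/8, the last term amounts to half of the squared norm of f and
        is absorbed on the left, leaving 8 M T.\<close>
      also have "(2 * q)\<^sup>2 = 4 * (real M * T + (L2_norm f)\<^sup>2 / 8)"
        unfolding q_def using T0 A M by (simp add: power_mult_distrib A_def distrib_left)
      finally have "(L2_norm f)\<^sup>2 \<le> 8 * real M * T" by simp
      then show "A * (L2_norm f)\<^sup>2 \<le> (\<Sum>\<^sub>\<infinity>i\<in>I. (cmod (L2_inner f (?g i)))\<^sup>2)"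
        unfolding T_eq A_def using M by (simp add: divide_le_eq mult_ac)
    qed
  qed
qed

end
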